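(* Let $G$ be a connected reductive algebraic group over an algebraically closed field $K$ of characteristic $\ell>0$, and let $F$ be a Steinberg endomorphism of $G$. Let $A\le G$ be a finite subgroup such that $F(A)$ and $A$ are conjugate in $G$. The following hold. (a) There exists a $G$-conjugate of $A$ which is $F$-stable. (b) Suppose $A$ has a $G$-conjugate in $G^F$. Replacing $A$ by this conjugate (so that $A\le G^F$), there is a bijection between the $G^F$-classes of subgroups of $G^F$ which are $G$-conjugate to $A$, and the $F$-classes in $N_G(A)/C_G(A)^\circ$ contained in $C_G(A)/C_G(A)^\circ$: the $F$-class of $w\in C_G(A)/C_G(A)^\circ$ corresponds to the $G^F$-class of subgroups with representative $A_w={}^gA$, where $g\in G$ is chosen with $g^{-1}F(g)C_G(A)^\circ=w$.
   Context: A Steinberg endomorphism of a linear algebraic group $G$ is an endomorphism $F:G\to G$ some power $F^m$ of which is a Frobenius morphism with respect to some $\mathbb F_q$-structure. $G^F$ is the (finite) group of fixed points. $H^\circ$ is the identity component of an algebraic group $H$, and ${}^gA=gAg^{-1}$. For finite $A\le G$ one has $N_G(A)^\circ=C_G(A)^\circ$. If $A\le G^F$, the $F$-class of a coset $uN_G(A)^\circ\in N_G(A)/N_G(A)^\circ$ is the set $\{F(g)ug^{-1}N_G(A)^\circ: g\in N_G(A)\}$.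
   Formalization: With F-classes {F(g)ug^{-1}C°} and g^{-1}F(g)C°=w, the stated correspondence is not well defined (it fails in PGL_3 for A cyclic of order 3); the formal version lets the class of A_w correspond to the F-class of w^{-1} instead of w. *)

theory Defs
  imports
    "HOL-Analysis.Abstract_Topology_2"
    "HOL-Algebra.Group_Action"
    "Jordan_Normal_Form.Determinant"
begin

section \<open>Linear algebraic groups\<close>

text \<open>Linear algebraic groups over \<open>K\<close> are realised as Zariski closed subgroups of
  \<open>GL\<^sub>n(K)\<close>, for arbitrary \<open>n\<close>.\<close>

definition GL :: "nat \<Rightarrow> 'a::field mat monoid" where
  "GL n = units_of (ring_mat TYPE('a) n ())"

text \<open>Elements of \<open>K[x\<^sub>i\<^sub>j, 1/det]\<close>, as functions on matrices; only their values
  on \<open>GL\<^sub>n\<close> matter.\<close>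

inductive_set regular_functions :: "nat \<Rightarrow> ('a::field mat \<Rightarrow> 'a) set" for n :: nat where
  const: "(\<lambda>_. c) \<in> regular_functions n"
| entry: "i < n \<Longrightarrow> j < n \<Longrightarrow> (\<lambda>x. x $$ (i, j)) \<in> regular_functions n"
| inv_det: "(\<lambda>x. inverse (det x)) \<in> regular_functions n"
| add: "f \<in> regular_functions n \<Longrightarrow> g \<in> regular_functions n \<Longrightarrow> (\<lambda>x. f x + g x) \<in> regular_functions n"
| mult: "f \<in> regular_functions n \<Longrightarrow> g \<in> regular_functions n \<Longrightarrow> (\<lambda>x. f x * g x) \<in> regular_functions n"

definition zariski_open :: "nat \<Rightarrow> 'a::field mat set \<Rightarrow> bool" where
  "zariski_open n U \<longleftrightarrow>
     (\<exists>S \<subseteq> regular_functions n. U = {x \<in> carrier (GL n). \<exists>f\<in>S. f x \<noteq> 0})"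

definition zariski :: "nat \<Rightarrow> 'a::field mat topology" where
  "zariski n = topology (zariski_open n)"

lemma istopology_zariski_open: "istopology (zariski_open n :: 'a::field mat set \<Rightarrow> bool)"
  unfolding istopology_def
proof (intro conjI allI impI)
  fix U V :: "'a mat set"
  assume "zariski_open n U" "zariski_open n V"
  then obtain S T where ST: "S \<subseteq> regular_functions n" "T \<subseteq> regular_functions n"
    and U: "U = {x \<in> carrier (GL n). \<exists>f\<in>S. f x \<noteq> 0}"
    and V: "V = {x \<in> carrier (GL n). \<exists>f\<in>T. f x \<noteq> 0}"
    unfolding zariski_open_def by blast
  let ?P = "{(\<lambda>x. f x * g x) |f g. f \<in> S \<and> g \<in> T}"
  have "?P \<subseteq> regular_functions n"
    using ST by (auto intro: regular_functions.mult)
  moreover have "U \<inter> V = {x \<in> carrier (GL n). \<exists>f\<in>?P. f x \<noteq> 0}"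
    unfolding U V by fastforce
  ultimately show "zariski_open n (U \<inter> V)"
    unfolding zariski_open_def by blast
next
  fix \<K> :: "'a mat set set"
  assume K: "\<forall>U\<in>\<K>. zariski_open n U"
  let ?S = "{f \<in> regular_functions n. {x \<in> carrier (GL n). f x \<noteq> 0} \<subseteq> \<Union>\<K>}"
  have "\<Union>\<K> = {x \<in> carrier (GL n). \<exists>f\<in>?S. f x \<noteq> 0}"
  proof
    show "\<Union>\<K> \<subseteq> {x \<in> carrier (GL n). \<exists>f\<in>?S. f x \<noteq> 0}"
    proof
      fix x assume "x \<in> \<Union>\<K>"
      then obtain U where U: "U \<in> \<K>" "x \<in> U" by blast
      then obtain S where S: "S \<subseteq> regular_functions n"
        "U = {x \<in> carrier (GL n). \<exists>f\<in>S. f x \<noteq> 0}"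
        using K unfolding zariski_open_def by blast
      with U obtain f where f: "f \<in> S" "f x \<noteq> 0" "x \<in> carrier (GL n)" by blast
      have "f \<in> ?S" using f S U(1) by blast
      with f show "x \<in> {x \<in> carrier (GL n). \<exists>f\<in>?S. f x \<noteq> 0}" by blast
    qed
  qed blast
  then show "zariski_open n (\<Union>\<K>)"
    unfolding zariski_open_def by (intro exI[of _ ?S]) blast
qed

lemma openin_zariski [simp]: "openin (zariski n) = zariski_open n"
  by (simp add: zariski_def istopology_zariski_open topology_inverse')

definition identity_component :: "nat \<Rightarrow> 'a::field mat set \<Rightarrow> 'a mat set" where
  "identity_component n H = connected_component_of_set (subtopology (zariski n) H) (1\<^sub>m n)"

definition linear_algebraic_group :: "nat \<Rightarrow> 'a::field mat monoid \<Rightarrow> bool" where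
  "linear_algebraic_group n G \<longleftrightarrow>
     G = GL n\<lparr>carrier := carrier G\<rparr> \<and>
     subgroup (carrier G) (GL n) \<and> closedin (zariski n) (carrier G)"

definition unipotent :: "nat \<Rightarrow> 'a::field mat \<Rightarrow> bool" where
  "unipotent n u \<longleftrightarrow> (\<exists>k. (u - 1\<^sub>m n) ^\<^sub>m k = 0\<^sub>m n n)"

text \<open>There is a largest closed connected normal unipotent subgroup; being the largest, it is
  the union of all of them.\<close>

definition unipotent_radical :: "nat \<Rightarrow> 'a::field mat monoid \<Rightarrow> 'a mat set" where
  "unipotent_radical n G =
     \<Union>{U. U \<lhd> G \<and> closedin (zariski n) U \<and> connectedin (zariski n) U \<and> (\<forall>u\<in>U. unipotent n u)}"

definition connected_reductive :: "nat \<Rightarrow> 'a::field mat monoid \<Rightarrow> bool" where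
  "connected_reductive n G \<longleftrightarrow>
     linear_algebraic_group n G \<and> connectedin (zariski n) (carrier G) \<and>
     unipotent_radical n G = {\<one>\<^bsub>G\<^esub>}"


section \<open>Steinberg endomorphisms\<close>

definition coordinate_ring :: "nat \<Rightarrow> 'a::field mat set \<Rightarrow> ('a mat \<Rightarrow> 'a) set" where
  "coordinate_ring n X = (\<lambda>f. restrict f X) ` regular_functions n"

text \<open>The inverse of the determinant need not be mentioned in the regularity condition:
  \<open>1 / det (F x) = det (F (inv x))\<close>, and inversion is regular.\<close>

definition algebraic_endomorphism ::
    "nat \<Rightarrow> 'a::field mat monoid \<Rightarrow> ('a mat \<Rightarrow> 'a mat) \<Rightarrow> bool" where
  "algebraic_endomorphism n G F \<longleftrightarrow>
     F \<in> hom G G \<and>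
     (\<forall>i<n. \<forall>j<n. (\<lambda>x\<in>carrier G. F x $$ (i, j)) \<in> coordinate_ring n (carrier G))"

definition independent_over ::
    "'a::field set \<Rightarrow> 'b set \<Rightarrow> ('b \<Rightarrow> 'a) set \<Rightarrow> bool" where
  "independent_over k X T \<longleftrightarrow>
     (\<forall>c. (\<forall>t\<in>T. c t \<in> k) \<and> (\<forall>x\<in>X. (\<Sum>t\<in>T. c t * t x) = 0) \<longrightarrow> (\<forall>t\<in>T. c t = 0))"

text \<open>For \<open>q\<close> a power of the characteristic, the subfield with \<open>q\<close> elements.\<close>

definition Fq :: "nat \<Rightarrow> 'a::field set" where
  "Fq q = {c. c ^ q = c}"

text \<open>An \<open>\<F>\<^sub>q\<close>-structure on \<open>X\<close> is an \<open>\<F>\<^sub>q\<close>-subalgebra \<open>R\<close> of \<open>K[X]\<close> such that the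
  multiplication map from the tensor product of \<open>K\<close> and \<open>R\<close> over \<open>\<F>\<^sub>q\<close> to \<open>K[X]\<close> is bijective;
  the last two conjuncts are its surjectivity and injectivity.\<close>

definition Fq_structure ::
    "nat \<Rightarrow> nat \<Rightarrow> 'a::field mat set \<Rightarrow> ('a mat \<Rightarrow> 'a) set \<Rightarrow> bool" where
  "Fq_structure q n X R \<longleftrightarrow>
     R \<subseteq> coordinate_ring n X \<and>
     (\<forall>c\<in>Fq q. (\<lambda>x\<in>X. c) \<in> R) \<and>
     (\<forall>f\<in>R. \<forall>g\<in>R. (\<lambda>x\<in>X. f x + g x) \<in> R \<and> (\<lambda>x\<in>X. f x * g x) \<in> R) \<and>
     (\<forall>f\<in>coordinate_ring n X. \<exists>T c. finite T \<and> T \<subseteq> R \<and> (\<forall>x\<in>X. f x = (\<Sum>t\<in>T. c t * t x))) \<and>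
     (\<forall>T. finite T \<and> T \<subseteq> R \<and> independent_over (Fq q) X T \<longrightarrow> independent_over UNIV X T)"

text \<open>The Frobenius morphism raises the functions in the \<open>\<F>\<^sub>q\<close>-form \<open>R\<close> to the \<open>q\<close>-th power,
  which determines it. If it is a group endomorphism, then multiplication and inversion
  are automatically defined over \<open>\<F>\<^sub>q\<close>.\<close>

definition frobenius_morphism ::
    "nat \<Rightarrow> 'a::field mat set \<Rightarrow> ('a mat \<Rightarrow> 'a) set \<Rightarrow> ('a mat \<Rightarrow> 'a mat) \<Rightarrow> bool" where
  "frobenius_morphism q X R \<phi> \<longleftrightarrow> \<phi> \<in> X \<rightarrow> X \<and> (\<forall>f\<in>R. \<forall>x\<in>X. f (\<phi> x) = f x ^ q)"

definition steinberg_endomorphism ::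
    "nat \<Rightarrow> 'a::field mat monoid \<Rightarrow> ('a mat \<Rightarrow> 'a mat) \<Rightarrow> bool" where
  "steinberg_endomorphism n G F \<longleftrightarrow>
     algebraic_endomorphism n G F \<and>
     (\<exists>m\<ge>1. \<exists>e\<ge>1. \<exists>R. Fq_structure (CHAR('a) ^ e) n (carrier G) R \<and>
        frobenius_morphism (CHAR('a) ^ e) (carrier G) R (F ^^ m))"

definition fixed_points :: "('a, 'b) monoid_scheme \<Rightarrow> ('a \<Rightarrow> 'a) \<Rightarrow> 'a set" where
  "fixed_points G F = {g \<in> carrier G. F g = g}"


section \<open>Conjugacy and \<open>F\<close>-classes\<close>

definition conj_by :: "('a, 'b) monoid_scheme \<Rightarrow> 'a \<Rightarrow> 'a set \<Rightarrow> 'a set" where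
  "conj_by G g A = g <#\<^bsub>G\<^esub> A #>\<^bsub>G\<^esub> inv\<^bsub>G\<^esub> g"

definition conj_class :: "('a, 'b) monoid_scheme \<Rightarrow> 'a set \<Rightarrow> 'a set \<Rightarrow> 'a set set" where
  "conj_class G H A = (\<lambda>h. conj_by G h A) ` H"

definition centralizer :: "('a, 'b) monoid_scheme \<Rightarrow> 'a set \<Rightarrow> 'a set" where
  "centralizer G A = {g \<in> carrier G. \<forall>a\<in>A. g \<otimes>\<^bsub>G\<^esub> a = a \<otimes>\<^bsub>G\<^esub> g}"

text \<open>The \<open>F\<close>-class of the coset \<open>u Q\<close> in \<open>N / Q\<close>, as a set of cosets. Pitfall: if
  \<open>g\<close> is replaced by \<open>g n\<close> with \<open>n\<close> in \<open>N\<close>, then \<open>w = g\<^sup>-\<^sup>1 F(g)\<close> becomes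
  \<open>n\<^sup>-\<^sup>1 w F(n)\<close>, which need not lie in the \<open>F\<close>-class of \<open>w\<close>. It is the \<open>F\<close>-class of
  \<open>w\<^sup>-\<^sup>1\<close> that is unchanged.\<close>

definition F_class ::
    "('a, 'b) monoid_scheme \<Rightarrow> ('a \<Rightarrow> 'a) \<Rightarrow> 'a set \<Rightarrow> 'a set \<Rightarrow> 'a \<Rightarrow> 'a set set" where
  "F_class G F N Q u = (\<lambda>g. (F g \<otimes>\<^bsub>G\<^esub> u \<otimes>\<^bsub>G\<^esub> inv\<^bsub>G\<^esub> g) <#\<^bsub>G\<^esub> Q) ` N"

end

theory Submission
  imports Defs "Jordan_Normal_Form.Char_Poly" "HOL-Library.Function_Algebras"
begin

text \<open>The group theory in this proposition rests on one theorem of algebraic geometry, the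
Lang--Steinberg theorem: if \<open>H\<close> is a closed connected subgroup of \<open>G\<close> with \<open>F(H) \<subseteq> H\<close>, then
every element of \<open>H\<close> has the form \<open>L(x) = x\<^sup>-\<^sup>1 F(x)\<close> with \<open>x \<in> H\<close>.

Part (a): if \<open>F(A) = g A g\<^sup>-\<^sup>1\<close>, choose \<open>x\<close> with \<open>x\<^sup>-\<^sup>1 F(x) = g\<^sup>-\<^sup>1\<close>; then \<open>x A x\<^sup>-\<^sup>1\<close> is
\<open>F\<close>-stable.

Part (b): let \<open>B \<le> G\<^sup>F\<close>, \<open>C\<close> its centralizer, \<open>N\<close> its normalizer and \<open>Q\<close> the identity component
of \<open>C\<close>. Comparing \<open>F(g b g\<^sup>-\<^sup>1)\<close> with \<open>g b g\<^sup>-\<^sup>1\<close> shows that \<open>g B g\<^sup>-\<^sup>1 \<le> G\<^sup>F\<close> if and only if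
\<open>L(g) \<in> C\<close>. The elements conjugating \<open>B\<close> into the same \<open>G\<^sup>F\<close>-class as \<open>g\<close> are the
\<open>x g n\<close> with \<open>x \<in> G\<^sup>F\<close> and \<open>n \<in> N\<close>, and \<open>L(x g n)\<^sup>-\<^sup>1 = F(n)\<^sup>-\<^sup>1 L(g)\<^sup>-\<^sup>1 n\<close>; so the class of
\<open>g B g\<^sup>-\<^sup>1\<close> determines the \<open>F\<close>-class of \<open>L(g)\<^sup>-\<^sup>1\<close>. Conversely, if two such \<open>F\<close>-classes agree
modulo \<open>Q\<close>, then the Lang--Steinberg theorem for the connected \<open>F\<close>-stable group \<open>g Q g\<^sup>-\<^sup>1\<close>
removes the ambiguity by an element of \<open>Q\<close>, which centralizes \<open>B\<close>. By the
Lang--Steinberg theorem for \<open>G\<close> all elements of \<open>C\<close> occur as \<open>L(g)\<close>.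
This part is \<open>lang_conjugacy.classes_bijection\<close>.

The Lang--Steinberg theorem is a statement of commutative algebra about the pullback \<open>L\<^sup>*\<close>.

\<^item> \<open>K[H]\<close> is integral over \<open>L\<^sup>* K[H]\<close> (\<open>integral_over_L\<close>). Let \<open>\<phi> = F\<^sup>m\<close> be the Frobenius
  morphism. There is a regular \<open>P\<close> with \<open>\<phi>(x) = x P(L(x))\<close>. For \<open>u\<close> a matrix entry or the
  inverse determinant, the functions \<open>v\<close> with \<open>v ^ q ^ k = u \<circ> \<phi>\<^sup>k\<close> are regular; finitely many of
  them with \<open>k \<ge> 1\<close> span a space that contains all the functions \<open>u\<close>, and each \<open>v ^ q\<close> is a
  combination of members of this family with coefficients in \<open>L\<^sup>* K[H]\<close>.

\<^item> \<open>H\<close> is irreducible (\<open>connected_group_irreducible\<close>), so \<open>K[H]\<close> is a Noetherian domain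
  (Noetherian by \<open>hilbert_basis\<close>).

\<^item> An endomorphism of a Noetherian domain over whose image the domain is integral is injective
  (\<open>integral_pullback_injective\<close>): otherwise the kernels of its powers would increase strictly.

\<^item> Lying over and the Nullstellensatz for integral extensions then give surjectivity of \<open>L\<close>
  (\<open>integral_map_surjective\<close>).\<close>

section \<open>Noetherian rings and the Hilbert basis theorem\<close>

text \<open>Rings appear as subsets of a commutative ring type, so that adjoining a generator
changes the set but not the type.\<close>

definition is_subring :: "'r::comm_ring_1 set \<Rightarrow> bool" where
  "is_subring B \<longleftrightarrow> 0 \<in> B \<and> 1 \<in> B \<and>
     (\<forall>a\<in>B. - a \<in> B) \<and> (\<forall>a\<in>B. \<forall>b\<in>B. a + b \<in> B \<and> a * b \<in> B)"

definition ideal_in :: "'r::comm_ring_1 set \<Rightarrow> 'r set \<Rightarrow> bool" where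
  "ideal_in B J \<longleftrightarrow> J \<subseteq> B \<and> 0 \<in> J \<and>
     (\<forall>a\<in>J. \<forall>b\<in>J. a + b \<in> J) \<and> (\<forall>r\<in>B. \<forall>a\<in>J. r * a \<in> J)"

definition ideal_hull :: "'r::comm_ring_1 set \<Rightarrow> 'r set \<Rightarrow> 'r set" where
  "ideal_hull B S = \<Inter>{J. ideal_in B J \<and> S \<subseteq> J}"

definition noetherian :: "'r::comm_ring_1 set \<Rightarrow> bool" where
  "noetherian B \<longleftrightarrow>
     (\<forall>J. ideal_in B J \<longrightarrow> (\<exists>S. finite S \<and> S \<subseteq> J \<and> J \<subseteq> ideal_hull B S))"

lemma noetherianE:
  assumes "noetherian B" "ideal_in B J"
  obtains S where "finite S" "S \<subseteq> J" "J \<subseteq> ideal_hull B S"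
  using assms unfolding noetherian_def by blast

lemma is_subringD:
  assumes "is_subring B"
  shows "0 \<in> B" "1 \<in> B" "a \<in> B \<Longrightarrow> - a \<in> B" "a \<in> B \<Longrightarrow> b \<in> B \<Longrightarrow> a + b \<in> B"
    "a \<in> B \<Longrightarrow> b \<in> B \<Longrightarrow> a * b \<in> B"
  using assms by (auto simp: is_subring_def)

lemma is_subring_sum:
  assumes "is_subring B" "\<And>i. i \<in> I \<Longrightarrow> f i \<in> B"
  shows "sum f I \<in> B"
  using assms(2) by (induction I rule: infinite_finite_induct) (auto simp: is_subringD[OF assms(1)])

lemma is_subring_power:
  assumes "is_subring B" "a \<in> B"
  shows "a ^ k \<in> B"
  by (induction k) (use assms in \<open>auto simp: is_subringD\<close>)

lemma ideal_inD:
  assumes "ideal_in B J"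
  shows "J \<subseteq> B" "0 \<in> J" "a \<in> J \<Longrightarrow> b \<in> J \<Longrightarrow> a + b \<in> J" "r \<in> B \<Longrightarrow> a \<in> J \<Longrightarrow> r * a \<in> J"
  using assms by (auto simp: ideal_in_def)

lemma ideal_in_minus:
  assumes "is_subring B" "ideal_in B J" "a \<in> J" "b \<in> J"
  shows "a - b \<in> J"
proof -
  have "(- 1) * b \<in> J"
    by (rule ideal_inD(4)[OF assms(2)]) (use assms is_subringD in auto)
  from ideal_inD(3)[OF assms(2,3) this] show ?thesis by simp
qed

lemma ideal_in_self: "is_subring B \<Longrightarrow> ideal_in B B"
  by (simp add: ideal_in_def is_subringD)

lemma subset_ideal_hull: "S \<subseteq> ideal_hull B S"
  by (auto simp: ideal_hull_def)

lemma ideal_hull_least: "ideal_in B J \<Longrightarrow> S \<subseteq> J \<Longrightarrow> ideal_hull B S \<subseteq> J"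
  by (auto simp: ideal_hull_def)

lemma ideal_hull_mono: "S \<subseteq> T \<Longrightarrow> ideal_hull B S \<subseteq> ideal_hull B T"
  by (auto simp: ideal_hull_def)

lemma ideal_in_hull:
  assumes "is_subring B" "S \<subseteq> B"
  shows "ideal_in B (ideal_hull B S)"
proof -
  have "ideal_hull B S \<subseteq> B"
    using assms by (intro ideal_hull_least ideal_in_self)
  then show ?thesis
    unfolding ideal_in_def ideal_hull_def by auto
qed

lemma noetherian_ascending_chain:
  assumes "is_subring B" "noetherian B" "\<And>k::nat. ideal_in B (J k)" "mono J"
  shows "\<exists>M. \<forall>k. J k \<subseteq> J M"
proof -
  have "ideal_in B (\<Union>k. J k)"
    unfolding ideal_in_def
  proof (intro conjI ballI)
    show "(\<Union>k. J k) \<subseteq> B" "0 \<in> (\<Union>k. J k)"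
      using ideal_inD(1,2)[OF assms(3)] by auto
    show "r * a \<in> (\<Union>k. J k)" if "r \<in> B" "a \<in> (\<Union>k. J k)" for r a
      using that ideal_inD(4)[OF assms(3)] by blast
    show "a + b \<in> (\<Union>k. J k)" if ab: "a \<in> (\<Union>k. J k)" "b \<in> (\<Union>k. J k)" for a b
    proof -
      from ab obtain i j where "a \<in> J i" "b \<in> J j" by blast
      then have "a \<in> J (max i j)" "b \<in> J (max i j)"
        using monoD[OF assms(4), of i "max i j"] monoD[OF assms(4), of j "max i j"] by auto
      then show ?thesis using ideal_inD(3)[OF assms(3)] by blast
    qed
  qed
  then obtain S where S: "finite S" "S \<subseteq> (\<Union>k. J k)" "(\<Union>k. J k) \<subseteq> ideal_hull B S"
    using noetherianE[OF assms(2)] by metis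
  have "\<exists>M. S \<subseteq> J M"
    using S(1,2)
  proof (induction S)
    case (insert s S)
    then obtain M i where "S \<subseteq> J M" "s \<in> J i" by auto
    then have "insert s S \<subseteq> J (max i M)"
      using monoD[OF assms(4), of i "max i M"] monoD[OF assms(4), of M "max i M"] by auto
    then show ?case by blast
  qed simp
  then obtain M where "S \<subseteq> J M" ..
  then have "(\<Union>k. J k) \<subseteq> J M"
    using S(3) ideal_hull_least[OF assms(3)] by blast
  then show ?thesis by blast
qed

lemma noetherian_maximal_ideal:
  assumes "is_subring B" "noetherian B" "P I0" "\<And>I. P I \<Longrightarrow> ideal_in B I"
  shows "\<exists>I. P I \<and> (\<forall>J. P J \<longrightarrow> I \<subseteq> J \<longrightarrow> J = I)"
proof -
  let ?R = "{(J, I). P I \<and> P J \<and> I \<subset> J}"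
  have "wf ?R"
    unfolding wf_iff_no_infinite_down_chain
  proof
    assume "\<exists>f. \<forall>i. (f (Suc i), f i) \<in> ?R"
    then obtain f where "\<forall>i. P (f i) \<and> P (f (Suc i)) \<and> f i \<subset> f (Suc i)" by auto
    then have f: "\<And>i. P (f i)" "\<And>i. f i \<subset> f (Suc i)" by blast+
    have "mono f" using f(2) by (intro mono_iff_le_Suc[THEN iffD2]) auto
    from noetherian_ascending_chain[OF assms(1,2) assms(4)[OF f(1)] this]
    obtain M where "\<And>k. f k \<subseteq> f M" by blast
    with f(2)[of M] show False by blast
  qed
  then have "\<forall>Q x. x \<in> Q \<longrightarrow> (\<exists>z\<in>Q. \<forall>y. (y, z) \<in> ?R \<longrightarrow> y \<notin> Q)"
    by (simp only: wf_eq_minimal)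
  then have "\<exists>I\<in>Collect P. \<forall>J. (J, I) \<in> ?R \<longrightarrow> J \<notin> Collect P"
    using CollectI[of P, OF assms(3)] by blast
  then obtain I where I: "P I" "\<And>J. (J, I) \<in> ?R \<Longrightarrow> \<not> P J" by blast
  have "J = I" if "P J" "I \<subseteq> J" for J
    using I(2)[of J] I(1) that by blast
  with I(1) show ?thesis by blast
qed

definition poly_over :: "'r::comm_ring_1 set \<Rightarrow> 'r poly set" where
  "poly_over B = {p. \<forall>i. coeff p i \<in> B}"

lemma is_subring_poly_over:
  assumes "is_subring B"
  shows "is_subring (poly_over B)"
  unfolding is_subring_def poly_over_def
proof (intro conjI ballI CollectI allI)
  show "coeff 0 i \<in> B" for i using is_subringD(1)[OF assms] by simp
  show "coeff 1 i \<in> B" for i using is_subringD(1,2)[OF assms] by (simp add: coeff_1)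
  fix p i assume p: "p \<in> {p. \<forall>i. coeff p i \<in> B}"
  then show "coeff (- p) i \<in> B" using is_subringD(3)[OF assms] by simp
  fix q assume q: "q \<in> {p. \<forall>i. coeff p i \<in> B}"
  then show "coeff (p + q) i \<in> B" using p is_subringD(4)[OF assms] by simp
  show "coeff (p * q) i \<in> B"
    unfolding coeff_mult using p q
    by (intro is_subring_sum[OF assms] is_subringD(5)[OF assms]) auto
qed

lemma monom_poly_over: "is_subring B \<Longrightarrow> a \<in> B \<Longrightarrow> monom a k \<in> poly_over B"
  by (auto simp: poly_over_def is_subringD)

text \<open>If an ideal \<open>J\<close> were not finitely generated, one could keep choosing \<open>p\<^sub>k\<close> of least degree
outside the ideal generated by its predecessors. The coefficients in degree \<open>deg p\<^sub>k\<close> of the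
elements of that ideal of at most this degree form an ascending chain of ideals of \<open>B\<close>, since the
degrees do not decrease. When the chain becomes stationary, the leading coefficient of \<open>p\<^sub>M\<close> is matched
by an element generated before, and the difference contradicts the minimality of the degree.\<close>

theorem hilbert_basis:
  fixes B :: "'r::comm_ring_1 set"
  assumes B: "is_subring B" and "noetherian B"
  shows "noetherian (poly_over B)"
  unfolding noetherian_def
proof (intro allI impI, rule ccontr)
  fix J
  let ?hull = "ideal_hull (poly_over B)"
  note BX = is_subring_poly_over[OF B]
  assume J: "ideal_in (poly_over B) J"
    and neg: "\<not> (\<exists>S. finite S \<and> S \<subseteq> J \<and> J \<subseteq> ?hull S)"
  define pick where "pick S = (ARG_MIN degree p. p \<in> J - ?hull S)" for S
  have pick: "pick S \<in> J - ?hull S" "\<And>p. p \<in> J - ?hull S \<Longrightarrow> degree (pick S) \<le> degree p"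
    if "finite S" "S \<subseteq> J" for S
  proof -
    have "\<not> J \<subseteq> ?hull S"
      by (rule notI, rule notE[OF neg]) (intro exI[of _ S] conjI that)
    then obtain p0 where p0: "p0 \<in> J - ?hull S" by blast
    show "pick S \<in> J - ?hull S"
      unfolding pick_def by (rule arg_min_natI, rule p0)
    show "degree (pick S) \<le> degree p" if "p \<in> J - ?hull S" for p
      unfolding pick_def using arg_min_nat_le[of "\<lambda>p. p \<in> J - ?hull S", OF that] .
  qed
  define L where "L = rec_nat {} (\<lambda>_ S. insert (pick S) S)"
  define p where "p k = pick (L k)" for k
  define d where "d k = degree (p k)" for k
  have L_Suc: "L (Suc k) = insert (p k) (L k)" for k
    by (simp add: L_def p_def)
  have L: "finite (L k) \<and> L k \<subseteq> J" for k
    by (induction k) (use pick(1) in \<open>auto simp: L_Suc p_def L_def\<close>)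
  note pJ = pick(1)[OF conjunct1[OF L] conjunct2[OF L], folded p_def]
  note p_min = pick(2)[OF conjunct1[OF L] conjunct2[OF L], folded p_def]
  have hullL: "ideal_in (poly_over B) (?hull (L k))" for k
    using L[of k] ideal_inD(1)[OF J] by (intro ideal_in_hull BX) blast
  have hull_J: "?hull (L k) \<subseteq> J" for k
    using L by (intro ideal_hull_least J) auto
  have d_Suc: "d k \<le> d (Suc k)" for k
    unfolding d_def
    using p_min[of "p (Suc k)" k] pJ[of "Suc k"] ideal_hull_mono[of "L k" "L (Suc k)" "poly_over B"]
    by (auto simp: L_Suc)
  define C where "C k = {a. \<exists>q\<in>?hull (L k). degree q \<le> d k \<and> coeff q (d k) = a}" for k
  have C_ideal: "ideal_in B (C k)" for k
    unfolding ideal_in_def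
  proof (intro conjI ballI)
    show "C k \<subseteq> B"
      using ideal_inD(1)[OF hullL[of k]] by (auto simp: C_def poly_over_def)
    show "0 \<in> C k"
      unfolding C_def using ideal_inD(2)[OF hullL[of k]] by force
    show "a + b \<in> C k" if "a \<in> C k" "b \<in> C k" for a b
    proof -
      from that obtain q r where "q \<in> ?hull (L k)" "r \<in> ?hull (L k)" "degree q \<le> d k"
        "degree r \<le> d k" "coeff q (d k) = a" "coeff r (d k) = b"
        unfolding C_def by blast
      then show ?thesis
        unfolding C_def using ideal_inD(3)[OF hullL[of k], of q r] degree_add_le[of q "d k" r]
        by force
    qed
    show "r * a \<in> C k" if "r \<in> B" "a \<in> C k" for r a
    proof -
      from that obtain q where q: "q \<in> ?hull (L k)" "degree q \<le> d k" "coeff q (d k) = a"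
        unfolding C_def by blast
      have "Polynomial.smult r q \<in> ?hull (L k)"
        using ideal_inD(4)[OF hullL[of k] monom_poly_over[OF B that(1), of 0] q(1)]
        by (simp add: monom_0)
      moreover have "degree (Polynomial.smult r q) \<le> d k"
        using degree_smult_le[of r q] q(2) by linarith
      ultimately show ?thesis
        unfolding C_def using q(3) by force
    qed
  qed
  have shift: "coeff q (d k) \<in> C (Suc k)" if "q \<in> ?hull (L (Suc k))" "degree q \<le> d k" for q k
  proof -
    let ?m = "monom 1 (d (Suc k) - d k)"
    have "?m * q \<in> ?hull (L (Suc k))"
      by (rule ideal_inD(4)[OF hullL]) (use that in \<open>auto intro!: monom_poly_over B is_subringD\<close>)
    moreover have "degree (?m * q) \<le> d (Suc k)"
      using degree_mult_le[of ?m q] degree_monom_le[of 1 "d (Suc k) - d k"] that(2) d_Suc[of k]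
      by (meson add_le_mono le_diff_conv2 le_trans order_refl)
    moreover have "coeff (?m * q) (d (Suc k)) = coeff q (d k)"
      using d_Suc[of k] by (simp add: coeff_monom_mult)
    ultimately show ?thesis
      unfolding C_def mem_Collect_eq by (intro bexI[of _ "?m * q"] conjI)
  qed
  have "mono C"
  proof (rule mono_iff_le_Suc[THEN iffD2], intro allI subsetI)
    fix k a assume "a \<in> C k"
    then obtain q where q: "q \<in> ?hull (L k)" "degree q \<le> d k" "coeff q (d k) = a"
      unfolding C_def by blast
    have "L k \<subseteq> L (Suc k)" by (auto simp: L_Suc)
    from shift[OF ideal_hull_mono[OF this, THEN subsetD, OF q(1)] q(2)] q(3)
    show "a \<in> C (Suc k)" by simp
  qed
  then obtain M where "\<forall>k. C k \<subseteq> C M"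
    using noetherian_ascending_chain[where J = C, OF B assms(2) C_ideal] by (elim meta_impE exE)
  then have M: "C k \<subseteq> C M" for k by (rule spec)
  have "coeff (p M) (d M) \<in> C (Suc M)"
    by (rule shift) (use subset_ideal_hull[of "L (Suc M)"] in \<open>auto simp: L_Suc d_def\<close>)
  then obtain q where q: "q \<in> ?hull (L M)" "degree q \<le> d M" "coeff q (d M) = coeff (p M) (d M)"
    using M[of "Suc M"] unfolding C_def[of M] by blast
  let ?r = "p M - q"
  have "?r \<in> J"
    by (rule ideal_in_minus[OF BX J]) (use pJ[of M] q(1) hull_J in auto)
  moreover have "?r \<notin> ?hull (L M)"
    using ideal_inD(3)[OF hullL q(1), of ?r] pJ[of M] by auto
  ultimately have "d M \<le> degree ?r"
    using p_min[of ?r M] by (auto simp: d_def)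
  moreover have "degree ?r \<le> d M"
    using q(2) by (intro degree_diff_le) (auto simp: d_def)
  ultimately have "lead_coeff ?r = 0"
    using q(3) by (metis coeff_diff diff_self le_antisym)
  then have "?r = 0" by (simp only: leading_coeff_0_iff)
  with \<open>?r \<notin> ?hull (L M)\<close> show False
    using ideal_inD(2)[OF hullL] by simp
qed

lemma noetherian_image:
  fixes h :: "'r::comm_ring_1 \<Rightarrow> 's::comm_ring_1"
  assumes "is_subring B" "noetherian B"
    and h: "h 0 = 0" "\<And>a b. h (a + b) = h a + h b" "\<And>a b. h (a * b) = h a * h b"
  shows "noetherian (h ` B)"
  unfolding noetherian_def
proof (intro allI impI)
  have vimage: "ideal_in B {b \<in> B. h b \<in> J}" if J: "ideal_in (h ` B) J" for J
    unfolding ideal_in_def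
  proof (intro conjI ballI)
    show "{b \<in> B. h b \<in> J} \<subseteq> B" by blast
    show "0 \<in> {b \<in> B. h b \<in> J}"
      using ideal_inD(2)[OF J] is_subringD(1)[OF assms(1)] by (simp add: h)
    show "a + b \<in> {b \<in> B. h b \<in> J}" if "a \<in> {b \<in> B. h b \<in> J}" "b \<in> {b \<in> B. h b \<in> J}" for a b
      using that ideal_inD(3)[OF J, of "h a" "h b"] is_subringD(4)[OF assms(1), of a b] by (simp add: h)
    show "r * a \<in> {b \<in> B. h b \<in> J}" if "r \<in> B" "a \<in> {b \<in> B. h b \<in> J}" for r a
      using that ideal_inD(4)[OF J, of "h r" "h a"] is_subringD(5)[OF assms(1), of r a] by (simp add: h)
  qed
  fix J assume J: "ideal_in (h ` B) J"
  obtain S where S: "finite S" "S \<subseteq> {b \<in> B. h b \<in> J}" "{b \<in> B. h b \<in> J} \<subseteq> ideal_hull B S"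
    by (rule noetherianE[OF assms(2) vimage[OF J]])
  have "J \<subseteq> ideal_hull (h ` B) (h ` S)"
  proof
    fix a assume "a \<in> J"
    with ideal_inD(1)[OF J] obtain b where b: "a = h b" "b \<in> B" by blast
    have "h b \<in> J'" if "ideal_in (h ` B) J'" "h ` S \<subseteq> J'" for J'
    proof -
      have "ideal_hull B S \<subseteq> {b \<in> B. h b \<in> J'}"
        by (rule ideal_hull_least[OF vimage[OF that(1)]]) (use that S in auto)
      then show ?thesis using S(3) b \<open>a \<in> J\<close> by blast
    qed
    then show "a \<in> ideal_hull (h ` B) (h ` S)"
      by (auto simp: ideal_hull_def b)
  qed
  then show "\<exists>S. finite S \<and> S \<subseteq> J \<and> J \<subseteq> ideal_hull (h ` B) S"
    using S by (intro exI[of _ "h ` S"]) auto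
qed

definition adjoin :: "'r::comm_ring_1 \<Rightarrow> 'r set \<Rightarrow> 'r set" where
  "adjoin g B = (\<lambda>p. poly p g) ` poly_over B"

lemma adjoin_noetherian: "is_subring B \<Longrightarrow> noetherian B \<Longrightarrow> noetherian (adjoin g B)"
  unfolding adjoin_def
  by (intro noetherian_image is_subring_poly_over hilbert_basis) auto

lemma adjoinI: "p \<in> poly_over B \<Longrightarrow> poly p g = a \<Longrightarrow> a \<in> adjoin g B"
  unfolding adjoin_def by blast

lemma adjoin_subring:
  assumes "is_subring B"
  shows "is_subring (adjoin g B)"
proof -
  note BX = is_subringD[OF is_subring_poly_over[OF assms]]
  show ?thesis
    unfolding is_subring_def
  proof (intro conjI ballI)
    show "0 \<in> adjoin g B" by (rule adjoinI[OF BX(1)]) simp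
    show "1 \<in> adjoin g B" by (rule adjoinI[OF BX(2)]) simp
    fix a assume "a \<in> adjoin g B"
    then obtain p where p: "a = poly p g" "p \<in> poly_over B" unfolding adjoin_def by blast
    show "- a \<in> adjoin g B" by (rule adjoinI[OF BX(3)[OF p(2)]]) (simp add: p)
    fix b assume "b \<in> adjoin g B"
    then obtain q where q: "b = poly q g" "q \<in> poly_over B" unfolding adjoin_def by blast
    show "a + b \<in> adjoin g B" by (rule adjoinI[OF BX(4)[OF p(2) q(2)]]) (simp add: p q)
    show "a * b \<in> adjoin g B" by (rule adjoinI[OF BX(5)[OF p(2) q(2)]]) (simp add: p q)
  qed
qed

lemma adjoin_contains:
  assumes "is_subring B"
  shows "g \<in> adjoin g B" "B \<subseteq> adjoin g B"
proof -
  show "g \<in> adjoin g B"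
    by (rule adjoinI[OF monom_poly_over[OF assms is_subringD(2)[OF assms], of 1]])
      (simp add: poly_monom)
  show "B \<subseteq> adjoin g B"
    by (rule subsetI, rule adjoinI[OF monom_poly_over[OF assms, of _ 0]])
      (simp_all add: poly_monom)
qed

lemma adjoin_least:
  assumes "is_subring R" "g \<in> R" "B \<subseteq> R"
  shows "adjoin g B \<subseteq> R"
proof
  fix a assume "a \<in> adjoin g B"
  then obtain p where p: "a = poly p g" "p \<in> poly_over B" unfolding adjoin_def by blast
  have "coeff p i \<in> R" for i using p(2) assms(3) by (auto simp: poly_over_def)
  then show "a \<in> R"
    unfolding p(1) poly_altdef
    by (intro is_subring_sum[OF assms(1)] is_subringD(5)[OF assms(1)]
        is_subring_power[OF assms(1,2)])
qed

text \<open>The finite set \<open>E\<close> generates \<open>R\<close> over \<open>B\<close>, which is expressed by minimality of \<open>R\<close>; adjoining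
its elements one at a time reduces to the Hilbert basis theorem.\<close>

lemma noetherian_finitely_generated:
  fixes R :: "'r::comm_ring_1 set"
  assumes B: "is_subring B" "noetherian B" and "finite E" and R: "is_subring R" "B \<subseteq> R" "E \<subseteq> R"
    and least: "\<And>R'. is_subring R' \<Longrightarrow> B \<subseteq> R' \<Longrightarrow> E \<subseteq> R' \<Longrightarrow> R \<subseteq> R'"
  shows "noetherian R"
proof -
  let ?P = "\<lambda>E R'. is_subring R' \<and> noetherian R' \<and> B \<subseteq> R' \<and> E \<subseteq> R' \<and> R' \<subseteq> R"
  have "\<exists>R'. ?P E R'"
    using \<open>finite E\<close> R(3)
  proof (induction E)
    case empty
    have "?P {} B" using B R by simp
    then show ?case by (rule exI)
  next
    case (insert g E)
    from insert.prems have "E \<subseteq> R" by blast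
    then obtain R' where "?P E R'" using insert.IH by blast
    then have R': "is_subring R'" "noetherian R'" "B \<subseteq> R'" "E \<subseteq> R'" "R' \<subseteq> R" by simp_all
    have "adjoin g R' \<subseteq> R" using R' insert.prems by (intro adjoin_least R(1)) auto
    moreover have "B \<subseteq> adjoin g R'" "insert g E \<subseteq> adjoin g R'"
      using R'(3,4) adjoin_contains[OF R'(1), of g] by blast+
    ultimately have "?P (insert g E) (adjoin g R')"
      using adjoin_noetherian[OF R'(1,2), of g] adjoin_subring[OF R'(1), of g] by simp
    then show ?case by (rule exI)
  qed
  then obtain R' where R': "?P E R'" by (rule exE)
  then have "R \<subseteq> R'" by (intro least) simp_all
  with R' have "R = R'" by blast
  with R' show ?thesis by simp
qed

section \<open>Regular functions and regular maps\<close>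

lemma GL_iff: "x \<in> carrier (GL n) \<longleftrightarrow> x \<in> carrier_mat n n \<and> det (x::'a::field mat) \<noteq> 0"
proof -
  have "x \<in> carrier (GL n) \<longleftrightarrow> x \<in> Units (ring_mat TYPE('a) n ())"
    by (simp add: GL_def units_of_def)
  also have "\<dots> \<longleftrightarrow> x \<in> carrier_mat n n \<and> det x \<noteq> 0"
    using unit_imp_det_non_zero[of x n "()"] det_non_zero_imp_unit[of x n "()"]
    by (auto simp: Units_def ring_mat_simps)
  finally show ?thesis .
qed

lemma group_GL: "group (GL n :: 'a::field mat monoid)"
proof -
  interpret ring "ring_mat TYPE('a) n ()" by (rule ring_mat)
  show ?thesis unfolding GL_def by (rule units_group)
qed

lemma mult_GL [simp]: "x \<otimes>\<^bsub>GL n\<^esub> y = x * y"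
  and one_GL [simp]: "\<one>\<^bsub>GL n\<^esub> = 1\<^sub>m n"
  by (simp_all add: GL_def units_of_def ring_mat_simps)

lemma regular_functions_subring: "is_subring (regular_functions n :: ('a::field mat \<Rightarrow> 'a) set)"
proof -
  have "(\<lambda>x. (- 1) * f x) \<in> regular_functions n" if "f \<in> regular_functions n" for f :: "'a mat \<Rightarrow> 'a"
    using regular_functions.mult[OF regular_functions.const that] .
  then show ?thesis
    by (auto simp: is_subring_def zero_fun_def one_fun_def plus_fun_def times_fun_def fun_Compl_def
        intro: regular_functions.intros)
qed

lemma noetherian_constants: "noetherian (range (\<lambda>c::'a::field. \<lambda>_::'b. c))"
  unfolding noetherian_def
proof (intro allI impI)
  let ?B = "range (\<lambda>c::'a. \<lambda>_::'b. c)"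
  fix J assume J: "ideal_in ?B J"
  show "\<exists>S. finite S \<and> S \<subseteq> J \<and> J \<subseteq> ideal_hull ?B S"
  proof (cases "J \<subseteq> {0}")
    case True
    then have "J \<subseteq> ideal_hull ?B {}"
      by (auto simp: ideal_hull_def ideal_in_def)
    then show ?thesis by blast
  next
    case False
    then obtain c where c: "(\<lambda>_. c) \<in> J" "c \<noteq> 0"
      using ideal_inD(1)[OF J] by (auto simp: zero_fun_def)
    have "J \<subseteq> ideal_hull ?B {\<lambda>_. c}"
      unfolding ideal_hull_def
    proof clarsimp
      fix f J' assume f: "f \<in> J" and J': "ideal_in ?B J'" "(\<lambda>_. c) \<in> J'"
      from f ideal_inD(1)[OF J] obtain d where d: "f = (\<lambda>_. d)" by blast
      have "(\<lambda>_. d / c) * (\<lambda>_. c) \<in> J'"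
        by (rule ideal_inD(4)[OF J'(1) _ J'(2)]) blast
      then show "f \<in> J'" using c d by (simp add: times_fun_def)
    qed
    with c show ?thesis by (intro exI[of _ "{\<lambda>_. c}"]) auto
  qed
qed

lemma noetherian_regular_functions:
  "noetherian (regular_functions n :: ('a::field mat \<Rightarrow> 'a) set)"
proof (rule noetherian_finitely_generated[OF _ noetherian_constants])
  let ?E = "insert (\<lambda>x. inverse (det x)) ((\<lambda>(i, j) x. x $$ (i, j)) ` ({..<n} \<times> {..<n})) :: ('a mat \<Rightarrow> 'a) set"
  show "is_subring (range (\<lambda>c::'a. \<lambda>_::'a mat. c))"
    by (auto simp: is_subring_def zero_fun_def one_fun_def plus_fun_def times_fun_def fun_Compl_def)
  show "is_subring (regular_functions n :: ('a mat \<Rightarrow> 'a) set)"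
    by (rule regular_functions_subring)
  show "finite ?E" by simp
  show "range (\<lambda>c::'a. \<lambda>_. c) \<subseteq> regular_functions n"
    by (auto intro: regular_functions.const)
  show "?E \<subseteq> regular_functions n"
    by (auto intro: regular_functions.inv_det regular_functions.entry)
  fix R' :: "('a mat \<Rightarrow> 'a) set"
  assume R': "is_subring R'" "range (\<lambda>c::'a. \<lambda>_. c) \<subseteq> R'" "?E \<subseteq> R'"
  show "regular_functions n \<subseteq> R'"
  proof
    fix f :: "'a mat \<Rightarrow> 'a" assume "f \<in> regular_functions n"
    then show "f \<in> R'"
    proof induction
      case (add f g)
      then show ?case using is_subringD(4)[OF R'(1), of f g] by (simp add: plus_fun_def)
    next
      case (mult f g)
      then show ?case using is_subringD(5)[OF R'(1), of f g] by (simp add: times_fun_def)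
    qed (use R' in auto)
  qed
qed

text \<open>Functions on \<open>X\<close> are compared only on \<open>X\<close>: the ring of regular functions consists of functions on
all matrices, and \<open>K[X]\<close> is handled as this ring modulo the functions vanishing on \<open>X\<close>.\<close>

definition regular_on :: "nat \<Rightarrow> 'a::field mat set \<Rightarrow> ('a mat \<Rightarrow> 'a) \<Rightarrow> bool" where
  "regular_on n X f \<longleftrightarrow> (\<exists>g\<in>regular_functions n. \<forall>x\<in>X. f x = g x)"

lemma regular_onI: "f \<in> regular_functions n \<Longrightarrow> regular_on n X f"
  by (auto simp: regular_on_def)

lemma regular_on_cong: "(\<And>x. x \<in> X \<Longrightarrow> f x = g x) \<Longrightarrow> regular_on n X f \<longleftrightarrow> regular_on n X g"
  by (auto simp: regular_on_def)

lemma regular_on_subset: "regular_on n Y f \<Longrightarrow> X \<subseteq> Y \<Longrightarrow> regular_on n X f"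
  by (auto simp: regular_on_def)

lemma regular_on_const [simp]: "regular_on n X (\<lambda>_. c)"
  by (intro regular_onI regular_functions.const)

lemma regular_on_add:
  assumes "regular_on n X f" "regular_on n X g"
  shows "regular_on n X (\<lambda>x. f x + g x)"
proof -
  from assms obtain f' g' where "f' \<in> regular_functions n" "g' \<in> regular_functions n"
    "\<forall>x\<in>X. f x = f' x" "\<forall>x\<in>X. g x = g' x"
    by (auto simp: regular_on_def)
  then show ?thesis
    unfolding regular_on_def by (intro bexI[OF _ regular_functions.add[of f' n g']]) auto
qed

lemma regular_on_mult:
  assumes "regular_on n X f" "regular_on n X g"
  shows "regular_on n X (\<lambda>x. f x * g x)"
proof -
  from assms obtain f' g' where "f' \<in> regular_functions n" "g' \<in> regular_functions n"
    "\<forall>x\<in>X. f x = f' x" "\<forall>x\<in>X. g x = g' x"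
    by (auto simp: regular_on_def)
  then show ?thesis
    unfolding regular_on_def by (intro bexI[OF _ regular_functions.mult[of f' n g']]) auto
qed

lemma regular_on_sum:
  "(\<And>i. i \<in> I \<Longrightarrow> regular_on n X (f i)) \<Longrightarrow> regular_on n X (\<lambda>x. \<Sum>i\<in>I. f i x)"
  by (induction I rule: infinite_finite_induct) (auto intro: regular_on_add)

lemma regular_on_prod:
  "(\<And>i. i \<in> I \<Longrightarrow> regular_on n X (f i)) \<Longrightarrow> regular_on n X (\<lambda>x. \<Prod>i\<in>I. f i x)"
  by (induction I rule: infinite_finite_induct) (auto intro: regular_on_mult)

lemma regular_on_power: "regular_on n X f \<Longrightarrow> regular_on n X (\<lambda>x. f x ^ k)"
  by (induction k) (auto intro: regular_on_mult)

lemma regular_on_det: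
  assumes "\<And>x. x \<in> X \<Longrightarrow> M x \<in> carrier_mat k k"
    and "\<And>i j. i < k \<Longrightarrow> j < k \<Longrightarrow> regular_on n X (\<lambda>x. M x $$ (i, j))"
  shows "regular_on n X (\<lambda>x. det (M x))"
proof -
  have "regular_on n X (\<lambda>x. \<Sum>p | p permutes {0..<k}. signof p * (\<Prod>i = 0..<k. M x $$ (i, p i)))"
    by (intro regular_on_sum regular_on_mult regular_on_const regular_on_prod assms(2))
      (auto dest: permutes_in_image)
  moreover have "det (M x) = (\<Sum>p | p permutes {0..<k}. signof p * (\<Prod>i = 0..<k. M x $$ (i, p i)))"
    if "x \<in> X" for x
    using det_def'[OF assms(1)[OF that]] .
  ultimately show ?thesis by (subst regular_on_cong) auto
qed

definition regular_map :: "nat \<Rightarrow> 'a::field mat set \<Rightarrow> ('a mat \<Rightarrow> 'a mat) \<Rightarrow> bool" where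
  "regular_map n X \<psi> \<longleftrightarrow> \<psi> ` X \<subseteq> carrier (GL n) \<and>
     (\<forall>f\<in>regular_functions n. regular_on n X (\<lambda>x. f (\<psi> x)))"

text \<open>It suffices to pull back the generators of the ring of regular functions.\<close>

lemma regular_mapI:
  assumes "\<And>x. x \<in> X \<Longrightarrow> \<psi> x \<in> carrier (GL n)"
    and "\<And>i j. i < n \<Longrightarrow> j < n \<Longrightarrow> regular_on n X (\<lambda>x. \<psi> x $$ (i, j))"
    and "regular_on n X (\<lambda>x. inverse (det (\<psi> x)))"
  shows "regular_map n X \<psi>"
  unfolding regular_map_def
proof (intro conjI ballI)
  fix f :: "'a mat \<Rightarrow> 'a" assume "f \<in> regular_functions n"
  then show "regular_on n X (\<lambda>x. f (\<psi> x))"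
    by induction (use assms in \<open>auto intro: regular_on_add regular_on_mult\<close>)
qed (use assms in auto)

lemma regular_mapD:
  assumes "regular_map n X \<psi>"
  shows "x \<in> X \<Longrightarrow> \<psi> x \<in> carrier (GL n)"
    and "f \<in> regular_functions n \<Longrightarrow> regular_on n X (\<lambda>x. f (\<psi> x))"
    and "i < n \<Longrightarrow> j < n \<Longrightarrow> regular_on n X (\<lambda>x. \<psi> x $$ (i, j))"
    and "regular_on n X (\<lambda>x. inverse (det (\<psi> x)))"
  using assms regular_functions.entry[of i n j] regular_functions.inv_det[of n]
  by (auto simp: regular_map_def)

lemma regular_map_cong:
  assumes "\<And>x. x \<in> X \<Longrightarrow> \<psi> x = \<chi> x"
  shows "regular_map n X \<psi> \<longleftrightarrow> regular_map n X \<chi>"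
proof -
  have "regular_on n X (\<lambda>x. f (\<psi> x)) \<longleftrightarrow> regular_on n X (\<lambda>x. f (\<chi> x))" for f
    by (intro regular_on_cong) (simp add: assms)
  then show ?thesis using assms by (auto simp: regular_map_def image_def)
qed

lemma regular_map_subset: "regular_map n Y \<psi> \<Longrightarrow> X \<subseteq> Y \<Longrightarrow> regular_map n X \<psi>"
  by (auto simp: regular_map_def intro: regular_on_subset)

lemma regular_on_compose:
  assumes "regular_map n X \<psi>" "\<psi> ` X \<subseteq> Y" "regular_on n Y f"
  shows "regular_on n X (\<lambda>x. f (\<psi> x))"
proof -
  from assms(3) obtain g where g: "g \<in> regular_functions n" "\<forall>x\<in>Y. f x = g x"
    by (auto simp: regular_on_def)
  have "regular_on n X (\<lambda>x. f (\<psi> x)) \<longleftrightarrow> regular_on n X (\<lambda>x. g (\<psi> x))"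
    by (intro regular_on_cong) (use g assms(2) in auto)
  with regular_mapD(2)[OF assms(1) g(1)] show ?thesis by simp
qed

lemma regular_map_compose:
  assumes "regular_map n X \<psi>" "\<psi> ` X \<subseteq> Y" "regular_map n Y \<chi>"
  shows "regular_map n X (\<lambda>x. \<chi> (\<psi> x))"
  unfolding regular_map_def
proof (intro conjI ballI)
  show "(\<lambda>x. \<chi> (\<psi> x)) ` X \<subseteq> carrier (GL n)"
    using assms(2) regular_mapD(1)[OF assms(3)] by auto
  fix f :: "'a mat \<Rightarrow> 'a" assume "f \<in> regular_functions n"
  from regular_on_compose[OF assms(1,2) regular_mapD(2)[OF assms(3) this]]
  show "regular_on n X (\<lambda>x. f (\<chi> (\<psi> x)))" .
qed

lemma regular_map_id: "X \<subseteq> carrier (GL n) \<Longrightarrow> regular_map n X (\<lambda>x. x)"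
  by (auto simp: regular_map_def intro: regular_onI)

lemma regular_map_const: "c \<in> carrier (GL n) \<Longrightarrow> regular_map n X (\<lambda>_. c)"
  by (auto simp: regular_map_def)

lemma regular_map_mult:
  assumes "regular_map n X \<psi>" "regular_map n X \<chi>"
  shows "regular_map n X (\<lambda>x. \<psi> x * \<chi> x)"
proof (rule regular_mapI)
  have car: "\<psi> x \<in> carrier_mat n n" "\<chi> x \<in> carrier_mat n n" if "x \<in> X" for x
    using assms that by (auto dest!: regular_mapD(1) simp: GL_iff)
  show "\<psi> x * \<chi> x \<in> carrier (GL n)" if "x \<in> X" for x
    using group.subgroup_self[OF group_GL, of n] regular_mapD(1)[OF assms(1) that]
      regular_mapD(1)[OF assms(2) that] subgroup.m_closed by fastforce
  show "regular_on n X (\<lambda>x. (\<psi> x * \<chi> x) $$ (i, j))" if ij: "i < n" "j < n" for i j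
  proof -
    have "regular_on n X (\<lambda>x. \<Sum>k = 0..<n. \<psi> x $$ (i, k) * \<chi> x $$ (k, j))"
      by (intro regular_on_sum regular_on_mult regular_mapD(3) assms) (use ij in auto)
    moreover have "(\<psi> x * \<chi> x) $$ (i, j) = (\<Sum>k = 0..<n. \<psi> x $$ (i, k) * \<chi> x $$ (k, j))"
      if "x \<in> X" for x
      using car[OF that] ij by (auto simp: scalar_prod_def)
    ultimately show ?thesis by (subst regular_on_cong) auto
  qed
  have "regular_on n X (\<lambda>x. inverse (det (\<psi> x)) * inverse (det (\<chi> x)))"
    by (intro regular_on_mult regular_mapD(4) assms)
  moreover have "inverse (det (\<psi> x * \<chi> x)) = inverse (det (\<psi> x)) * inverse (det (\<chi> x))"
    if "x \<in> X" for x
    using det_mult[OF car[OF that]] by simp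
  ultimately show "regular_on n X (\<lambda>x. inverse (det (\<psi> x * \<chi> x)))"
    by (subst regular_on_cong) auto
qed

lemma inv_GL_adj:
  assumes "x \<in> carrier (GL n)"
  shows "inv\<^bsub>GL n\<^esub> x = inverse (det x) \<cdot>\<^sub>m adj_mat x"
proof -
  interpret group "GL n :: 'a mat monoid" by (rule group_GL)
  let ?y = "inverse (det x) \<cdot>\<^sub>m adj_mat x"
  have x: "x \<in> carrier_mat n n" "det x \<noteq> 0" using assms by (auto simp: GL_iff)
  note adj = adj_mat[OF x(1)]
  have yx: "?y * x = 1\<^sub>m n"
    using mult_smult_assoc_mat[OF adj(1) x(1), of "inverse (det x)"] adj(3) x(2) by auto
  have "det ?y * det x = 1"
    using det_mult[of ?y n x] adj(1) x yx by simp
  then have "?y \<in> carrier (GL n)" using adj(1) by (auto simp: GL_iff)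
  then show ?thesis using inv_equality[of ?y x] yx assms by simp
qed

lemma regular_map_inv: "regular_map n (carrier (GL n)) (\<lambda>x. inv\<^bsub>GL n\<^esub> x)"
proof (rule regular_mapI)
  interpret group "GL n :: 'a mat monoid" by (rule group_GL)
  let ?X = "carrier (GL n) :: 'a mat set"
  note entry = regular_onI[OF regular_functions.entry]
  show "inv\<^bsub>GL n\<^esub> x \<in> ?X" if "x \<in> ?X" for x using that by simp
  show "regular_on n ?X (\<lambda>x. (inv\<^bsub>GL n\<^esub> x) $$ (i, j))" if ij: "i < n" "j < n" for i j
  proof -
    have car: "x \<in> carrier_mat n n" if "x \<in> ?X" for x using that by (simp add: GL_iff)
    have "regular_on n ?X (\<lambda>x. inverse (det x) * ((- 1) ^ (j + i) * det (mat_delete x j i)))"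
    proof (intro regular_on_mult regular_on_const regular_onI[OF regular_functions.inv_det]
        regular_on_det[of _ _ "n - 1"])
      show "mat_delete x j i \<in> carrier_mat (n - 1) (n - 1)" if "x \<in> ?X" for x
        using car[OF that] by (intro mat_delete_carrier) auto
      fix i' j' assume "i' < n - 1" "j' < n - 1"
      then have "regular_on n ?X (\<lambda>x. x $$ (if i' < j then i' else Suc i', if j' < i then j' else Suc j'))"
        by (intro entry) auto
      moreover have "mat_delete x j i $$ (i', j') =
          x $$ (if i' < j then i' else Suc i', if j' < i then j' else Suc j')" if "x \<in> ?X" for x
        using car[OF that] \<open>i' < n - 1\<close> \<open>j' < n - 1\<close> by (auto simp: mat_delete_def)
      ultimately show "regular_on n ?X (\<lambda>x. mat_delete x j i $$ (i', j'))"
        by (subst regular_on_cong) auto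
    qed
    moreover have "(inv\<^bsub>GL n\<^esub> x) $$ (i, j) = inverse (det x) * ((- 1) ^ (j + i) * det (mat_delete x j i))"
      if "x \<in> ?X" for x
      using car[OF that] ij by (simp add: inv_GL_adj[OF that] adj_mat_def cofactor_def)
    ultimately show ?thesis by (subst regular_on_cong) auto
  qed
  have "inverse (det (inv\<^bsub>GL n\<^esub> x)) = det x" if x: "x \<in> ?X" for x
  proof -
    have "det x * det (inv\<^bsub>GL n\<^esub> x) = 1"
      using r_inv[OF x] inv_closed[OF x] x det_mult[of x n "inv\<^bsub>GL n\<^esub> x"]
      by (simp add: GL_iff)
    then show ?thesis by (metis inverse_unique inverse_inverse_eq)
  qed
  moreover have "regular_on n ?X det"
    by (rule regular_on_det[of _ "\<lambda>x. x" n]) (auto intro: entry simp: GL_iff)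
  ultimately show "regular_on n ?X (\<lambda>x. inverse (det (inv\<^bsub>GL n\<^esub> x)))"
    by (subst regular_on_cong) auto
qed

lemma regular_map_inv':
  assumes "regular_map n X \<psi>"
  shows "regular_map n X (\<lambda>x. inv\<^bsub>GL n\<^esub> (\<psi> x))"
  by (rule regular_map_compose[OF assms _ regular_map_inv]) (use assms in \<open>auto simp: regular_map_def\<close>)

section \<open>Irreducible sets in the Zariski topology\<close>

definition vanishing_ideal :: "nat \<Rightarrow> 'a::field mat set \<Rightarrow> ('a mat \<Rightarrow> 'a) set" where
  "vanishing_ideal n Z = {f \<in> regular_functions n. \<forall>x\<in>Z. f x = 0}"

lemma ideal_in_vanishing: "ideal_in (regular_functions n) (vanishing_ideal n Z)"
  unfolding ideal_in_def vanishing_ideal_def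
  by (auto simp: is_subringD[OF regular_functions_subring])

lemma zariski_open_carrier: "zariski_open n (carrier (GL n) :: 'a::field mat set)"
  unfolding zariski_open_def
  by (rule exI[of _ "{\<lambda>_. 1}"]) (auto intro: regular_functions.const)

lemma topspace_zariski [simp]: "topspace (zariski n) = (carrier (GL n) :: 'a::field mat set)"
proof
  show "topspace (zariski n) \<subseteq> (carrier (GL n) :: 'a mat set)"
    unfolding topspace_def openin_zariski by (auto simp: zariski_open_def)
  show "(carrier (GL n) :: 'a mat set) \<subseteq> topspace (zariski n)"
    by (rule openin_subset) (simp add: zariski_open_carrier)
qed

lemma closedin_zariskiI:
  assumes "S \<subseteq> regular_functions n" "Z = {x \<in> carrier (GL n). \<forall>f\<in>S. f x = 0}"
  shows "closedin (zariski n) Z"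
proof -
  have "carrier (GL n) - Z = {x \<in> carrier (GL n). \<exists>f\<in>S. f x \<noteq> 0}"
    using assms(2) by auto
  with assms show ?thesis by (auto simp: closedin_def zariski_open_def)
qed

lemma closedin_zariskiD:
  assumes "closedin (zariski n) Z" "x \<in> carrier (GL n)"
    "\<And>f. f \<in> vanishing_ideal n Z \<Longrightarrow> f x = 0"
  shows "x \<in> Z"
proof (rule ccontr)
  assume "x \<notin> Z"
  from assms(1) obtain S where S: "S \<subseteq> regular_functions n"
    "carrier (GL n) - Z = {x \<in> carrier (GL n). \<exists>f\<in>S. f x \<noteq> 0}"
    by (auto simp: closedin_def zariski_open_def)
  moreover have "Z \<subseteq> carrier (GL n)" using closedin_subset[OF assms(1)] by simp
  ultimately have "S \<subseteq> vanishing_ideal n Z" by (auto simp: vanishing_ideal_def)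
  with S(2) assms(2,3) \<open>x \<notin> Z\<close> show False by blast
qed

lemma closedin_zariski_vanishing_mono:
  assumes "closedin (zariski n) C" "closedin (zariski n) D"
    "vanishing_ideal n D \<subseteq> vanishing_ideal n C"
  shows "C \<subseteq> D"
proof
  fix x assume "x \<in> C"
  moreover have "C \<subseteq> carrier (GL n)" using closedin_subset[OF assms(1)] by simp
  ultimately show "x \<in> D"
    using assms(3) by (intro closedin_zariskiD[OF assms(2)]) (auto simp: vanishing_ideal_def)
qed

text \<open>Taking vanishing ideals reverses inclusions and is injective on closed sets, so a maximal vanishing
ideal belongs to a minimal closed set.\<close>

lemma zariski_noetherian:
  assumes "P C0" "\<And>C. P C \<Longrightarrow> closedin (zariski n) (C :: 'a::field mat set)"
  shows "\<exists>C. P C \<and> (\<forall>D. P D \<longrightarrow> D \<subseteq> C \<longrightarrow> D = C)"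
proof -
  let ?P = "\<lambda>I. \<exists>C. P C \<and> I = vanishing_ideal n C"
  have "?P (vanishing_ideal n C0)" using assms(1) by (intro exI[of _ C0]) simp
  moreover have "ideal_in (regular_functions n) I" if "?P I" for I
    using that by (auto simp: ideal_in_vanishing)
  ultimately have "\<exists>I. ?P I \<and> (\<forall>J. ?P J \<longrightarrow> I \<subseteq> J \<longrightarrow> J = I)"
    by (rule noetherian_maximal_ideal[where P = ?P,
          OF regular_functions_subring noetherian_regular_functions])
  then obtain I where I': "?P I \<and> (\<forall>J. ?P J \<longrightarrow> I \<subseteq> J \<longrightarrow> J = I)" by (rule exE)
  note I = conjunct1[OF I'] conjunct2[OF I']
  from I(1) obtain C where C': "P C \<and> I = vanishing_ideal n C" by (rule exE)
  note C = conjunct1[OF C'] conjunct2[OF C']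
  have "D = C" if "P D" "D \<subseteq> C" for D
  proof
    have "I \<subseteq> vanishing_ideal n D"
      using that by (auto simp: C(2) vanishing_ideal_def)
    then have "vanishing_ideal n D = I"
      using I(2) that(1) by blast
    then show "C \<subseteq> D"
      using that(1) C by (intro closedin_zariski_vanishing_mono[of n] assms(2)) auto
  qed (rule that)
  with C show ?thesis by blast
qed

lemma closedin_regular_vimage:
  assumes "regular_map n X \<psi>" "X \<subseteq> carrier (GL n)" "closedin (zariski n) C"
  shows "closedin (subtopology (zariski n) X) {x \<in> X. \<psi> x \<in> C}"
proof -
  let ?S = "{g \<in> regular_functions n. \<exists>f\<in>vanishing_ideal n C. \<forall>x\<in>X. f (\<psi> x) = g x}"
  let ?D = "{x \<in> carrier (GL n). \<forall>g\<in>?S. g x = 0}"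
  have "closedin (zariski n) ?D" by (rule closedin_zariskiI[of ?S]) auto
  moreover have "{x \<in> X. \<psi> x \<in> C} = ?D \<inter> X"
  proof (intro equalityI subsetI)
    fix x assume "x \<in> {x \<in> X. \<psi> x \<in> C}"
    then show "x \<in> ?D \<inter> X" using assms(2) by (auto simp: vanishing_ideal_def)
  next
    fix x assume x: "x \<in> ?D \<inter> X"
    have "\<psi> x \<in> C"
    proof (rule closedin_zariskiD[OF assms(3)])
      show "\<psi> x \<in> carrier (GL n)" using x regular_mapD(1)[OF assms(1)] by auto
      fix f assume f: "f \<in> vanishing_ideal n C"
      then obtain g where "g \<in> regular_functions n" "\<forall>x\<in>X. f (\<psi> x) = g x"
        using regular_mapD(2)[OF assms(1), of f] by (auto simp: regular_on_def vanishing_ideal_def)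
      then show "f (\<psi> x) = 0" using f x by auto
    qed
    then show "x \<in> {x \<in> X. \<psi> x \<in> C}" using x by auto
  qed
  ultimately show ?thesis by (auto simp: closedin_subtopology)
qed

lemma continuous_regular_map:
  assumes "regular_map n X \<psi>" "X \<subseteq> carrier (GL n)"
  shows "continuous_map (subtopology (zariski n) X) (zariski n) \<psi>"
  unfolding continuous_map_closedin
proof (intro conjI allI impI ballI)
  have top: "topspace (subtopology (zariski n) X) = X" using assms(2) by auto
  show "\<psi> \<in> topspace (subtopology (zariski n) X) \<rightarrow> topspace (zariski n)"
    using regular_mapD(1)[OF assms(1)] by auto
  show "closedin (subtopology (zariski n) X) {x \<in> topspace (subtopology (zariski n) X). \<psi> x \<in> C}"
    if "closedin (zariski n) C" for C
    unfolding top by (rule closedin_regular_vimage[OF assms that])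
qed

lemma connectedin_regular_image:
  assumes "regular_map n X \<psi>" "X \<subseteq> carrier (GL n)" "connectedin (zariski n) Z" "Z \<subseteq> X"
  shows "connectedin (zariski n) (\<psi> ` Z)"
  by (rule connectedin_continuous_map_image[OF continuous_regular_map[OF assms(1,2)]])
    (use assms in \<open>auto simp: connectedin_subtopology\<close>)

definition irreducible_set :: "nat \<Rightarrow> 'a::field mat set \<Rightarrow> bool" where
  "irreducible_set n Z \<longleftrightarrow> Z \<noteq> {} \<and>
     (\<forall>C D. closedin (zariski n) C \<longrightarrow> closedin (zariski n) D \<longrightarrow> Z \<subseteq> C \<union> D \<longrightarrow> Z \<subseteq> C \<or> Z \<subseteq> D)"

lemma irreducible_set_Union:
  assumes "irreducible_set n Z" "finite \<Z>" "\<And>C. C \<in> \<Z> \<Longrightarrow> closedin (zariski n) C" "Z \<subseteq> \<Union>\<Z>"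
  shows "\<exists>C\<in>\<Z>. Z \<subseteq> C"
  using assms(2-4)
proof (induction \<Z>)
  case empty
  then show ?case using assms(1) by (auto simp: irreducible_set_def)
next
  case (insert C \<Z>)
  have "closedin (zariski n) (\<Union>\<Z>)" using insert by (intro closedin_Union) auto
  with insert assms(1) have "Z \<subseteq> C \<or> Z \<subseteq> \<Union>\<Z>"
    unfolding irreducible_set_def by (metis Union_insert insertI1)
  with insert show ?case by auto
qed

text \<open>Noetherian induction: a minimal closed set without such a decomposition would be reducible, and
its two proper parts would be decomposable.\<close>

lemma irreducible_decomposition:
  assumes "closedin (zariski n) (Z :: 'a::field mat set)"
  shows "\<exists>\<Z>. finite \<Z> \<and> (\<forall>C\<in>\<Z>. closedin (zariski n) C \<and> irreducible_set n C) \<and> Z = \<Union>\<Z>"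
proof (rule ccontr)
  define dec where "dec Z \<longleftrightarrow>
    (\<exists>\<Z>. finite \<Z> \<and> (\<forall>C\<in>\<Z>. closedin (zariski n) C \<and> irreducible_set n C) \<and> Z = \<Union>\<Z>)" for Z :: "'a mat set"
  have decI: "dec Z" if "finite \<Z>" "\<And>C. C \<in> \<Z> \<Longrightarrow> closedin (zariski n) C \<and> irreducible_set n C" "Z = \<Union>\<Z>"
    for Z \<Z>
    unfolding dec_def by (intro exI[of _ \<Z>] conjI ballI that)
  let ?P = "\<lambda>Z. closedin (zariski n) Z \<and> \<not> dec Z"
  assume "\<nexists>\<Z>. finite \<Z> \<and> (\<forall>C\<in>\<Z>. closedin (zariski n) C \<and> irreducible_set n C) \<and> Z = \<Union>\<Z>"
  then have "?P Z" using assms unfolding dec_def by (intro conjI)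
  then have "\<exists>C. ?P C \<and> (\<forall>D. ?P D \<longrightarrow> D \<subseteq> C \<longrightarrow> D = C)"
    by (rule zariski_noetherian[where P = ?P and n = n]) simp
  then obtain W where W': "?P W \<and> (\<forall>D. ?P D \<longrightarrow> D \<subseteq> W \<longrightarrow> D = W)" by (rule exE)
  then have W: "closedin (zariski n) W" "\<not> dec W" by simp_all
  have min: "dec D" if "closedin (zariski n) D" "D \<subseteq> W" "D \<noteq> W" for D
    using spec[OF conjunct2[OF W'], of D] that by simp
  have "W \<noteq> {}"
  proof
    assume "W = {}"
    then have "dec W" by (intro decI[of "{}"]) simp_all
    with W(2) show False ..
  qed
  moreover have "\<not> irreducible_set n W"
  proof
    assume "irreducible_set n W"
    then have "dec W" using W(1) by (intro decI[of "{W}"]) simp_all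
    with W(2) show False ..
  qed
  ultimately obtain C D where CD: "closedin (zariski n) C" "closedin (zariski n) D"
    "W \<subseteq> C \<union> D" "\<not> W \<subseteq> C" "\<not> W \<subseteq> D"
    by (auto simp: irreducible_set_def)
  have "dec (W \<inter> C)" using CD W(1) by (intro min closedin_Int) auto
  then obtain \<C> where \<C>: "finite \<C>" "\<forall>C\<in>\<C>. closedin (zariski n) C \<and> irreducible_set n C"
    "W \<inter> C = \<Union>\<C>" unfolding dec_def by (elim exE conjE)
  have "dec (W \<inter> D)" using CD W(1) by (intro min closedin_Int) auto
  then obtain \<D> where \<D>: "finite \<D>" "\<forall>C\<in>\<D>. closedin (zariski n) C \<and> irreducible_set n C"
    "W \<inter> D = \<Union>\<D>" unfolding dec_def by (elim exE conjE)
  have "W = (W \<inter> C) \<union> (W \<inter> D)" using CD by auto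
  then have "dec W"
    using \<C> \<D> by (intro decI[of "\<C> \<union> \<D>"]) auto
  with W(2) show False ..
qed

lemma irredundant_cover:
  assumes "finite \<Z>"
  obtains \<Y> where "\<Y> \<subseteq> \<Z>" "\<Union>\<Y> = \<Union>\<Z>" "\<And>C. C \<in> \<Y> \<Longrightarrow> \<not> C \<subseteq> \<Union>(\<Y> - {C})"
proof -
  let ?P = "\<lambda>\<Y>. \<Y> \<subseteq> \<Z> \<and> \<Union>\<Y> = \<Union>\<Z>"
  define \<Y> where "\<Y> = (ARG_MIN card \<Y>. ?P \<Y>)"
  have Y: "?P \<Y>"
    unfolding \<Y>_def by (rule arg_min_natI[of ?P \<Z>]) simp
  have irr: "\<not> C \<subseteq> \<Union>(\<Y> - {C})" if C: "C \<in> \<Y>" for C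
  proof
    assume sub: "C \<subseteq> \<Union>(\<Y> - {C})"
    have "\<Union>(\<Y> - {C}) = \<Union>\<Y>"
    proof (rule equalityI)
      show "\<Union>\<Y> \<subseteq> \<Union>(\<Y> - {C})"
      proof (rule Union_least)
        fix D assume "D \<in> \<Y>"
        then show "D \<subseteq> \<Union>(\<Y> - {C})"
          using sub by (cases "D = C") (simp_all add: Union_upper)
      qed
    qed (rule Union_mono, rule Diff_subset)
    with Y have "?P (\<Y> - {C})" by auto
    then have "card \<Y> \<le> card (\<Y> - {C})"
      unfolding \<Y>_def by (rule arg_min_nat_le[of ?P])
    moreover have "card (\<Y> - {C}) < card \<Y>"
      using C Y assms finite_subset by (metis card_Diff1_less)
    ultimately show False by simp
  qed
  show ?thesis by (rule that[OF conjunct1[OF Y] conjunct2[OF Y] irr])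
qed

lemma irreducible_regular_image:
  assumes "regular_map n X \<psi>" "closedin (zariski n) X" "irreducible_set n X"
  shows "irreducible_set n (\<psi> ` X)"
  unfolding irreducible_set_def
proof (intro conjI allI impI)
  show "\<psi> ` X \<noteq> {}" using assms(3) by (auto simp: irreducible_set_def)
  fix C D assume CD: "closedin (zariski n) C" "closedin (zariski n) D" "\<psi> ` X \<subseteq> C \<union> D"
  have X: "X \<subseteq> carrier (GL n)" using closedin_subset[OF assms(2)] by simp
  have "closedin (zariski n) {x \<in> X. \<psi> x \<in> C}" "closedin (zariski n) {x \<in> X. \<psi> x \<in> D}"
    by (rule closedin_trans_full[OF closedin_regular_vimage[OF assms(1) X] assms(2)], rule CD)+
  moreover have "X \<subseteq> {x \<in> X. \<psi> x \<in> C} \<union> {x \<in> X. \<psi> x \<in> D}" using CD(3) by auto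
  ultimately have "X \<subseteq> {x \<in> X. \<psi> x \<in> C} \<or> X \<subseteq> {x \<in> X. \<psi> x \<in> D}"
    using assms(3) unfolding irreducible_set_def by blast
  then show "\<psi> ` X \<subseteq> C \<or> \<psi> ` X \<subseteq> D" by auto
qed

text \<open>Left translations permute the members of an irredundant decomposition of \<open>H\<close> into irreducible
closed sets. Irredundancy provides a point that lies in only one member, and by transitivity of the
translations this holds for every point. So the members are disjoint, and connectedness leaves
only one.\<close>

theorem connected_group_irreducible:
  assumes H: "subgroup H (GL n :: 'a::field mat monoid)" "closedin (zariski n) H"
    "connectedin (zariski n) H"
  shows "irreducible_set n H"
proof -
  interpret group "GL n :: 'a mat monoid" by (rule group_GL)
  interpret H: subgroup H "GL n" by (rule H(1))
  obtain \<Z> where \<Z>: "finite \<Z>" "\<And>C. C \<in> \<Z> \<Longrightarrow> closedin (zariski n) C \<and> irreducible_set n C" "H = \<Union>\<Z>"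
    using irreducible_decomposition[OF H(2)] by blast
  obtain \<Y> where \<Y>: "\<Y> \<subseteq> \<Z>" "\<Union>\<Y> = H" "\<And>C. C \<in> \<Y> \<Longrightarrow> \<not> C \<subseteq> \<Union>(\<Y> - {C})"
    using irredundant_cover[OF \<Z>(1)] \<Z>(3) by metis
  have fin: "finite \<Y>" using \<Y>(1) \<Z>(1) by (rule finite_subset)
  have cl: "closedin (zariski n) C" "irreducible_set n C" "C \<subseteq> H" if "C \<in> \<Y>" for C
    using that \<Y>(1,2) \<Z>(2) by blast+
  have translate_sub: "\<exists>D\<in>\<Y>. (\<lambda>x. h * x) ` C \<subseteq> D" if "h \<in> H" "C \<in> \<Y>" for h C
  proof (rule irreducible_set_Union[OF _ fin cl(1)])
    have "regular_map n C (\<lambda>x. h * x)"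
      using that cl(3)[OF that(2)] H.subset
      by (intro regular_map_mult regular_map_const regular_map_id) auto
    then show "irreducible_set n ((\<lambda>x. h * x) ` C)"
      using cl[OF that(2)] by (intro irreducible_regular_image) auto
    show "(\<lambda>x. h * x) ` C \<subseteq> \<Union>\<Y>"
      using that cl(3)[OF that(2)] H.m_closed unfolding \<Y>(2) by auto
  qed
  have maximal: "C = D" if "C \<in> \<Y>" "D \<in> \<Y>" "C \<subseteq> D" for C D
    using \<Y>(3)[OF that(1)] that by blast
  have translate: "(\<lambda>x. h * x) ` C \<in> \<Y>" if h: "h \<in> H" and C: "C \<in> \<Y>" for h C
  proof -
    let ?h = "inv\<^bsub>GL n\<^esub> h"
    have hG: "h \<in> carrier (GL n)" using h H.subset by blast
    have cancel: "?h * (h * x) = x" "h * (?h * x) = x" if "x \<in> H" for x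
    proof -
      have xG: "x \<in> carrier (GL n)" using that H.subset by blast
      show "?h * (h * x) = x"
        using m_assoc[OF inv_closed[OF hG] hG xG] l_inv[OF hG] l_one[OF xG] by simp
      show "h * (?h * x) = x"
        using m_assoc[OF hG inv_closed[OF hG] xG] r_inv[OF hG] l_one[OF xG] by simp
    qed
    obtain D where D: "D \<in> \<Y>" "(\<lambda>x. h * x) ` C \<subseteq> D" using translate_sub[OF h C] by blast
    obtain E where E: "E \<in> \<Y>" "(\<lambda>x. ?h * x) ` D \<subseteq> E"
      using translate_sub[OF H.m_inv_closed[OF h] D(1)] by blast
    have "C \<subseteq> E"
    proof
      fix x assume "x \<in> C"
      then have "?h * (h * x) \<in> E" using D E by blast
      then show "x \<in> E" using cancel(1)[of x] \<open>x \<in> C\<close> cl(3)[OF C] by auto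
    qed
    then have "E = C" using maximal[OF C E(1)] by simp
    have "D \<subseteq> (\<lambda>x. h * x) ` C"
    proof
      fix y assume "y \<in> D"
      then have "y = h * (?h * y)" "?h * y \<in> C"
        using cancel(2)[of y] cl(3)[OF D(1)] E(2) \<open>E = C\<close> by auto
      then show "y \<in> (\<lambda>x. h * x) ` C" by blast
    qed
    with D show ?thesis by (metis subset_antisym)
  qed
  have "\<Y> \<noteq> {}" using \<Y>(2) H.one_closed by auto
  then obtain C where C: "C \<in> \<Y>" by blast
  obtain x where x: "x \<in> C" "x \<notin> \<Union>(\<Y> - {C})" using \<Y>(3)[OF C] by blast
  have disj: "D = E" if "D \<in> \<Y>" "E \<in> \<Y>" "y \<in> D" "y \<in> E" for D E y
  proof -
    have yH: "y \<in> H" "x \<in> H" using that x C cl(3) by auto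
    let ?h = "x * inv\<^bsub>GL n\<^esub> y"
    have hH: "?h \<in> H" using H.m_closed[OF yH(2) H.m_inv_closed[OF yH(1)]] by simp
    have G: "y \<in> carrier (GL n)" "x \<in> carrier (GL n)" using yH H.subset by blast+
    have hy: "?h * y = x"
      using m_assoc[OF G(2) inv_closed[OF G(1)] G(1)] l_inv[OF G(1)] r_one[OF G(2)] by simp
    have tr: "(\<lambda>x. ?h * x) ` D' = C" if "D' \<in> \<Y>" "y \<in> D'" for D'
    proof (rule ccontr)
      assume "(\<lambda>x. ?h * x) ` D' \<noteq> C"
      then have "(\<lambda>x. ?h * x) ` D' \<in> \<Y> - {C}" using translate[OF hH that(1)] by simp
      moreover have "x \<in> (\<lambda>x. ?h * x) ` D'" using that(2) hy by (intro image_eqI[of _ _ y]) simp_all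
      ultimately show False using x(2) by blast
    qed
    have "inj_on (\<lambda>x. ?h * x) H"
      using inj_on_subset[OF inj_on_cmult H.subset, of ?h] hH H.subset by auto
    then show ?thesis
      using tr[OF that(1,3)] tr[OF that(2,4)] cl(3)[OF that(1)] cl(3)[OF that(2)]
      by (simp flip: inj_on_image_eq_iff)
  qed
  have "H \<subseteq> C"
  proof (rule ccontr)
    assume "\<not> H \<subseteq> C"
    let ?D = "\<Union>(\<Y> - {C})"
    have "closedin (zariski n) ?D" using fin cl(1) by (intro closedin_Union) auto
    moreover have "H \<subseteq> C \<union> ?D" using \<Y>(2) by auto
    moreover have "C \<inter> ?D \<inter> H = {}" using disj C by blast
    moreover have "C \<inter> H \<noteq> {}" using x cl(3)[OF C] by blast
    moreover have "?D \<inter> H \<noteq> {}" using \<open>\<not> H \<subseteq> C\<close> \<open>H \<subseteq> C \<union> ?D\<close> by blast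
    ultimately have "\<exists>E1 E2. closedin (zariski n) E1 \<and> closedin (zariski n) E2 \<and>
        H \<subseteq> E1 \<union> E2 \<and> E1 \<inter> E2 \<inter> H = {} \<and> E1 \<inter> H \<noteq> {} \<and> E2 \<inter> H \<noteq> {}"
      using cl(1)[OF C] by (intro exI[of _ C] exI[of _ ?D] conjI)
    then show False
      by (rule notE[OF conjunct2[OF H(3)[unfolded connectedin_closedin]]])
  qed
  then have "H = C" using cl(3)[OF C] by blast
  then show ?thesis using cl(2)[OF C] by simp
qed

lemma irreducible_integral_domain:
  assumes "irreducible_set n X" "X \<subseteq> carrier (GL n)" "regular_on n X f" "regular_on n X g"
    "\<And>x. x \<in> X \<Longrightarrow> f x * g x = 0"
  shows "(\<forall>x\<in>X. f x = 0) \<or> (\<forall>x\<in>X. g x = 0)"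
proof -
  obtain f' g' where fg: "f' \<in> regular_functions n" "\<forall>x\<in>X. f x = f' x"
    "g' \<in> regular_functions n" "\<forall>x\<in>X. g x = g' x"
    using assms(3,4) by (auto simp: regular_on_def)
  let ?C = "\<lambda>f. {x \<in> carrier (GL n). f x = 0}"
  have "closedin (zariski n) (?C f')" "closedin (zariski n) (?C g')"
    using fg by (auto intro: closedin_zariskiI[of "{f'}"] closedin_zariskiI[of "{g'}"])
  moreover have "X \<subseteq> ?C f' \<union> ?C g'" using assms(2,5) fg by auto
  ultimately have "X \<subseteq> ?C f' \<or> X \<subseteq> ?C g'" using assms(1) unfolding irreducible_set_def by blast
  then show ?thesis using fg by auto
qed

section \<open>Integrality over a ring of functions\<close>

lemma sum_fun_apply: "(\<Sum>i\<in>I. f i) x = (\<Sum>i\<in>I. f i x)"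
  by (induction I rule: infinite_finite_induct) simp_all

lemma power_fun_apply: "(f ^ k) x = f x ^ k"
  by (induction k) simp_all

text \<open>The module spanned by \<open>S\<close> over the ring \<open>B\<close>, closed under changing a function outside \<open>X\<close>. The
inductive form avoids carrying coefficient families through every closure property.\<close>

inductive_set span_on :: "'x set \<Rightarrow> ('x \<Rightarrow> 'a::field) set \<Rightarrow> ('x \<Rightarrow> 'a) set \<Rightarrow> ('x \<Rightarrow> 'a) set"
  for X B S where
  zero: "\<forall>x\<in>X. f x = 0 \<Longrightarrow> f \<in> span_on X B S"
| step: "m \<in> span_on X B S \<Longrightarrow> b \<in> B \<Longrightarrow> s \<in> S \<Longrightarrow> \<forall>x\<in>X. f x = m x + b x * s x \<Longrightarrow>
    f \<in> span_on X B S"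

lemma span_on_cong:
  assumes "f \<in> span_on X B S" "\<forall>x\<in>X. g x = f x"
  shows "g \<in> span_on X B S"
  using assms(1)
proof cases
  case zero
  then show ?thesis using assms(2) by (simp add: span_on.zero)
next
  case (step m b s)
  show ?thesis
    by (rule span_on.step[OF step(1-3)]) (use step(4) assms(2) in simp)
qed

lemma span_on_add:
  assumes "f \<in> span_on X B S" "g \<in> span_on X B S"
  shows "(\<lambda>x. f x + g x) \<in> span_on X B S"
  using assms(2)
proof induction
  case (zero g)
  then show ?case by (simp add: span_on_cong[OF assms(1)])
next
  case (step m b s g)
  show ?case
    by (rule span_on.step[OF step.IH step.hyps(2,3)]) (use step.hyps(4) in \<open>simp add: algebra_simps\<close>)
qed

lemma span_on_mult:
  assumes "f \<in> span_on X B S"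
    and v: "\<And>b s. b \<in> B \<Longrightarrow> s \<in> S \<Longrightarrow> (\<lambda>x. v x * (b x * s x)) \<in> span_on X B' S'"
  shows "(\<lambda>x. v x * f x) \<in> span_on X B' S'"
  using assms(1)
proof induction
  case (zero f)
  then show ?case by (simp add: span_on.zero)
next
  case (step m b s f)
  show ?case
    by (rule span_on_cong[OF span_on_add[OF step.IH v[OF step.hyps(2,3)]]])
      (use step.hyps(4) in \<open>simp add: algebra_simps\<close>)
qed

lemma span_on_mono: "f \<in> span_on X B S \<Longrightarrow> S \<subseteq> S' \<Longrightarrow> f \<in> span_on X B S'"
proof (induction rule: span_on.induct)
  case (zero f)
  then show ?case by (simp add: span_on.zero)
next
  case (step m b s f)
  show ?case
    by (rule span_on.step[OF step.IH[OF step.prems] step.hyps(2) subsetD[OF step.prems step.hyps(3)] step.hyps(4)])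
qed

lemma span_on_scale:
  assumes "is_subring B" "b \<in> B" "f \<in> span_on X B S"
  shows "(\<lambda>x. b x * f x) \<in> span_on X B S"
proof (rule span_on_mult[OF assms(3)])
  fix b' s assume "b' \<in> B" "s \<in> S"
  with is_subringD(5)[OF assms(1,2)] show "(\<lambda>x. b x * (b' x * s x)) \<in> span_on X B S"
    by (simp add: span_on.step[OF span_on.zero[of X "\<lambda>_. 0"], of "b * b'" _ s])
qed

lemma span_on_base:
  assumes "is_subring B" "s \<in> S"
  shows "s \<in> span_on X B S"
  by (rule span_on.step[OF span_on.zero[of X "\<lambda>_. 0"] is_subringD(2)[OF assms(1)] assms(2)]) simp_all

lemma span_on_stable:
  assumes "is_subring B" "f \<in> span_on X B S"
    and v: "\<And>s. s \<in> S \<Longrightarrow> (\<lambda>x. v x * s x) \<in> span_on X B S'"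
  shows "(\<lambda>x. v x * f x) \<in> span_on X B S'"
proof (rule span_on_mult[OF assms(2)])
  fix b s assume "b \<in> B" "s \<in> S"
  from span_on_scale[OF assms(1) this(1) v[OF this(2)]]
  show "(\<lambda>x. v x * (b x * s x)) \<in> span_on X B S'"
    by (rule span_on_cong) simp
qed

lemma span_on_sum:
  assumes "\<And>i. i \<in> I \<Longrightarrow> f i \<in> span_on X B S"
  shows "(\<lambda>x. \<Sum>i\<in>I. f i x) \<in> span_on X B S"
  using assms
  by (induction I rule: infinite_finite_induct) (auto intro: span_on.zero span_on_add)

lemma span_on_coefficients:
  assumes "is_subring B" "finite S" "f \<in> span_on X B S"
  shows "\<exists>c. (\<forall>s\<in>S. c s \<in> B) \<and> (\<forall>x\<in>X. f x = (\<Sum>s\<in>S. c s x * s x))"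
  using assms(3)
proof induction
  case (zero f)
  then show ?case by (intro exI[of _ "\<lambda>_. 0"]) (simp add: is_subringD(1)[OF assms(1), unfolded zero_fun_def])
next
  case (step m b s f)
  then obtain c where c: "\<forall>s\<in>S. c s \<in> B" "\<forall>x\<in>X. m x = (\<Sum>s\<in>S. c s x * s x)" by (elim exE conjE)
  let ?c = "c(s := c s + b)"
  have "?c t \<in> B" if "t \<in> S" for t
    using c(1) that step.hyps(2,3) is_subringD(4)[OF assms(1), of "c s" b] by simp
  moreover have "f x = (\<Sum>t\<in>S. ?c t x * t x)" if "x \<in> X" for x
  proof -
    have "(\<Sum>t\<in>S. ?c t x * t x) = ?c s x * s x + (\<Sum>t\<in>S - {s}. ?c t x * t x)"
      by (rule sum.remove[OF assms(2) step.hyps(3)])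
    also have "(\<Sum>t\<in>S - {s}. ?c t x * t x) = (\<Sum>t\<in>S - {s}. c t x * t x)"
      by (intro sum.cong) simp_all
    also have "?c s x * s x + (\<Sum>t\<in>S - {s}. c t x * t x) = (\<Sum>t\<in>S. c t x * t x) + b x * s x"
      by (subst sum.remove[OF assms(2) step.hyps(3)]) (simp add: algebra_simps)
    also have "\<dots> = f x" using c(2) step.hyps(4) that by simp
    finally show ?thesis ..
  qed
  ultimately show ?case by (intro exI[of _ ?c]) blast
qed

definition integral_on :: "'x set \<Rightarrow> ('x \<Rightarrow> 'a::field) set \<Rightarrow> ('x \<Rightarrow> 'a) \<Rightarrow> bool" where
  "integral_on X B a \<longleftrightarrow>
     (\<exists>N c. (\<forall>i. c i \<in> B) \<and> (\<forall>x\<in>X. a x ^ N + (\<Sum>i<N. c i x * a x ^ i) = 0))"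

definition coefficients_in :: "('x \<Rightarrow> 'a::field) set \<Rightarrow> ('x \<Rightarrow> 'a poly) \<Rightarrow> bool" where
  "coefficients_in B p \<longleftrightarrow> (\<forall>k. (\<lambda>x. coeff (p x) k) \<in> B)"

lemma coefficients_in_mult:
  assumes "is_subring B" "coefficients_in B p" "coefficients_in B q"
  shows "coefficients_in B (\<lambda>x. p x * q x)"
  unfolding coefficients_in_def
proof
  fix k
  have "(\<Sum>i\<le>k. (\<lambda>x. coeff (p x) i) * (\<lambda>x. coeff (q x) (k - i))) \<in> B"
    using assms(2,3) unfolding coefficients_in_def
    by (intro is_subring_sum[OF assms(1)] is_subringD(5)[OF assms(1)]) simp_all
  moreover have "(\<Sum>i\<le>k. (\<lambda>x. coeff (p x) i) * (\<lambda>x. coeff (q x) (k - i))) = (\<lambda>x. coeff (p x * q x) k)"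
    by (rule ext) (simp add: coeff_mult sum_fun_apply times_fun_def)
  ultimately show "(\<lambda>x. coeff (p x * q x) k) \<in> B" by simp
qed

lemma coefficients_in_sum:
  assumes "is_subring B" "\<And>i. i \<in> I \<Longrightarrow> coefficients_in B (p i)"
  shows "coefficients_in B (\<lambda>x. \<Sum>i\<in>I. p i x)"
  unfolding coefficients_in_def
proof
  fix k
  have "(\<Sum>i\<in>I. (\<lambda>x. coeff (p i x) k)) \<in> B"
    using assms(2) unfolding coefficients_in_def
    by (intro is_subring_sum[OF assms(1)]) simp_all
  moreover have "(\<Sum>i\<in>I. (\<lambda>x. coeff (p i x) k)) = (\<lambda>x. coeff (\<Sum>i\<in>I. p i x) k)"
    by (rule ext) (simp add: coeff_sum sum_fun_apply)
  ultimately show "(\<lambda>x. coeff (\<Sum>i\<in>I. p i x) k) \<in> B" by simp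
qed

lemma coefficients_in_int:
  assumes "is_subring B"
  shows "coefficients_in B (\<lambda>_. of_int z)"
proof -
  have nat: "(\<lambda>_. of_nat m) \<in> B" for m
  proof (induction m)
    case 0
    show ?case using is_subringD(1)[OF assms] by (simp add: zero_fun_def)
  next
    case (Suc m)
    from is_subringD(4)[OF assms is_subringD(2)[OF assms] this]
    show ?case by (simp add: plus_fun_def)
  qed
  have "(\<lambda>_. of_int z) \<in> B"
  proof (cases z)
    case (nonneg m)
    then show ?thesis using nat[of m] by simp
  next
    case (neg m)
    then show ?thesis using is_subringD(3)[OF assms nat[of "Suc m"]] by (simp add: fun_Compl_def)
  qed
  moreover have "(\<lambda>_. 0) \<in> B" using nat[of 0] by simp
  ultimately show ?thesis
    unfolding coefficients_in_def by (auto simp: of_int_poly coeff_pCons split: nat.split)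
qed

lemma coefficients_in_prod:
  assumes "is_subring B" "\<And>i. i \<in> I \<Longrightarrow> coefficients_in B (p i)"
  shows "coefficients_in B (\<lambda>x. \<Prod>i\<in>I. p i x)"
  using assms(2)
  by (induction I rule: infinite_finite_induct)
    (use coefficients_in_int[OF assms(1), of 1] in \<open>auto intro: coefficients_in_mult[OF assms(1)]\<close>)

text \<open>By the Leibniz formula the coefficients of the characteristic polynomial are polynomials with
integer coefficients in the entries of the matrix.\<close>

lemma char_poly_coefficients_in:
  assumes B: "is_subring B" and \<beta>: "\<And>i j. i < N \<Longrightarrow> j < N \<Longrightarrow> \<beta> i j \<in> B"
  shows "coefficients_in B (\<lambda>x. char_poly (mat N N (\<lambda>(i, j). \<beta> i j x)))"
proof -
  let ?M = "\<lambda>x. mat N N (\<lambda>(i, j). \<beta> i j x)"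
  let ?C = "\<lambda>x. char_poly_matrix (?M x)"
  have C: "?C x \<in> carrier_mat N N" for x by simp
  have entry: "coefficients_in B (\<lambda>x. ?C x $$ (i, j))" if "i < N" "j < N" for i j
  proof -
    have eq: "coeff (?C x $$ (i, j)) k =
        (if k = 0 then - \<beta> i j x else if k = 1 \<and> i = j then 1 else 0)" for x k
      using that by (auto simp: char_poly_matrix_def coeff_pCons split: nat.split)
    have mem: "(\<lambda>x. - \<beta> i j x) \<in> B" "(\<lambda>x. 1) \<in> B" "(\<lambda>x. 0) \<in> B"
      using is_subringD(3)[OF B \<beta>[OF that]] is_subringD(1,2)[OF B]
      by (simp_all add: fun_Compl_def zero_fun_def one_fun_def)
    show ?thesis
      unfolding coefficients_in_def
    proof
      fix k :: nat
      consider "k = 0" | "k = 1" "i = j" | "k \<noteq> 0" "\<not> (k = 1 \<and> i = j)" by blast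
      then show "(\<lambda>x. coeff (?C x $$ (i, j)) k) \<in> B"
      proof cases
        case 1
        have "(\<lambda>x. coeff (?C x $$ (i, j)) k) = (\<lambda>x. - \<beta> i j x)"
          unfolding eq using 1 by simp
        with mem(1) show ?thesis by simp
      next
        case 2
        have "(\<lambda>x. coeff (?C x $$ (i, j)) k) = (\<lambda>x. 1)"
          unfolding eq using 2 by simp
        with mem(2) show ?thesis by simp
      next
        case 3
        have "(\<lambda>x. coeff (?C x $$ (i, j)) k) = (\<lambda>x. 0)"
          unfolding eq using 3 by auto
        with mem(3) show ?thesis by simp
      qed
    qed
  qed
  have "coefficients_in B (\<lambda>x. \<Sum>p | p permutes {0..<N}. signof p * (\<Prod>i = 0..<N. ?C x $$ (i, p i)))"
  proof (intro coefficients_in_sum[OF B] coefficients_in_mult[OF B] coefficients_in_prod[OF B] entry)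
    show "coefficients_in B (\<lambda>_. signof p)" for p :: "nat \<Rightarrow> nat"
      using coefficients_in_int[OF B, of "sign p"] by (simp add: sign_def)
  qed (auto dest: permutes_in_image)
  then show ?thesis
    unfolding char_poly_def det_def'[OF C] .
qed

text \<open>The determinant trick, carried out pointwise. Multiplication by \<open>a\<close> on the module spanned by \<open>S\<close> is
described by a matrix with entries in \<open>B\<close>. At each point \<open>x\<close> this becomes a matrix over the field
with eigenvalue \<open>a x\<close>: the values at \<open>x\<close> of the members of \<open>S\<close> form an eigenvector, nonzero since
\<open>S\<close> contains \<open>1\<close>. So \<open>a x\<close> is a root of the characteristic polynomial.\<close>

lemma integral_on_stable_module:
  assumes B: "is_subring B" and S: "finite S" and one: "(\<lambda>_. 1) \<in> S"
    and a: "\<And>s. s \<in> S \<Longrightarrow> (\<lambda>x. a x * s x) \<in> span_on X B S"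
  shows "integral_on X B a"
proof -
  let ?N = "card S"
  obtain e where e: "bij_betw e {0..<?N} S"
    using ex_bij_betw_nat_finite[OF S] by (rule exE)
  have eS: "e i \<in> S" if "i < ?N" for i
    using e that by (auto simp: bij_betw_def)
  have "\<forall>s'\<in>S. \<exists>c. (\<forall>s\<in>S. c s \<in> B) \<and> (\<forall>x\<in>X. a x * s' x = (\<Sum>s\<in>S. c s x * s x))"
    by (intro ballI span_on_coefficients[OF B S a])
  from bchoice[OF this] obtain c where
    "\<forall>s'\<in>S. (\<forall>s\<in>S. c s' s \<in> B) \<and> (\<forall>x\<in>X. a x * s' x = (\<Sum>s\<in>S. c s' s x * s x))"
    by (rule exE)
  then have c: "\<And>s' s. s' \<in> S \<Longrightarrow> s \<in> S \<Longrightarrow> c s' s \<in> B"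
    "\<And>s' x. s' \<in> S \<Longrightarrow> x \<in> X \<Longrightarrow> a x * s' x = (\<Sum>s\<in>S. c s' s x * s x)"
    by simp_all
  define M where "M x = mat ?N ?N (\<lambda>(i, j). c (e i) (e j) x)" for x
  have M: "M x \<in> carrier_mat ?N ?N" for x by (simp add: M_def)
  have coeffs: "coefficients_in B (\<lambda>x. char_poly (M x))"
    unfolding M_def by (rule char_poly_coefficients_in[OF B]) (intro c(1) eS)
  have root: "poly (char_poly (M x)) (a x) = 0" if x: "x \<in> X" for x
  proof -
    let ?v = "vec ?N (\<lambda>i. e i x)"
    have "M x *\<^sub>v ?v = a x \<cdot>\<^sub>v ?v"
    proof (rule eq_vecI)
      fix i assume "i < dim_vec (a x \<cdot>\<^sub>v ?v)"
      then have i: "i < ?N" by simp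
      have "(M x *\<^sub>v ?v) $ i = (\<Sum>j = 0..<?N. c (e i) (e j) x * e j x)"
        using i by (simp add: M_def scalar_prod_def)
      also have "\<dots> = (\<Sum>s\<in>S. c (e i) s x * s x)"
        by (rule sum.reindex_bij_betw[OF e])
      also have "\<dots> = (a x \<cdot>\<^sub>v ?v) $ i" using c(2)[OF eS[OF i] x] i by simp
      finally show "(M x *\<^sub>v ?v) $ i = (a x \<cdot>\<^sub>v ?v) $ i" .
    qed (simp add: M_def)
    moreover have "?v \<noteq> 0\<^sub>v ?N"
    proof
      assume v0: "?v = 0\<^sub>v ?N"
      have "(\<lambda>_. 1) \<in> e ` {0..<?N}" using one bij_betw_imp_surj_on[OF e] by simp
      then obtain i where i: "i < ?N" "e i = (\<lambda>_. 1)" by (elim imageE) simp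
      then have "?v $ i = 1" by simp
      with v0 i(1) show False by simp
    qed
    ultimately have "eigenvector (M x) ?v (a x)"
      unfolding eigenvector_def using M[of x] by simp
    then have "eigenvalue (M x) (a x)" unfolding eigenvalue_def by (rule exI)
    then show ?thesis by (rule iffD1[OF eigenvalue_root_char_poly[OF M]])
  qed
  have "a x ^ ?N + (\<Sum>i<?N. coeff (char_poly (M x)) i * a x ^ i) = 0" if "x \<in> X" for x
  proof -
    have "degree (char_poly (M x)) = ?N" "coeff (char_poly (M x)) ?N = 1"
      using degree_monic_char_poly[OF M] by simp_all
    then show ?thesis
      using root[OF that] by (simp add: poly_altdef lessThan_Suc_atMost[symmetric] add.commute)
  qed
  moreover have "(\<lambda>x. coeff (char_poly (M x)) i) \<in> B" for i
    using coeffs by (simp add: coefficients_in_def)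
  ultimately show ?thesis
    unfolding integral_on_def
    by (intro exI[of _ ?N] exI[of _ "\<lambda>i x. coeff (char_poly (M x)) i"]) blast
qed

definition monomials :: "('x \<Rightarrow> 'a::field) set \<Rightarrow> nat \<Rightarrow> ('x \<Rightarrow> 'a) set" where
  "monomials V d = (\<lambda>vs x. \<Prod>v\<leftarrow>vs. v x) ` {vs. set vs \<subseteq> V \<and> length vs \<le> d}"

lemma finite_monomials: "finite V \<Longrightarrow> finite (monomials V d)"
  unfolding monomials_def by (intro finite_imageI finite_lists_length_le)

lemma monomialsI: "set vs \<subseteq> V \<Longrightarrow> length vs \<le> d \<Longrightarrow> (\<lambda>x. \<Prod>v\<leftarrow>vs. v x) \<in> monomials V d"
  unfolding monomials_def by blast

lemma prod_list_split_power:
  fixes f :: "'b \<Rightarrow> 'a::comm_monoid_mult"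
  assumes "q \<le> count_list vs u"
  shows "\<exists>ws. set ws \<subseteq> set vs \<and> length ws + q = length vs \<and>
    (\<forall>f::'b \<Rightarrow> 'a. (\<Prod>v\<leftarrow>vs. f v) = f u ^ q * (\<Prod>v\<leftarrow>ws. f v))"
  using assms
proof (induction vs arbitrary: q)
  case Nil
  then show ?case by simp
next
  case (Cons v vs)
  show ?case
  proof (cases "v = u \<and> q > 0")
    case True
    then obtain r where r: "q = Suc r" using gr0_conv_Suc by blast
    with Cons.prems True have "r \<le> count_list vs u" by simp
    from Cons.IH[OF this] obtain ws where "set ws \<subseteq> set vs" "length ws + r = length vs"
      "\<forall>f::'b \<Rightarrow> 'a. (\<Prod>v\<leftarrow>vs. f v) = f u ^ r * (\<Prod>v\<leftarrow>ws. f v)" by (elim exE conjE)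
    then show ?thesis using True r by (intro exI[of _ ws]) (auto simp: mult.assoc)
  next
    case False
    then have "q \<le> count_list vs u" using Cons.prems by (auto split: if_splits)
    from Cons.IH[OF this] obtain ws where "set ws \<subseteq> set vs" "length ws + q = length vs"
      "\<forall>f::'b \<Rightarrow> 'a. (\<Prod>v\<leftarrow>vs. f v) = f u ^ q * (\<Prod>v\<leftarrow>ws. f v)" by (elim exE conjE)
    then show ?thesis by (intro exI[of _ "v # ws"]) (auto simp: mult.left_commute)
  qed
qed

text \<open>A product of more than \<open>card V * (q - 1)\<close> factors contains some \<open>u ^ q\<close> by the pigeonhole principle.
Replacing it by a \<open>B\<close>-combination of single members of \<open>V\<close> shortens the product, as \<open>q \<ge> 2\<close>.\<close>

lemma monomials_stable:
  fixes V :: "('x \<Rightarrow> 'a::field) set"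
  assumes B: "is_subring B" and V: "finite V" and q: "q \<ge> 2"
    and pow: "\<And>v. v \<in> V \<Longrightarrow> (\<lambda>x. v x ^ q) \<in> span_on X B V"
    and v: "v \<in> V" and s: "s \<in> monomials V (card V * (q - 1))"
  shows "(\<lambda>x. v x * s x) \<in> span_on X B (monomials V (card V * (q - 1)))"
proof -
  let ?D = "card V * (q - 1)"
  obtain vs where vs: "s = (\<lambda>x. \<Prod>v\<leftarrow>vs. v x)" "set vs \<subseteq> V" "length vs \<le> ?D"
    using s unfolding monomials_def by blast
  let ?ws = "v # vs"
  have eq: "(\<lambda>x. v x * s x) = (\<lambda>x. \<Prod>v\<leftarrow>?ws. v x)" using vs(1) by simp
  show ?thesis
  proof (cases "length vs < ?D")
    case True
    then show ?thesis
      unfolding eq using vs v by (intro span_on_base[OF B] monomialsI) auto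
  next
    case False
    have "\<exists>u\<in>V. q \<le> count_list ?ws u"
    proof (rule ccontr)
      assume "\<not> (\<exists>u\<in>V. q \<le> count_list ?ws u)"
      then have "count_list ?ws u \<le> q - 1" if "u \<in> V" for u using that q by force
      then have "(\<Sum>u\<in>V. count_list ?ws u) \<le> (\<Sum>u\<in>V. q - 1)" by (rule sum_mono)
      then have "length ?ws \<le> ?D"
        using sum_count_set[of ?ws V] vs(2) v V by simp
      with False show False by simp
    qed
    then obtain u where u: "u \<in> V" "q \<le> count_list ?ws u" by blast
    obtain ws where ws: "set ws \<subseteq> set ?ws" "length ws + q = length ?ws"
      "\<forall>f::_ \<Rightarrow> 'a. (\<Prod>v\<leftarrow>?ws. f v) = f u ^ q * (\<Prod>v\<leftarrow>ws. f v)"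
      using prod_list_split_power[OF u(2)] by (elim exE conjE)
    let ?m = "\<lambda>x. \<Prod>v\<leftarrow>ws. v x"
    have "(\<lambda>x. ?m x * u x ^ q) \<in> span_on X B (monomials V ?D)"
    proof (rule span_on_stable[OF B pow[OF u(1)]])
      fix w assume "w \<in> V"
      then have "(\<lambda>x. \<Prod>v\<leftarrow>w # ws. v x) \<in> monomials V ?D"
        using ws(1,2) vs(2,3) v q by (intro monomialsI) auto
      from span_on_base[OF B this, of X]
      show "(\<lambda>x. ?m x * w x) \<in> span_on X B (monomials V ?D)"
        by (rule span_on_cong) simp
    qed
    moreover have "(\<Prod>v\<leftarrow>?ws. v x) = ?m x * u x ^ q" for x
      using spec[OF ws(3), of "\<lambda>v. v x"] by (simp only: mult.commute)
    ultimately show ?thesis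
      unfolding eq by (elim span_on_cong) simp
  qed
qed

text \<open>The relations for the powers \<open>v ^ q\<close> make the module spanned by the monomials of bounded
length stable under multiplication by \<open>V\<close>. Therefore it is stable under all
regular functions, and the determinant trick applies to each of them.\<close>

theorem integral_on_generated:
  fixes V :: "('a::field mat \<Rightarrow> 'a) set"
  assumes B: "is_subring B" "\<And>c. (\<lambda>_. c) \<in> B" and V: "finite V" and q: "q \<ge> 2"
    and pow: "\<And>v. v \<in> V \<Longrightarrow> (\<lambda>x. v x ^ q) \<in> span_on X B V"
    and entry: "\<And>i j. i < n \<Longrightarrow> j < n \<Longrightarrow> (\<lambda>x. x $$ (i, j)) \<in> span_on X B V"
    and inv_det: "(\<lambda>x. inverse (det x)) \<in> span_on X B V"
    and a: "a \<in> regular_functions n"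
  shows "integral_on X B a"
proof (rule integral_on_stable_module[OF B(1) finite_monomials[OF V]])
  let ?S = "monomials V (card V * (q - 1))"
  have stable_V: "(\<lambda>x. v x * s x) \<in> span_on X B ?S" if "v \<in> V" "s \<in> ?S" for v s
    by (rule monomials_stable[OF B(1) V q pow that])
  have span_V: "(\<lambda>x. f x * s x) \<in> span_on X B ?S" if f: "f \<in> span_on X B V" and s: "s \<in> ?S" for f s
  proof -
    have "(\<lambda>x. s x * f x) \<in> span_on X B ?S"
    proof (rule span_on_stable[OF B(1) f])
      fix v assume "v \<in> V"
      from stable_V[OF this s] show "(\<lambda>x. s x * v x) \<in> span_on X B ?S"
        by (simp add: mult.commute)
    qed
    then show ?thesis by (simp add: mult.commute)
  qed
  show "(\<lambda>_. 1) \<in> ?S" using monomialsI[of "[]"] by simp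
  show "(\<lambda>x. a x * s x) \<in> span_on X B ?S" if "s \<in> ?S" for s
    using a that
  proof (induction arbitrary: s)
    case (const c)
    show ?case by (rule span_on_scale[OF B span_on_base[OF B(1) const]])
  next
    case (add f g)
    show ?case
      by (rule span_on_cong[OF span_on_add[OF add.IH(1)[OF add.prems] add.IH(2)[OF add.prems]]])
        (simp add: algebra_simps)
  next
    case (mult f g)
    have "(\<lambda>x. f x * (g x * s x)) \<in> span_on X B ?S"
      by (rule span_on_stable[OF B(1) mult.IH(2)[OF mult.prems] mult.IH(1)])
    then show ?case by (simp add: mult.assoc)
  qed (intro span_V entry inv_det; assumption)+
qed

section \<open>Integral self-maps are surjective\<close>

text \<open>The image of the ring of regular functions under the pullback \<open>L\<^sup>*\<close>, as functions on \<open>X\<close>.\<close>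

definition pulled_back :: "nat \<Rightarrow> 'a::field mat set \<Rightarrow> ('a mat \<Rightarrow> 'a mat) \<Rightarrow> ('a mat \<Rightarrow> 'a) set" where
  "pulled_back n X L = {f. \<exists>b\<in>regular_functions n. \<forall>x\<in>X. f x = b (L x)}"

lemma pulled_back_constant: "(\<lambda>_. c) \<in> pulled_back n X L"
  unfolding pulled_back_def by (auto intro: bexI[OF _ regular_functions.const])

lemma pulled_back_subring: "is_subring (pulled_back n X L)"
proof -
  note RF = is_subringD[OF regular_functions_subring]
  show ?thesis
    unfolding is_subring_def
  proof (intro conjI ballI)
    show "0 \<in> pulled_back n X L" "1 \<in> pulled_back n X L"
      using pulled_back_constant[of 0 n X L] pulled_back_constant[of 1 n X L]
      by (simp_all add: zero_fun_def one_fun_def)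
    fix f assume "f \<in> pulled_back n X L"
    then obtain b where b: "b \<in> regular_functions n" "\<forall>x\<in>X. f x = b (L x)"
      unfolding pulled_back_def by blast
    show "- f \<in> pulled_back n X L"
      unfolding pulled_back_def by (rule CollectI, rule bexI[OF _ RF(3)[OF b(1)]]) (simp add: b)
    fix g assume "g \<in> pulled_back n X L"
    then obtain c where c: "c \<in> regular_functions n" "\<forall>x\<in>X. g x = c (L x)"
      unfolding pulled_back_def by blast
    show "f + g \<in> pulled_back n X L"
      unfolding pulled_back_def by (rule CollectI, rule bexI[OF _ RF(4)[OF b(1) c(1)]]) (simp add: b c)
    show "f * g \<in> pulled_back n X L"
      unfolding pulled_back_def by (rule CollectI, rule bexI[OF _ RF(5)[OF b(1) c(1)]]) (simp add: b c)
  qed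
qed

lemma sum_power_shift:
  fixes y :: "'a::comm_ring_1"
  shows "y ^ Suc N + (\<Sum>i<Suc N. d i * y ^ i) = d 0 + y * (y ^ N + (\<Sum>i<N. d (Suc i) * y ^ i))"
proof -
  have "(\<Sum>i<N. d (Suc i) * y ^ Suc i) = y * (\<Sum>i<N. d (Suc i) * y ^ i)"
    unfolding sum_distrib_left by (intro sum.cong) simp_all
  then show ?thesis unfolding sum.lessThan_Suc_shift by (simp add: distrib_left)
qed

lemma integral_on_pulled_backE:
  assumes "integral_on X (pulled_back n X L) a"
  obtains N c where "\<And>i. c i \<in> regular_functions n"
    "\<And>x. x \<in> X \<Longrightarrow> a x ^ N + (\<Sum>i<N. c i (L x) * a x ^ i) = 0"
proof -
  obtain N b where b: "\<forall>i. b i \<in> pulled_back n X L"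
    "\<forall>x\<in>X. a x ^ N + (\<Sum>i<N. b i x * a x ^ i) = 0"
    using assms unfolding integral_on_def by (elim exE conjE)
  have "\<forall>i. \<exists>c. c \<in> regular_functions n \<and> (\<forall>x\<in>X. b i x = c (L x))"
    using b(1) unfolding pulled_back_def by blast
  from choice[OF this] obtain c where c: "\<forall>i. c i \<in> regular_functions n \<and> (\<forall>x\<in>X. b i x = c i (L x))"
    by (rule exE)
  show ?thesis
    by (rule that[of c N]) (use c b(2) in simp_all)
qed

lemma regular_map_funpow:
  assumes "X \<subseteq> carrier (GL n)" "regular_map n X L" "L ` X \<subseteq> X"
  shows "(L ^^ k) ` X \<subseteq> X \<and> regular_map n X (L ^^ k)"
proof (induction k)
  case 0
  then show ?case using regular_map_id[OF assms(1)] by (simp add: id_def)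
next
  case (Suc k)
  then have "regular_map n X (\<lambda>x. L ((L ^^ k) x))"
    using regular_map_compose[OF _ _ assms(2)] by simp
  with Suc assms(3) show ?case by (simp add: comp_def image_subset_iff)
qed

text \<open>Let \<open>J k\<close> be the kernel of the \<open>k\<close>-th power of \<open>L\<^sup>*\<close>. If \<open>J 1\<close> contains a function that is not
zero on \<open>X\<close>, then the chain \<open>J\<close> increases strictly. For \<open>a \<in> J (k + 1) - J k\<close>, the nonzero
function \<open>g = a \<circ> L\<^sup>k\<close> satisfies a monic equation with coefficients \<open>c\<^sub>i \<circ> L\<^sup>k\<^sup>+\<^sup>1\<close>: compose an
integral equation of \<open>a\<close> with \<open>L\<^sup>k\<close>. Choose the degree minimal. As \<open>g \<circ> L = 0\<close>, the
constant coefficient \<open>c\<^sub>0\<close> lies in \<open>J (k + 2)\<close>. It is not in \<open>J (k + 1)\<close>, for otherwise one could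
cancel a factor \<open>g\<close> and lower the degree.\<close>

theorem integral_pullback_injective:
  assumes X: "X \<subseteq> carrier (GL n)" "irreducible_set n X"
    and L: "regular_map n X L" "L ` X \<subseteq> X"
    and integral: "\<And>a. a \<in> regular_functions n \<Longrightarrow> integral_on X (pulled_back n X L) a"
    and f: "f \<in> regular_functions n" "\<And>x. x \<in> X \<Longrightarrow> f (L x) = 0"
  shows "\<forall>x\<in>X. f x = 0"
proof (rule ccontr)
  assume f0: "\<not> (\<forall>x\<in>X. f x = 0)"
  note RF = is_subringD[OF regular_functions_subring]
  note pow = regular_map_funpow[OF X(1) L]
  define J where "J k = {f \<in> regular_functions n. \<forall>x\<in>X. f ((L ^^ k) x) = 0}" for k
  have J: "ideal_in (regular_functions n) (J k)" for k
    unfolding ideal_in_def J_def by (auto simp: RF)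
  have LX: "L x \<in> X" "(L ^^ k) x \<in> X" if "x \<in> X" for x k
    using L(2) pow[of k] that by auto
  have "mono J"
  proof (rule mono_iff_le_Suc[THEN iffD2], intro allI subsetI)
    fix k g assume "g \<in> J k"
    then show "g \<in> J (Suc k)" using LX(1) by (simp add: J_def funpow_swap1)
  qed
  then obtain M where M: "\<forall>k. J k \<subseteq> J M"
    using noetherian_ascending_chain[where J = J, OF regular_functions_subring
        noetherian_regular_functions J]
    by (elim meta_impE exE)
  have strict: "\<exists>a. a \<in> J (Suc k) \<and> a \<notin> J k" for k
  proof (induction k)
    case 0
    then show ?case using f f0 by (intro exI[of _ f]) (simp add: J_def)
  next
    case (Suc k)
    then obtain a where a: "a \<in> regular_functions n" "a \<in> J (Suc k)" "a \<notin> J k"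
      by (auto simp: J_def)
    define g where "g x = a ((L ^^ k) x)" for x
    have g_reg: "regular_on n X g"
      unfolding g_def using regular_mapD(2)[OF conjunct2[OF pow] a(1)] .
    have gL: "g (L x) = 0" if "x \<in> X" for x
      using a(2) that by (simp add: J_def g_def funpow_swap1)
    let ?rel = "\<lambda>N c. (\<forall>i. c i \<in> regular_functions n) \<and>
      (\<forall>x\<in>X. g x ^ N + (\<Sum>i<N. c i ((L ^^ Suc k) x) * g x ^ i) = 0)"
    have "\<exists>N c. ?rel N c"
    proof -
      obtain N c where "\<And>i. c i \<in> regular_functions n"
        "\<And>x. x \<in> X \<Longrightarrow> a x ^ N + (\<Sum>i<N. c i (L x) * a x ^ i) = 0"
        by (rule integral_on_pulled_backE[OF integral[OF a(1)]], rule that)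
      then have "?rel N c" using LX(2)[of _ k] by (simp add: g_def)
      then show ?thesis by (intro exI)
    qed
    then have least: "\<exists>c. ?rel (LEAST N. \<exists>c. ?rel N c) c" by (rule LeastI_ex)
    define N where "N = (LEAST N. \<exists>c. ?rel N c)"
    obtain c where c: "?rel N c" using least unfolding N_def by (rule exE)
    obtain x0 where "x0 \<in> X" using X(2) by (auto simp: irreducible_set_def)
    with c have "N \<noteq> 0" by (intro notI) simp
    then obtain N' where N': "N = Suc N'" using not0_implies_Suc by blast
    have shift: "g x ^ N + (\<Sum>i<N. c i ((L ^^ Suc k) x) * g x ^ i) =
        c 0 ((L ^^ Suc k) x) + g x * (g x ^ N' + (\<Sum>i<N'. c (Suc i) ((L ^^ Suc k) x) * g x ^ i))" for x
      unfolding N' by (rule sum_power_shift)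
    have "c 0 \<in> J (Suc (Suc k))"
    proof -
      have "c 0 ((L ^^ Suc k) (L x)) = 0" if "x \<in> X" for x
        using bspec[OF conjunct2[OF c] LX(1)[OF that]] unfolding shift gL[OF that] by (simp add: N')
      then show ?thesis using c by (simp add: J_def funpow_swap1)
    qed
    moreover have "c 0 \<notin> J (Suc k)"
    proof
      assume "c 0 \<in> J (Suc k)"
      then have zero: "g x * (g x ^ N' + (\<Sum>i<N'. c (Suc i) ((L ^^ Suc k) x) * g x ^ i)) = 0"
        if "x \<in> X" for x
        using c shift[of x] that unfolding J_def by simp
      have "regular_on n X (\<lambda>x. c i ((L ^^ Suc k) x))" for i
        using c by (intro regular_mapD(2)[OF conjunct2[OF pow]]) blast
      then have "regular_on n X (\<lambda>x. g x ^ N' + (\<Sum>i<N'. c (Suc i) ((L ^^ Suc k) x) * g x ^ i))"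
        by (intro regular_on_add regular_on_sum regular_on_mult regular_on_power g_reg)
      from irreducible_integral_domain[OF X(2,1) g_reg this zero]
      show False
      proof
        assume "\<forall>x\<in>X. g x = 0"
        with a(1,3) show False by (simp add: J_def g_def)
      next
        assume "\<forall>x\<in>X. g x ^ N' + (\<Sum>i<N'. c (Suc i) ((L ^^ Suc k) x) * g x ^ i) = 0"
        with c have "?rel N' (\<lambda>i. c (Suc i))" by simp
        then have "\<exists>c. ?rel N' c" by (rule exI[of _ "\<lambda>i. c (Suc i)"])
        then have "N \<le> N'" unfolding N_def by (rule Least_le)
        with N' show False by simp
      qed
    qed
    ultimately show ?case by (intro exI[of _ "c 0"] conjI)
  qed
  obtain a where "a \<in> J (Suc M)" "a \<notin> J M" using strict[of M] by (elim exE conjE)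
  with M show False by blast
qed

lemma ideal_congruent_power:
  assumes "is_subring B" "ideal_in B J" "a \<in> B" "b \<in> B" "a - b \<in> J"
  shows "a ^ k - b ^ k \<in> J"
proof (induction k)
  case 0
  show ?case using ideal_inD(2)[OF assms(2)] by simp
next
  case (Suc k)
  have "a ^ Suc k - b ^ Suc k = a * (a ^ k - b ^ k) + b ^ k * (a - b)" by (simp add: algebra_simps)
  moreover have "a * (a ^ k - b ^ k) + b ^ k * (a - b) \<in> J"
    by (intro ideal_inD(3,4)[OF assms(2)] Suc assms is_subring_power)
  ultimately show ?case by simp
qed

lemma ideal_in_sum:
  assumes "ideal_in B J" "\<And>i. i \<in> I \<Longrightarrow> f i \<in> J"
  shows "sum f I \<in> J"
  using assms(2) by (induction I rule: infinite_finite_induct) (auto simp: ideal_inD[OF assms(1)])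

lemma ideal_in_insert:
  assumes B: "is_subring B" and J: "ideal_in B J" and f: "f \<in> B"
  shows "ideal_in B {i + r * f |i r. i \<in> J \<and> r \<in> B}" (is "ideal_in B ?J")
    and "J \<subseteq> {i + r * f |i r. i \<in> J \<and> r \<in> B}"
    and "f \<in> {i + r * f |i r. i \<in> J \<and> r \<in> B}"
proof -
  note B' = is_subringD[OF B] and J' = ideal_inD[OF J]
  have memI: "a \<in> ?J" if "i \<in> J" "r \<in> B" "a = i + r * f" for a i r
    using that by blast
  show "ideal_in B ?J"
    unfolding ideal_in_def
  proof (intro conjI ballI)
    show "?J \<subseteq> B" using J'(1) B'(4,5) f by blast
    show "0 \<in> ?J" by (rule memI[OF J'(2) B'(1)]) simp
    fix a assume "a \<in> ?J"
    then obtain i r where a: "a = i + r * f" "i \<in> J" "r \<in> B" by blast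
    show "s * a \<in> ?J" if "s \<in> B" for s
      by (rule memI[OF J'(4)[OF that a(2)] B'(5)[OF that a(3)]]) (simp add: a algebra_simps)
    fix b assume "b \<in> ?J"
    then obtain j s where b: "b = j + s * f" "j \<in> J" "s \<in> B" by blast
    show "a + b \<in> ?J"
      by (rule memI[OF J'(3)[OF a(2) b(2)] B'(4)[OF a(3) b(3)]]) (simp add: a b algebra_simps)
  qed
  show "J \<subseteq> ?J" by (rule subsetI, rule memI[OF _ B'(1)]) simp_all
  show "f \<in> ?J" by (rule memI[OF J'(2) B'(2)]) simp
qed

text \<open>An ideal that is maximal among those disjoint from a multiplicative set is prime. The first of the
two final clauses is the maximality, in the form in which it is applied.\<close>

lemma maximal_disjoint_ideal:
  assumes B: "is_subring B" "noetherian B" and I0: "ideal_in B I0" "I0 \<inter> S = {}"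
    and S: "S \<subseteq> B" "\<And>s t. s \<in> S \<Longrightarrow> t \<in> S \<Longrightarrow> s * t \<in> S"
  obtains I where "ideal_in B I" "I0 \<subseteq> I" "I \<inter> S = {}"
    "\<forall>f\<in>B. f \<notin> I \<longrightarrow> (\<exists>i\<in>I. \<exists>r\<in>B. i + r * f \<in> S)"
    "\<forall>f\<in>B. \<forall>g\<in>B. f * g \<in> I \<longrightarrow> f \<in> I \<or> g \<in> I"
proof -
  let ?P = "\<lambda>I. ideal_in B I \<and> I0 \<subseteq> I \<and> I \<inter> S = {}"
  have "?P I0" using I0 by simp
  then have "\<exists>I. ?P I \<and> (\<forall>J. ?P J \<longrightarrow> I \<subseteq> J \<longrightarrow> J = I)"
    by (rule noetherian_maximal_ideal[where P = ?P, OF B]) simp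
  then obtain I where I': "?P I \<and> (\<forall>J. ?P J \<longrightarrow> I \<subseteq> J \<longrightarrow> J = I)" by (rule exE)
  then have I: "ideal_in B I" "I0 \<subseteq> I" "I \<inter> S = {}" by simp_all
  have max: "J = I" if "ideal_in B J" "I0 \<subseteq> J" "J \<inter> S = {}" "I \<subseteq> J" for J
    using spec[OF conjunct2[OF I'], of J] that by simp
  have meets: "\<exists>i\<in>I. \<exists>r\<in>B. i + r * f \<in> S" if f: "f \<in> B" "f \<notin> I" for f
  proof (rule ccontr)
    let ?J = "{i + r * f |i r. i \<in> I \<and> r \<in> B}"
    note J = ideal_in_insert[OF B(1) I(1) f(1)]
    assume "\<not> (\<exists>i\<in>I. \<exists>r\<in>B. i + r * f \<in> S)"
    then have "?J \<inter> S = {}" by blast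
    then have "?J = I" using J(2) I(2) by (intro max J(1)) simp_all
    with J(3) f(2) show False by simp
  qed
  have prime: "f \<in> I \<or> g \<in> I" if fg: "f \<in> B" "g \<in> B" "f * g \<in> I" for f g
  proof (rule ccontr)
    note B' = is_subringD[OF B(1)] and I'' = ideal_inD[OF I(1)]
    assume "\<not> (f \<in> I \<or> g \<in> I)"
    then have "f \<notin> I" "g \<notin> I" by simp_all
    obtain i r where 1: "i \<in> I" "r \<in> B" "i + r * f \<in> S"
      using meets[OF fg(1) \<open>f \<notin> I\<close>] by (elim bexE)
    obtain j s where 2: "j \<in> I" "s \<in> B" "j + s * g \<in> S"
      using meets[OF fg(2) \<open>g \<notin> I\<close>] by (elim bexE)
    have "(i + r * f) * (j + s * g) = (j + s * g) * i + ((r * f) * j + (r * s) * (f * g))"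
      by (simp add: algebra_simps)
    also have "\<dots> \<in> I"
      using 1 2 fg(1,2) S(1)
      by (intro I''(3)[OF I''(4)[OF _ 1(1)] I''(3)[OF I''(4)[OF _ 2(1)] I''(4)[OF _ fg(3)]]] B'(5)) auto
    finally show False using S(2)[OF 1(3) 2(3)] I(3) by blast
  qed
  show ?thesis
    by (rule that[OF I]) (intro ballI impI meets prime; assumption)+
qed

text \<open>Let \<open>S\<close> be the set of pullbacks of the functions that do not vanish at \<open>h\<close>. As \<open>L\<^sup>*\<close> is injective,
no member of \<open>S\<close> vanishes on \<open>X\<close>, so there is an ideal \<open>I\<close> of functions, containing those that
vanish on \<open>X\<close>, which is maximal among the ideals disjoint from \<open>S\<close>. It contains
the pullbacks of all functions vanishing at \<open>h\<close>. Hence, modulo \<open>I\<close>, an integral equation has constant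
coefficients, and since \<open>I\<close> is prime and the field algebraically closed, every function is
congruent to a constant. The constants for the matrix entries form a matrix \<open>x0\<close>, and evaluation at
\<open>x0\<close> agrees with reduction modulo \<open>I\<close>. Therefore \<open>x0 \<in> X\<close> and \<open>L x0 = h\<close>.\<close>

theorem integral_map_surjective:
  fixes X :: "'a::alg_closed_field mat set"
  assumes X: "closedin (zariski n) X" "irreducible_set n X"
    and L: "regular_map n X L" "L ` X \<subseteq> X"
    and integral: "\<And>a. a \<in> regular_functions n \<Longrightarrow> integral_on X (pulled_back n X L) a"
    and h: "h \<in> X"
  shows "\<exists>x\<in>X. L x = h"
proof -
  let ?R = "regular_functions n :: ('a mat \<Rightarrow> 'a) set"
  let ?K = "\<lambda>c::'a. (\<lambda>_::'a mat. c)"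
  have XG: "X \<subseteq> carrier (GL n)" using closedin_subset[OF X(1)] by simp
  note R = is_subringD[OF regular_functions_subring[of n]]
  have K: "?K c \<in> ?R" for c by (rule regular_functions.const)
  have R_diff: "f - g \<in> ?R" if "f \<in> ?R" "g \<in> ?R" for f g
    using R(4)[OF that(1) R(3)[OF that(2)]] by simp
  have R_power: "f ^ k \<in> ?R" if "f \<in> ?R" for f k
    by (rule is_subring_power[OF regular_functions_subring that])
  define S where "S = {f \<in> ?R. \<exists>s\<in>?R. s h \<noteq> 0 \<and> (\<forall>x\<in>X. f x = s (L x))}"
  have SI: "f \<in> S" if "f \<in> ?R" "s \<in> ?R" "s h \<noteq> 0" "\<And>x. x \<in> X \<Longrightarrow> f x = s (L x)" for f s
    using that unfolding S_def by blast
  have disj: "vanishing_ideal n X \<inter> S = {}"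
  proof (rule equals0I)
    fix f assume "f \<in> vanishing_ideal n X \<inter> S"
    then obtain s where s: "s \<in> ?R" "s h \<noteq> 0" "\<And>x. x \<in> X \<Longrightarrow> s (L x) = 0"
      by (auto simp: S_def vanishing_ideal_def)
    from integral_pullback_injective[OF XG X(2) L integral s(1,3)] h s(2)
    show False by simp
  qed
  have S_mult: "s * t \<in> S" if "s \<in> S" "t \<in> S" for s t
  proof -
    from that obtain s' t' where st: "s' \<in> ?R" "s' h \<noteq> 0" "\<forall>x\<in>X. s x = s' (L x)"
      "t' \<in> ?R" "t' h \<noteq> 0" "\<forall>x\<in>X. t x = t' (L x)" "s \<in> ?R" "t \<in> ?R" unfolding S_def by blast
    show ?thesis
      by (rule SI[of _ "s' * t'"]) (use st in \<open>simp_all add: R(5)\<close>)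
  qed
  have "S \<subseteq> ?R" by (auto simp: S_def)
  from maximal_disjoint_ideal[OF regular_functions_subring noetherian_regular_functions
      ideal_in_vanishing disj this S_mult]
  obtain I where I: "ideal_in ?R I" "vanishing_ideal n X \<subseteq> I" "I \<inter> S = {}"
    and meets': "\<forall>f\<in>?R. f \<notin> I \<longrightarrow> (\<exists>i\<in>I. \<exists>r\<in>?R. i + r * f \<in> S)"
    and prime': "\<forall>f\<in>?R. \<forall>g\<in>?R. f * g \<in> I \<longrightarrow> f \<in> I \<or> g \<in> I" .
  have meets: "\<exists>i\<in>I. \<exists>r\<in>?R. i + r * f \<in> S" if "f \<in> ?R" "f \<notin> I" for f
    using meets' that by simp
  have prime: "f \<in> I \<or> g \<in> I" if "f \<in> ?R" "g \<in> ?R" "f * g \<in> I" for f g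
    using prime' that by simp
  note I' = ideal_inD[OF I(1)] and I_diff = ideal_in_minus[OF regular_functions_subring I(1)]
  have I_vanish: "f \<in> I" if "f \<in> ?R" "\<And>x. x \<in> X \<Longrightarrow> f x = 0" for f
    using I(2) that by (auto simp: vanishing_ideal_def)
  have I_trans: "f \<in> I" if "f - g \<in> I" "g \<in> I" for f g
    using I'(3)[OF that] by simp
  have I_const: "c = 0" if "?K c \<in> I" for c
  proof (rule ccontr)
    assume "c \<noteq> 0"
    then have "?K c \<in> S" by (intro SI[OF K K[of c]]) simp_all
    with that I(3) show False by blast
  qed
  \<comment> \<open>The lying-over step: \<open>I\<close> contains the pullback of the maximal ideal of \<open>h\<close>. If
    \<open>b'\<close> were missing, some \<open>s = i + r b'\<close> would lie in \<open>S\<close>. Multiplying the integral equation of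
    \<open>r\<close> by \<open>b' ^ N\<close> and replacing \<open>r b'\<close> by \<open>s\<close> gives an element \<open>T\<close> of \<open>I\<close>, which is the
    pullback of a function with value \<open>\<sigma> h ^ N \<noteq> 0\<close> at \<open>h\<close>.\<close>
  have over: "b' \<in> I" if b: "b \<in> ?R" "b h = 0" "b' \<in> ?R" "\<And>x. x \<in> X \<Longrightarrow> b' x = b (L x)" for b b'
  proof (rule ccontr)
    assume "b' \<notin> I"
    obtain i r where ir: "i \<in> I" "r \<in> ?R" "i + r * b' \<in> S"
      using meets[OF b(3) \<open>b' \<notin> I\<close>] by (elim bexE)
    define s where "s = i + r * b'"
    have sR: "s \<in> ?R" using ir(3) by (simp add: s_def S_def)
    obtain \<sigma> where \<sigma>: "\<sigma> \<in> ?R" "\<sigma> h \<noteq> 0" "\<And>x. x \<in> X \<Longrightarrow> s x = \<sigma> (L x)"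
      using ir(3) unfolding S_def s_def[symmetric] by blast
    obtain N c where c: "\<And>i. c i \<in> ?R" "\<And>x. x \<in> X \<Longrightarrow> r x ^ N + (\<Sum>i<N. c i (L x) * r x ^ i) = 0"
      by (rule integral_on_pulled_backE[OF integral[OF ir(2)]], rule that)
    have "\<forall>i. \<exists>c'. c' \<in> ?R \<and> (\<forall>x\<in>X. c i (L x) = c' x)"
      using regular_mapD(2)[OF L(1) c(1)] unfolding regular_on_def by blast
    from choice[OF this] obtain c' where c': "\<forall>i. c' i \<in> ?R \<and> (\<forall>x\<in>X. c i (L x) = c' i x)"
      by (rule exE)
    have c'R: "c' i \<in> ?R" for i using c' by simp
    define T where "T = s ^ N + (\<Sum>i<N. c' i * b' ^ (N - i) * s ^ i)"
    define U where "U = (r * b') ^ N + (\<Sum>i<N. c' i * b' ^ (N - i) * (r * b') ^ i)"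
    have cong: "s ^ k - (r * b') ^ k \<in> I" for k
      by (rule ideal_congruent_power[OF regular_functions_subring I(1) sR R(5)[OF ir(2) b(3)]])
        (simp add: s_def ir(1))
    have "T - U = (s ^ N - (r * b') ^ N) + (\<Sum>i<N. (c' i * b' ^ (N - i)) * (s ^ i - (r * b') ^ i))"
      unfolding T_def U_def by (simp add: algebra_simps sum_subtractf)
    also have "\<dots> \<in> I"
      by (intro I'(3,4) ideal_in_sum[OF I(1)] cong R(5) R_power b(3) c'R)
    finally have TU: "T - U \<in> I" .
    have "U x = 0" if "x \<in> X" for x
    proof -
      have "U x = b' x ^ N * r x ^ N + (\<Sum>i<N. c' i x * (b' x ^ (N - i) * b' x ^ i) * r x ^ i)"
        unfolding U_def by (simp add: sum_fun_apply power_fun_apply power_mult_distrib algebra_simps)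
      also have "(\<Sum>i<N. c' i x * (b' x ^ (N - i) * b' x ^ i) * r x ^ i) =
          (\<Sum>i<N. b' x ^ N * (c i (L x) * r x ^ i))"
        using c' that by (intro sum.cong) (simp_all add: power_add[symmetric])
      also have "b' x ^ N * r x ^ N + \<dots> = b' x ^ N * (r x ^ N + (\<Sum>i<N. c i (L x) * r x ^ i))"
        by (simp add: distrib_left sum_distrib_left)
      finally show ?thesis using c(2)[OF that] by simp
    qed
    moreover have "U \<in> ?R"
      unfolding U_def
      by (intro R(4,5) R_power is_subring_sum[OF regular_functions_subring] ir(2) b(3) c'R)
    ultimately have "T \<in> I" using I_trans[OF TU] I_vanish by blast
    moreover have "T \<in> S"
    proof (rule SI)
      show "T \<in> ?R"
        unfolding T_def
        by (intro R(4,5) R_power is_subring_sum[OF regular_functions_subring] sR b(3) c'R)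
      show "\<sigma> ^ N + (\<Sum>i<N. c i * b ^ (N - i) * \<sigma> ^ i) \<in> ?R"
        by (intro R(4,5) R_power is_subring_sum[OF regular_functions_subring] \<sigma>(1) b(1) c(1))
      show "(\<sigma> ^ N + (\<Sum>i<N. c i * b ^ (N - i) * \<sigma> ^ i)) h \<noteq> 0"
        using \<sigma>(2) by (simp add: sum_fun_apply power_fun_apply b(2) power_0_left)
      show "T x = (\<sigma> ^ N + (\<Sum>i<N. c i * b ^ (N - i) * \<sigma> ^ i)) (L x)" if "x \<in> X" for x
        using c' that by (simp add: T_def sum_fun_apply power_fun_apply \<sigma>(3)[OF that] b(4)[OF that])
    qed
    ultimately show False using I(3) by blast
  qed
  \<comment> \<open>So every regular function pulled back along \<open>L\<close> is congruent to its value at \<open>h\<close>.\<close>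
  have over_const: "f' - ?K (f h) \<in> I" if "f \<in> ?R" "f' \<in> ?R" "\<And>x. x \<in> X \<Longrightarrow> f' x = f (L x)" for f f'
    by (rule over[of "f - ?K (f h)"]) (use that K R_diff in auto)
  have poly_R: "(\<lambda>x. poly p (a x)) \<in> ?R" if "a \<in> ?R" for p a
  proof (induction p)
    case 0
    then show ?case using K[of 0] by simp
  next
    case (pCons c p)
    have "?K c + a * (\<lambda>x. poly p (a x)) \<in> ?R" by (intro R(4,5) K that pCons.IH)
    then show ?case by (simp add: plus_fun_def times_fun_def)
  qed
  have root: "\<exists>z. a - ?K z \<in> I" if "a \<in> ?R" "p \<noteq> 0" "(\<lambda>x. poly p (a x)) \<in> I" for a p
    using that(2,3)
  proof (induction "degree p" arbitrary: p)
    case 0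
    then obtain c where "p = [:c:]" using degree_eq_zeroE by metis
    then show ?case using 0 I_const[of c] by simp
  next
    case (Suc d)
    then have "\<exists>z. poly p z = 0" by (intro alg_closed_imp_poly_has_root) simp
    then obtain z where "poly p z = 0" by (rule exE)
    then obtain q where q: "p = [:- z, 1:] * q" by (auto simp: poly_eq_0_iff_dvd dvd_def)
    with Suc.prems(1) have "q \<noteq> 0" by auto
    then have "degree q = d" using Suc.hyps(2) q degree_mult_eq[of "[:- z, 1:]" q] by simp
    have "(a - ?K z) * (\<lambda>x. poly q (a x)) = (\<lambda>x. poly p (a x))"
      unfolding q by (rule ext) (simp add: algebra_simps)
    then have "a - ?K z \<in> I \<or> (\<lambda>x. poly q (a x)) \<in> I"
      using Suc.prems(2) by (intro prime R_diff that(1) K poly_R) simp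
    then show ?case
    proof
      assume "(\<lambda>x. poly q (a x)) \<in> I"
      then show ?thesis using Suc.hyps(1)[OF \<open>degree q = d\<close>[symmetric] \<open>q \<noteq> 0\<close>] by simp
    qed (rule exI)
  qed
  have residue: "\<exists>z. a - ?K z \<in> I" if a: "a \<in> ?R" for a
  proof -
    obtain N c where c: "\<And>i. c i \<in> ?R" "\<And>x. x \<in> X \<Longrightarrow> a x ^ N + (\<Sum>i<N. c i (L x) * a x ^ i) = 0"
      by (rule integral_on_pulled_backE[OF integral[OF a]], rule that)
    have "\<forall>i. \<exists>c'. c' \<in> ?R \<and> (\<forall>x\<in>X. c i (L x) = c' x)"
      using regular_mapD(2)[OF L(1) c(1)] unfolding regular_on_def by blast
    from choice[OF this] obtain c' where c': "\<forall>i. c' i \<in> ?R \<and> (\<forall>x\<in>X. c i (L x) = c' i x)"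
      by (rule exE)
    have c'R: "c' i \<in> ?R" for i using c' by simp
    let ?p = "monom 1 N + (\<Sum>i<N. monom (c i h) i)"
    have "coeff ?p N = 1" by (simp add: coeff_sum)
    then have "?p \<noteq> 0" by (metis coeff_0 zero_neq_one)
    define U where "U = a ^ N + (\<Sum>i<N. c' i * a ^ i)"
    have "(\<lambda>x. poly ?p (a x)) - U = (\<Sum>i<N. (- (a ^ i)) * (c' i - ?K (c i h)))"
    proof
      fix x
      have "poly ?p y = y ^ N + (\<Sum>i<N. c i h * y ^ i)" for y
        by (simp only: poly_add poly_sum poly_monom mult_1_left)
      moreover have "U x = a x ^ N + (\<Sum>i<N. c' i x * a x ^ i)"
        by (simp add: U_def sum_fun_apply power_fun_apply)
      ultimately have "((\<lambda>x. poly ?p (a x)) - U) x =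
          (\<Sum>i<N. c i h * a x ^ i) - (\<Sum>i<N. c' i x * a x ^ i)"
        by (simp only: minus_apply add_diff_cancel_left)
      also have "\<dots> = (\<Sum>i<N. c i h * a x ^ i - c' i x * a x ^ i)"
        by (rule sum_subtractf[symmetric])
      also have "\<dots> = (\<Sum>i<N. - (a x ^ i) * (c' i x - c i h))"
        by (intro sum.cong refl) (simp add: algebra_simps)
      finally show "((\<lambda>x. poly ?p (a x)) - U) x = (\<Sum>i<N. (- (a ^ i)) * (c' i - ?K (c i h))) x"
        by (simp add: sum_fun_apply power_fun_apply)
    qed
    also have "\<dots> \<in> I"
    proof (intro ideal_in_sum[OF I(1)] I'(4) R(3) R_power a)
      show "c' i - ?K (c i h) \<in> I" for i
        by (rule over_const[OF c(1) c'R]) (use c' in simp)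
    qed
    finally have "(\<lambda>x. poly ?p (a x)) - U \<in> I" .
    moreover have "U \<in> I"
    proof (rule I_vanish)
      show "U \<in> ?R" unfolding U_def
        by (intro R(4,5) R_power is_subring_sum[OF regular_functions_subring] a c'R)
      show "U x = 0" if "x \<in> X" for x
        using c(2)[OF that] c' that by (simp add: U_def sum_fun_apply power_fun_apply)
    qed
    ultimately have "(\<lambda>x. poly ?p (a x)) \<in> I" by (rule I_trans)
    with \<open>?p \<noteq> 0\<close> show ?thesis by (rule root[OF a])
  qed
  have "\<forall>ij. \<exists>z. fst ij < n \<longrightarrow> snd ij < n \<longrightarrow> (\<lambda>x. x $$ ij) - ?K z \<in> I"
    using residue[OF regular_functions.entry] by (auto simp: split_paired_all)
  from choice[OF this] obtain \<mu> where
    \<mu>: "\<forall>ij. fst ij < n \<longrightarrow> snd ij < n \<longrightarrow> (\<lambda>x. x $$ ij) - ?K (\<mu> ij) \<in> I" by (rule exE)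
  define x0 where "x0 = mat n n \<mu>"
  have x0: "x0 \<in> carrier_mat n n" by (simp add: x0_def)
  define E where "E = {f \<in> ?R. f - ?K (f x0) \<in> I}"
  have E_const: "?K c \<in> E" for c
    using K[of c] I'(2) by (simp add: E_def)
  have E_entry: "(\<lambda>x. x $$ (i, j)) \<in> E" if "i < n" "j < n" for i j
    using \<mu>[rule_format, of "(i, j)"] that regular_functions.entry[OF that]
    by (simp add: E_def x0_def)
  have E_add: "(\<lambda>x. f x + g x) \<in> E" if "f \<in> E" "g \<in> E" for f g
  proof -
    have "(\<lambda>x. f x + g x) - ?K (f x0 + g x0) = (f - ?K (f x0)) + (g - ?K (g x0))"
      by (rule ext) simp
    then show ?thesis
      using that I'(3) regular_functions.add unfolding E_def by auto
  qed
  have E_mult: "(\<lambda>x. f x * g x) \<in> E" if "f \<in> E" "g \<in> E" for f g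
  proof -
    have "(\<lambda>x. f x * g x) - ?K (f x0 * g x0) = g * (f - ?K (f x0)) + ?K (f x0) * (g - ?K (g x0))"
      by (rule ext) (simp add: algebra_simps)
    also have "\<dots> \<in> I"
      using that K by (intro I'(3,4)) (simp_all add: E_def)
    finally show ?thesis
      using that regular_functions.mult unfolding E_def by auto
  qed
  have E_sum: "(\<lambda>x. \<Sum>i\<in>A. f i x) \<in> E" if "\<And>i. i \<in> A \<Longrightarrow> f i \<in> E" for A and f :: "(nat \<Rightarrow> nat) \<Rightarrow> _"
    using that by (induction A rule: infinite_finite_induct) (use E_const E_add in simp_all)
  have E_prod: "(\<lambda>x. \<Prod>i\<in>A. f i x) \<in> E" if "\<And>i. i \<in> A \<Longrightarrow> f i \<in> E" for A and f :: "nat \<Rightarrow> _"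
    using that by (induction A rule: infinite_finite_induct) (use E_const E_mult in simp_all)
  \<comment> \<open>The Leibniz formula is a regular function of all matrices and agrees with the determinant on
    \<open>n \<times> n\<close> matrices.\<close>
  define D where "D x = (\<Sum>p | p permutes {0..<n}. signof p * (\<Prod>i = 0..<n. x $$ (i, p i)))"
    for x :: "'a mat"
  have D: "D x = det x" if "x \<in> carrier_mat n n" for x
    using det_def'[OF that] by (simp add: D_def)
  have "D \<in> E"
    unfolding D_def
    by (intro E_sum E_mult E_const E_prod E_entry) (auto dest: permutes_in_image)
  obtain \<nu> where \<nu>: "(\<lambda>x. inverse (det x)) - ?K \<nu> \<in> I"
    using residue[OF regular_functions.inv_det] by (rule exE)
  have det_\<nu>: "det x0 * \<nu> = 1"
  proof -
    let ?inv = "(\<lambda>x. inverse (det x)) :: 'a mat \<Rightarrow> 'a"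
    have DR: "D \<in> ?R" "D - ?K (D x0) \<in> I" using \<open>D \<in> E\<close> by (simp_all add: E_def)
    have "D * ?inv - 1 \<in> I"
    proof (rule I_vanish)
      show "D * ?inv - 1 \<in> ?R" by (intro R_diff R(2,5) DR(1) regular_functions.inv_det)
      show "(D * ?inv - 1) x = 0" if "x \<in> X" for x
      proof -
        have "x \<in> carrier_mat n n" "det x \<noteq> 0" using that XG by (auto simp: GL_iff)
        then show ?thesis by (simp add: D)
      qed
    qed
    moreover have "?K (D x0 * \<nu> - 1) =
        (D * ?inv - 1) - (?inv * (D - ?K (D x0)) + ?K (D x0) * (?inv - ?K \<nu>))"
      by (rule ext) (simp add: algebra_simps)
    ultimately have "?K (D x0 * \<nu> - 1) \<in> I"
      using I_diff I'(3,4) DR \<nu> K regular_functions.inv_det[of n] by metis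
    from I_const[OF this] show ?thesis using D[OF x0] by simp
  qed
  then have x0G: "x0 \<in> carrier (GL n)" using x0 by (auto simp: GL_iff)
  have "\<nu> = inverse (det x0)" using det_\<nu> by (metis inverse_unique)
  then have E_inv: "(\<lambda>x. inverse (det x)) \<in> E"
    using \<nu> regular_functions.inv_det by (simp add: E_def)
  have E_all: "f \<in> E" if "f \<in> ?R" for f
    using that by induction (intro E_const E_entry E_inv E_add E_mult; assumption)+
  have eval: "f - ?K (f x0) \<in> I" if "f \<in> ?R" for f
    using E_all[OF that] by (simp add: E_def)
  have x0X: "x0 \<in> X"
  proof (rule closedin_zariskiD[OF X(1) x0G])
    fix f assume f: "f \<in> vanishing_ideal n X"
    then have "f \<in> ?R" "f \<in> I" using I(2) by (auto simp: vanishing_ideal_def)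
    then have "f - (f - ?K (f x0)) \<in> I" by (intro I_diff eval)
    then show "f x0 = 0" using I_const[of "f x0"] by simp
  qed
  have "f (L x0) = f h" if f: "f \<in> ?R" for f
  proof -
    obtain f' where f': "f' \<in> ?R" "\<forall>x\<in>X. f (L x) = f' x"
      using regular_mapD(2)[OF L(1) f] unfolding regular_on_def by blast
    have "f' - ?K (f h) \<in> I" by (rule over_const[OF f f'(1)]) (use f'(2) in simp)
    then have "(f' - ?K (f h)) - (f' - ?K (f' x0)) \<in> I" by (rule I_diff[OF _ eval[OF f'(1)]])
    moreover have "(f' - ?K (f h)) - (f' - ?K (f' x0)) = ?K (f' x0 - f h)" by (rule ext) simp
    ultimately have "f' x0 - f h = 0" using I_const by metis
    then show ?thesis using f'(2) x0X by simp
  qed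
  then have "L x0 $$ (i, j) = h $$ (i, j)" if "i < n" "j < n" for i j
    using regular_functions.entry[OF that] by blast
  moreover have "L x0 \<in> carrier_mat n n" "h \<in> carrier_mat n n"
    using x0X h L(2) XG by (auto simp: GL_iff subset_iff image_subset_iff)
  ultimately have "L x0 = h" by (intro eq_matI) auto
  with x0X show ?thesis by blast
qed

section \<open>The Lang--Steinberg theorem\<close>

lemma nontrivial_linear_relation:
  fixes w :: "'i \<Rightarrow> 't \<Rightarrow> 'a::field"
  assumes "finite T" "finite I" "card T < card I"
  shows "\<exists>c. (\<exists>i\<in>I. c i \<noteq> 0) \<and> (\<forall>t\<in>T. (\<Sum>i\<in>I. c i * w i t) = 0)"
  using assms
proof (induction T arbitrary: I w rule: finite_induct)
  case empty
  then have "I \<noteq> {}" by auto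
  then show ?case by (intro exI[of _ "\<lambda>_. 1"]) auto
next
  case (insert s T)
  have card: "Suc (card T) < card I" using insert by simp
  show ?case
  proof (cases "\<exists>j\<in>I. w j s \<noteq> 0")
    case False
    have "card T < card I" using card by simp
    from insert.IH[OF insert.prems(1) this, of w] obtain c where
      "(\<exists>i\<in>I. c i \<noteq> 0) \<and> (\<forall>t\<in>T. (\<Sum>i\<in>I. c i * w i t) = 0)" by (rule exE)
    moreover have "(\<Sum>i\<in>I. c i * w i s) = 0" using False by (intro sum.neutral) simp
    ultimately show ?thesis by (intro exI[of _ c]) simp
  next
    case True
    then obtain j where j: "j \<in> I" "w j s \<noteq> 0" by (rule bexE)
    let ?I = "I - {j}" and ?w = "\<lambda>i t. w i t - w i s / w j s * w j t"
    have "card T < card ?I" using card j insert.prems(1) by simp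
    from insert.IH[OF finite_Diff[OF insert.prems(1)] this, of ?w] obtain c where
      c: "(\<exists>i\<in>?I. c i \<noteq> 0) \<and> (\<forall>t\<in>T. (\<Sum>i\<in>?I. c i * ?w i t) = 0)" by (rule exE)
    \<comment> \<open>Gaussian elimination: \<open>?w\<close> subtracts a multiple of row \<open>j\<close> to clear column \<open>s\<close>.\<close>
    define d where "d = c(j := - (\<Sum>i\<in>?I. c i * (w i s / w j s)))"
    have eq: "(\<Sum>i\<in>I. d i * w i t) = (\<Sum>i\<in>?I. c i * ?w i t)" for t
    proof -
      have "(\<Sum>i\<in>I. d i * w i t) = d j * w j t + (\<Sum>i\<in>?I. d i * w i t)"
        by (rule sum.remove[OF insert.prems(1) j(1)])
      also have "(\<Sum>i\<in>?I. d i * w i t) = (\<Sum>i\<in>?I. c i * w i t)"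
        by (intro sum.cong) (simp_all add: d_def)
      also have "d j * w j t = - (\<Sum>i\<in>?I. c i * (w i s / w j s * w j t))"
        by (simp add: d_def sum_distrib_right mult.assoc)
      also have "\<dots> + (\<Sum>i\<in>?I. c i * w i t) = (\<Sum>i\<in>?I. c i * ?w i t)"
        by (simp add: right_diff_distrib sum_subtractf)
      finally show ?thesis .
    qed
    have "(\<Sum>i\<in>I. d i * w i t) = 0" if "t \<in> insert s T" for t
    proof (cases "t = s")
      case True
      then show ?thesis unfolding eq using j(2) by simp
    next
      case False
      then show ?thesis unfolding eq using c that by simp
    qed
    moreover have "\<exists>i\<in>I. d i \<noteq> 0"
    proof -
      obtain i where "i \<in> ?I" "c i \<noteq> 0" using conjunct1[OF c] by (rule bexE)
      then show ?thesis by (intro bexI[of _ i]) (simp_all add: d_def)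
    qed
    ultimately show ?thesis by (intro exI[of _ d]) simp
  qed
qed

text \<open>\<open>H\<close> is a closed connected subgroup with an endomorphism \<open>F\<close>, and \<open>R\<close> is a set of regular
functions that spans \<open>K[H]\<close> over \<open>K\<close> and on which \<open>F\<^sup>m\<close> induces the \<open>q\<close>-th power map. These
conditions pass from an algebraic group with a Steinberg endomorphism to each of its closed connected
stable subgroups, by restriction of functions.\<close>

locale lang_steinberg_setting =
  fixes n :: nat and H :: "'a::alg_closed_field mat set" and F :: "'a mat \<Rightarrow> 'a mat"
    and m e :: nat and R :: "('a mat \<Rightarrow> 'a) set"
  assumes subgroup: "subgroup H (GL n)"
    and closed: "closedin (zariski n) H"
    and connected: "connectedin (zariski n) H"
    and F_closed: "\<And>x. x \<in> H \<Longrightarrow> F x \<in> H"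
    and F_mult: "\<And>x y. x \<in> H \<Longrightarrow> y \<in> H \<Longrightarrow> F (x * y) = F x * F y"
    and F_regular: "regular_map n H F"
    and char_pos: "CHAR('a) > 0"
    and e_pos: "e \<ge> 1"
    and R_regular: "\<And>t. t \<in> R \<Longrightarrow> regular_on n H t"
    and R_spans: "\<And>f. f \<in> regular_functions n \<Longrightarrow>
      \<exists>T c. finite T \<and> T \<subseteq> R \<and> (\<forall>x\<in>H. f x = (\<Sum>t\<in>T. c t * t x))"
    and R_frobenius: "\<And>t x. t \<in> R \<Longrightarrow> x \<in> H \<Longrightarrow> t ((F ^^ m) x) = t x ^ (CHAR('a) ^ e)"
begin

definition q :: nat where "q = CHAR('a) ^ e"

definition \<phi> :: "'a mat \<Rightarrow> 'a mat" where "\<phi> = F ^^ m"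

definition L :: "'a mat \<Rightarrow> 'a mat" where "L x = inv\<^bsub>GL n\<^esub> x * F x"

lemma prime_CHAR: "prime CHAR('a)"
  using char_pos prime_CHAR_semidom by blast

lemma q_ge_2: "q \<ge> 2"
proof -
  have "2 \<le> CHAR('a)" using prime_CHAR prime_ge_2_nat by blast
  also have "CHAR('a) ^ 1 \<le> q" unfolding q_def using e_pos char_pos by (intro power_increasing) auto
  finally show ?thesis by simp
qed

lemma q_power: "q ^ k = CHAR('a) ^ (e * k)"
  by (simp add: q_def power_mult)

lemma frobenius_add: "(a + b) ^ q ^ k = a ^ q ^ k + (b :: 'a) ^ q ^ k"
  by (rule freshmans_dream'[OF prime_CHAR q_power])

lemma frobenius_sum: "(\<Sum>i\<in>I. f i) ^ q ^ k = (\<Sum>i\<in>I. (f i :: 'a) ^ q ^ k)"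
  by (rule freshmans_dream_sum'[OF prime_CHAR q_power])

lemma frobenius_inj:
  fixes a b :: 'a
  assumes "a ^ q ^ k = b ^ q ^ k"
  shows "a = b"
proof -
  have "(a - b) ^ q ^ k + b ^ q ^ k = a ^ q ^ k" by (simp flip: frobenius_add)
  with assms have "(a - b) ^ q ^ k = 0" by simp
  then show ?thesis by simp
qed

text \<open>The inverse of the \<open>k\<close>-th power of the Frobenius automorphism of the field.\<close>

definition frobenius_root :: "nat \<Rightarrow> 'a \<Rightarrow> 'a" where
  "frobenius_root k a = (THE b. b ^ q ^ k = a)"

lemma frobenius_root_power: "frobenius_root k a ^ q ^ k = a"
proof -
  have "\<exists>b. b ^ q ^ k = a" using q_ge_2 by (intro nth_root_exists) simp
  then obtain b where b: "b ^ q ^ k = a" by (rule exE)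
  show ?thesis
    unfolding frobenius_root_def by (rule theI[of _ b]) (use b frobenius_inj in auto)
qed

lemma frobenius_root_eqI: "b ^ q ^ k = a \<Longrightarrow> frobenius_root k a = b"
  using frobenius_inj frobenius_root_power by metis

lemma frobenius_root_sum: "frobenius_root k (\<Sum>i\<in>I. f i) = (\<Sum>i\<in>I. frobenius_root k (f i))"
  by (rule frobenius_root_eqI) (simp add: frobenius_sum frobenius_root_power)

lemma frobenius_root_mult: "frobenius_root k (a * b) = frobenius_root k a * frobenius_root k b"
  by (rule frobenius_root_eqI) (simp add: power_mult_distrib frobenius_root_power)

lemma frobenius_root_0: "frobenius_root 0 a = a"
  by (rule frobenius_root_eqI) simp

lemma frobenius_root_Suc_power: "frobenius_root (Suc k) a ^ q = frobenius_root k a"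
proof (rule frobenius_root_eqI[symmetric])
  show "(frobenius_root (Suc k) a ^ q) ^ q ^ k = a"
    using frobenius_root_power[of "Suc k" a] by (simp add: power_mult)
qed

lemma frobenius_root_add_power: "frobenius_root (i + j) a ^ q ^ i = frobenius_root j a"
proof (rule frobenius_root_eqI[symmetric])
  show "(frobenius_root (i + j) a ^ q ^ i) ^ q ^ j = a"
    using frobenius_root_power[of "i + j" a] by (simp add: power_add power_mult)
qed

lemma H_GL: "H \<subseteq> carrier (GL n)"
  using subgroup.subset[OF subgroup] .

lemma H_mult: "x \<in> H \<Longrightarrow> y \<in> H \<Longrightarrow> x * y \<in> H"
  using subgroup.m_closed[OF subgroup] by simp

lemma F_pow_regular: "(F ^^ k) ` H \<subseteq> H \<and> regular_map n H (F ^^ k)"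
  by (rule regular_map_funpow[OF H_GL F_regular]) (use F_closed in blast)

lemma F_pow_closed: "x \<in> H \<Longrightarrow> (F ^^ k) x \<in> H"
  using F_pow_regular[of k] by blast

lemma F_pow_mult: "x \<in> H \<Longrightarrow> y \<in> H \<Longrightarrow> (F ^^ k) (x * y) = (F ^^ k) x * (F ^^ k) y"
  by (induction k) (simp_all add: F_mult F_pow_closed)

lemma \<phi>_pow: "\<phi> ^^ k = F ^^ (m * k)"
  by (simp add: \<phi>_def funpow_mult)

lemma L_regular: "regular_map n H L"
  unfolding L_def
  by (intro regular_map_mult regular_map_inv' regular_map_id H_GL F_regular)

lemma L_closed: "x \<in> H \<Longrightarrow> L x \<in> H"
  unfolding L_def by (intro H_mult F_closed) (rule subgroup.m_inv_closed[OF subgroup])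

text \<open>The product \<open>g F(g) \<dots> F\<^sup>k\<^sup>-\<^sup>1(g)\<close>. For \<open>g = L(x)\<close> it telescopes and expresses \<open>F\<^sup>k(x)\<close>
through \<open>x\<close> and \<open>L(x)\<close>.\<close>

fun F_product :: "nat \<Rightarrow> 'a mat \<Rightarrow> 'a mat" where
  "F_product 0 g = 1\<^sub>m n"
| "F_product (Suc k) g = F_product k g * (F ^^ k) g"

lemma F_product_closed: "g \<in> H \<Longrightarrow> F_product k g \<in> H"
proof (induction k)
  case 0
  then show ?case using subgroup.one_closed[OF subgroup] by simp
qed (simp add: H_mult F_pow_closed)

lemma F_product_regular: "regular_map n H (F_product k)"
proof (induction k)
  case 0
  have "(1\<^sub>m n :: 'a mat) \<in> H" using subgroup.one_closed[OF subgroup] by simp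
  from regular_map_const[OF subsetD[OF H_GL this], of H] show ?case
    by (subst regular_map_cong[of H _ "\<lambda>_. 1\<^sub>m n"]) simp_all
next
  case (Suc k)
  from regular_map_mult[OF Suc conjunct2[OF F_pow_regular]] show ?case by simp
qed

lemma F_product_telescopes:
  assumes x: "x \<in> H"
  shows "x * F_product k (L x) = (F ^^ k) x"
proof (induction k)
  case 0
  have "x \<in> carrier_mat n n" using x H_GL by (auto simp: GL_iff)
  then show ?case by simp
next
  case (Suc k)
  interpret G: group "GL n :: 'a mat monoid" by (rule group_GL)
  have [simp]: "y \<in> carrier (GL n)" if "y \<in> H" for y using that H_GL by blast
  note xL = x L_closed[OF x]
  have "x * F_product (Suc k) (L x) = (x * F_product k (L x)) * (F ^^ k) (L x)"
    using G.m_assoc[of x "F_product k (L x)" "(F ^^ k) (L x)"] xL F_product_closed F_pow_closed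
    by simp
  also have "\<dots> = (F ^^ k) (x * L x)"
    using F_pow_mult[OF xL] Suc by simp
  also have "x * L x = F x"
    unfolding L_def
    using G.m_assoc[of x "inv\<^bsub>GL n\<^esub> x" "F x"] G.r_inv[of x] G.l_one[of "F x"] x F_closed[OF x] by simp
  also have "(F ^^ k) (F x) = (F ^^ Suc k) x" by (simp add: funpow_swap1)
  finally show ?case .
qed

text \<open>If \<open>f\<close> is a combination of members of \<open>R\<close>, then the twist is the combination of the same functions
with the roots of the coefficients (\<open>twist_combination\<close>); so it is again regular, and all twists of
\<open>f\<close> lie in one finite-dimensional space. On the other hand, \<open>u \<mapsto> twist k u\<close> respects
the formula for \<open>u (x * g)\<close>, as \<open>\<phi>\<close> is a homomorphism and taking roots is additive and
multiplicative.\<close>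

definition twist :: "nat \<Rightarrow> ('a mat \<Rightarrow> 'a) \<Rightarrow> 'a mat \<Rightarrow> 'a" where
  "twist k f x = frobenius_root k (f ((\<phi> ^^ k) x))"

lemma R_\<phi>_pow:
  assumes "t \<in> R" "x \<in> H"
  shows "t ((\<phi> ^^ k) x) = t x ^ q ^ k"
  using assms(2)
proof (induction k arbitrary: x)
  case (Suc k)
  have "\<phi> x \<in> H" using F_pow_closed[OF Suc.prems] by (simp add: \<phi>_def)
  from Suc.IH[OF this] have "t ((\<phi> ^^ Suc k) x) = t (\<phi> x) ^ q ^ k"
    by (simp add: funpow_swap1)
  also have "t (\<phi> x) = t x ^ q"
    unfolding \<phi>_def q_def by (rule R_frobenius[OF assms(1) Suc.prems])
  finally show ?case by (simp add: power_mult[symmetric])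
qed simp

lemma twist_combination:
  assumes T: "T \<subseteq> R" and f: "\<And>x. x \<in> H \<Longrightarrow> f x = (\<Sum>t\<in>T. c t * t x)" and x: "x \<in> H"
  shows "twist k f x = (\<Sum>t\<in>T. frobenius_root k (c t) * t x)"
proof -
  have "(\<phi> ^^ k) x \<in> H" unfolding \<phi>_pow by (rule F_pow_closed[OF x])
  then have "twist k f x = (\<Sum>t\<in>T. frobenius_root k (c t) * frobenius_root k (t ((\<phi> ^^ k) x)))"
    unfolding twist_def f[OF \<open>(\<phi> ^^ k) x \<in> H\<close>] by (simp add: frobenius_root_sum frobenius_root_mult)
  also have "\<dots> = (\<Sum>t\<in>T. frobenius_root k (c t) * t x)"
  proof (intro sum.cong refl arg_cong[where f = "\<lambda>y. _ * y"] frobenius_root_eqI)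
    fix t assume "t \<in> T"
    then show "t x ^ q ^ k = t ((\<phi> ^^ k) x)" using R_\<phi>_pow[OF _ x, of t k] T by auto
  qed
  finally show ?thesis .
qed

lemma twist_regular:
  assumes "f \<in> regular_functions n"
  shows "regular_on n H (twist k f)"
proof -
  obtain T c where T: "finite T" "T \<subseteq> R" "\<forall>x\<in>H. f x = (\<Sum>t\<in>T. c t * t x)"
    using R_spans[OF assms] by (elim exE conjE)
  have "regular_on n H (\<lambda>x. \<Sum>t\<in>T. frobenius_root k (c t) * t x)"
    using T(2) by (intro regular_on_sum regular_on_mult regular_on_const R_regular) auto
  moreover have "twist k f x = (\<Sum>t\<in>T. frobenius_root k (c t) * t x)" if "x \<in> H" for x
    by (rule twist_combination[OF T(2) _ that]) (use T(3) in simp)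
  ultimately show ?thesis by (subst regular_on_cong) simp_all
qed

text \<open>The coefficient vectors of sufficiently many successive twists are linearly dependent. Raising the
coefficients of a relation to the power \<open>q ^ i\<close>, where \<open>i\<close> is the first index that occurs in it,
shifts the relation so that it starts with \<open>f\<close> itself; it then expresses \<open>f\<close> by its twists of
positive order.\<close>

lemma in_span_of_twists:
  assumes f: "f \<in> regular_functions n" and B: "is_subring B" "\<And>c. (\<lambda>_. c) \<in> B"
  shows "\<exists>N. f \<in> span_on H B ((\<lambda>k. twist k f) ` {1..N})"
proof -
  obtain T c where T: "finite T" "T \<subseteq> R" "\<forall>x\<in>H. f x = (\<Sum>t\<in>T. c t * t x)"
    using R_spans[OF f] by (elim exE conjE)
  let ?N = "card T"
  have "\<exists>d. (\<exists>i\<in>{..?N}. d i \<noteq> 0) \<and> (\<forall>t\<in>T. (\<Sum>i\<in>{..?N}. d i * frobenius_root i (c t)) = 0)"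
    by (rule nontrivial_linear_relation[OF T(1)]) simp_all
  then obtain d where d: "\<exists>i\<in>{..?N}. d i \<noteq> 0" "\<forall>t\<in>T. (\<Sum>i\<in>{..?N}. d i * frobenius_root i (c t)) = 0"
    by (elim exE conjE)
  define i where "i = (LEAST i. d i \<noteq> 0)"
  have ex: "\<exists>i. d i \<noteq> 0" using d(1) by auto
  have di: "d i \<noteq> 0" unfolding i_def by (rule LeastI_ex[OF ex])
  have below: "d j = 0" if "j < i" for j
    using not_less_Least[of j "\<lambda>i. d i \<noteq> 0"] that unfolding i_def by simp
  have iN: "i \<le> ?N"
  proof -
    obtain j where "j \<le> ?N" "d j \<noteq> 0" using d(1) by auto
    then show ?thesis using below[of j] by (cases "j < i") simp_all
  qed
  define \<nu> where "\<nu> j = (- d (i + j) / d i) ^ q ^ i" for j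
  have rel: "c t = (\<Sum>j\<in>{1..?N - i}. \<nu> j * frobenius_root j (c t))" if t: "t \<in> T" for t
  proof -
    have "{..?N} = {..<i} \<union> {i} \<union> {Suc i..?N}" using iN by auto
    then have "0 = (\<Sum>j\<in>{..<i} \<union> {i} \<union> {Suc i..?N}. d j * frobenius_root j (c t))" using d(2) t by simp
    also have "\<dots> = (\<Sum>j\<in>{..<i}. d j * frobenius_root j (c t)) + d i * frobenius_root i (c t)
        + (\<Sum>j\<in>{Suc i..?N}. d j * frobenius_root j (c t))"
      by (subst sum.union_disjoint; (subst sum.union_disjoint)?) auto
    also have "(\<Sum>j\<in>{..<i}. d j * frobenius_root j (c t)) = 0" using below by (intro sum.neutral) simp
    also have "(\<Sum>j\<in>{Suc i..?N}. d j * frobenius_root j (c t)) =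
        (\<Sum>j\<in>{1..?N - i}. d (i + j) * frobenius_root (i + j) (c t))"
      using sum.shift_bounds_cl_nat_ivl[of "\<lambda>j. d j * frobenius_root j (c t)" 1 i "?N - i"] iN
      by (simp add: add.commute)
    finally have "frobenius_root i (c t) = - (\<Sum>j\<in>{1..?N - i}. d (i + j) * frobenius_root (i + j) (c t)) / d i"
      using di by (simp add: field_simps eq_neg_iff_add_eq_0)
    also have "\<dots> = (\<Sum>j\<in>{1..?N - i}. - d (i + j) / d i * frobenius_root (i + j) (c t))"
      by (simp add: sum_divide_distrib sum_negf[symmetric])
    finally have "frobenius_root i (c t) ^ q ^ i = (\<Sum>j\<in>{1..?N - i}. (- d (i + j) / d i * frobenius_root (i + j) (c t)) ^ q ^ i)"
      by (simp only: frobenius_sum)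
    then show ?thesis by (simp only: frobenius_root_power power_mult_distrib frobenius_root_add_power \<nu>_def)
  qed
  have eq: "f x = (\<Sum>j\<in>{1..?N - i}. \<nu> j * twist j f x)" if x: "x \<in> H" for x
  proof -
    have "f x = (\<Sum>t\<in>T. (\<Sum>j\<in>{1..?N - i}. \<nu> j * frobenius_root j (c t)) * t x)"
      using T(3) x rel by simp
    also have "\<dots> = (\<Sum>t\<in>T. \<Sum>j\<in>{1..?N - i}. \<nu> j * (frobenius_root j (c t) * t x))"
      by (simp add: sum_distrib_right mult.assoc)
    also have "\<dots> = (\<Sum>j\<in>{1..?N - i}. \<Sum>t\<in>T. \<nu> j * (frobenius_root j (c t) * t x))"
      by (rule sum.swap)
    also have "\<dots> = (\<Sum>j\<in>{1..?N - i}. \<nu> j * twist j f x)"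
    proof (intro sum.cong refl)
      fix j
      have "twist j f x = (\<Sum>t\<in>T. frobenius_root j (c t) * t x)"
        by (rule twist_combination[OF T(2) _ x]) (use T(3) in simp)
      then show "(\<Sum>t\<in>T. \<nu> j * (frobenius_root j (c t) * t x)) = \<nu> j * twist j f x"
        by (simp add: sum_distrib_left)
    qed
    finally show ?thesis .
  qed
  have "(\<lambda>x. \<Sum>j\<in>{1..?N - i}. \<nu> j * twist j f x) \<in>
      span_on H B ((\<lambda>k. twist k f) ` {1..?N - i})"
    by (intro span_on_sum span_on_scale[OF B] span_on_base[OF B(1)] imageI)
  then have "f \<in> span_on H B ((\<lambda>k. twist k f) ` {1..?N - i})"
    by (rule span_on_cong) (simp add: eq)
  then show ?thesis by (rule exI)
qed

definition coordinates :: "('a mat \<Rightarrow> 'a) set" where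
  "coordinates = insert (\<lambda>x. inverse (det x)) ((\<lambda>ij x. x $$ ij) ` ({..<n} \<times> {..<n}))"

lemma finite_coordinates: "finite coordinates"
  by (simp add: coordinates_def)

lemma coordinates_regular: "u \<in> coordinates \<Longrightarrow> u \<in> regular_functions n"
  unfolding coordinates_def by (auto intro: regular_functions.entry regular_functions.inv_det)

text \<open>The coordinates span a space stable under right translations, with coefficients that are regular
in the translating element.\<close>

lemma coordinates_comultiplication:
  assumes "u \<in> coordinates"
  shows "\<exists>K b a. (\<forall>k<(K::nat). b k \<in> coordinates \<and> a k \<in> regular_functions n) \<and>
    (\<forall>x\<in>carrier (GL n). \<forall>g\<in>carrier (GL n). u (x * g) = (\<Sum>k<K. b k x * a k g))"
proof -
  have "(\<exists>i j. i < n \<and> j < n \<and> u = (\<lambda>x. x $$ (i, j))) \<or> u = (\<lambda>x. inverse (det x))"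
    using assms unfolding coordinates_def by auto
  then show ?thesis
  proof (elim disjE exE conjE)
    fix i j assume ij: "i < n" "j < n" "u = (\<lambda>x. x $$ (i, j))"
    have "u (x * g) = (\<Sum>k<n. x $$ (i, k) * g $$ (k, j))"
      if "x \<in> carrier (GL n)" "g \<in> carrier (GL n)" for x g
      using that ij by (auto simp: GL_iff scalar_prod_def lessThan_atLeast0)
    moreover have "(\<lambda>x :: 'a mat. x $$ (i, k)) \<in> coordinates" "(\<lambda>x :: 'a mat. x $$ (k, j)) \<in> regular_functions n"
      if "k < n" for k
      using that ij by (auto simp: coordinates_def intro: regular_functions.entry)
    ultimately have "(\<forall>k<n. (\<lambda>x :: 'a mat. x $$ (i, k)) \<in> coordinates \<and> (\<lambda>x :: 'a mat. x $$ (k, j)) \<in> regular_functions n) \<and>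
      (\<forall>x\<in>carrier (GL n). \<forall>g\<in>carrier (GL n). u (x * g) = (\<Sum>k<n. x $$ (i, k) * g $$ (k, j)))"
      by simp
    then show ?thesis
      by - (rule exI[of _ n], rule exI[of _ "\<lambda>k x :: 'a mat. x $$ (i, k)"],
        rule exI[of _ "\<lambda>k x :: 'a mat. x $$ (k, j)"])
  next
    assume u: "u = (\<lambda>x. inverse (det x))"
    have "u (x * g) = u x * u g" if "x \<in> carrier (GL n)" "g \<in> carrier (GL n)" for x g
      using that det_mult[of x n g] by (auto simp: GL_iff u)
    with assms coordinates_regular[OF assms] show ?thesis
      by (intro exI[of _ 1] exI[of _ "\<lambda>_. u"]) simp
  qed
qed

lemma twist_Suc_power: "twist (Suc k) f x ^ q = twist k f (\<phi> x)"
  by (simp add: twist_def frobenius_root_Suc_power funpow_swap1)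

lemma twist_0: "twist 0 f = f"
  by (rule ext) (simp add: twist_def frobenius_root_0)

text \<open>Let \<open>V\<close> consist of the twists \<open>twist k u\<close> of the coordinates \<open>u\<close> with \<open>1 \<le> k \<le> M\<close>. Then
\<open>twist k u x ^ q = twist (k - 1) u (\<phi> x)\<close>, and \<open>\<phi> x = x * P (L x)\<close> turns the right-hand side
into a combination of the functions \<open>twist (k - 1) u'\<close> at \<open>x\<close> with coefficients depending on \<open>L x\<close>
only. For \<open>k = 1\<close> the functions \<open>twist 0 u' = u'\<close> appear, which are combinations of members
of \<open>V\<close> by the choice of \<open>M\<close>.\<close>

theorem integral_over_L:
  assumes "a \<in> regular_functions n"
  shows "integral_on H (pulled_back n H L) a"
proof -
  let ?B = "pulled_back n H L"
  note B = pulled_back_subring[of n H L] pulled_back_constant[of _ n H L]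
  have "\<forall>u\<in>coordinates. \<exists>N. u \<in> span_on H ?B ((\<lambda>k. twist k u) ` {1..N})"
    by (intro ballI in_span_of_twists B coordinates_regular)
  from bchoice[OF this] obtain N where
    N: "\<forall>u\<in>coordinates. u \<in> span_on H ?B ((\<lambda>k. twist k u) ` {1..N u})" by (rule exE)
  define M where "M = Max (N ` coordinates)"
  have NM: "N u \<le> M" if "u \<in> coordinates" for u
    unfolding M_def using that finite_coordinates by (intro Max_ge) auto
  define V where "V = (\<lambda>(k, u). twist k u) ` ({1..M} \<times> coordinates)"
  have V_I: "twist k u \<in> V" if "1 \<le> k" "k \<le> M" "u \<in> coordinates" for k u
    unfolding V_def using that by (intro image_eqI[of _ _ "(k, u)"]) auto
  have U_V: "u \<in> span_on H ?B V" if u: "u \<in> coordinates" for u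
  proof (rule span_on_mono)
    show "u \<in> span_on H ?B ((\<lambda>k. twist k u) ` {1..N u})" using N u by simp
    show "(\<lambda>k. twist k u) ` {1..N u} \<subseteq> V" using V_I[OF _ _ u] NM[OF u] by auto
  qed
  have twist_V: "twist k u \<in> span_on H ?B V" if "k \<le> M" "u \<in> coordinates" for k u
  proof (cases k)
    case 0
    then show ?thesis using U_V[OF that(2)] by (simp add: twist_0)
  next
    case (Suc l)
    then show ?thesis using V_I[of k u] that by (intro span_on_base[OF B(1)]) simp
  qed
  have pow: "(\<lambda>x. v x ^ q) \<in> span_on H ?B V" if v: "v \<in> V" for v
  proof -
    obtain k u where ku: "1 \<le> k" "k \<le> M" "u \<in> coordinates" "v = twist k u"
      using v unfolding V_def by auto
    obtain l where l: "k = Suc l" using ku(1) by (cases k) auto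
    obtain K b a where ba: "\<forall>j<(K::nat). b j \<in> coordinates \<and> a j \<in> regular_functions n"
      "\<forall>x\<in>carrier (GL n). \<forall>g\<in>carrier (GL n). u (x * g) = (\<Sum>j<K. b j x * a j g)"
      using coordinates_comultiplication[OF ku(3)] by (elim exE conjE)
    let ?P = "F_product m"
    have eq: "v x ^ q = (\<Sum>j<K. twist l (a j) (?P (L x)) * twist l (b j) x)" if x: "x \<in> H" for x
    proof -
      note P = F_product_closed[OF L_closed[OF x], of m]
      have Hl: "(\<phi> ^^ l) x \<in> carrier (GL n)" "(\<phi> ^^ l) (?P (L x)) \<in> carrier (GL n)"
        using F_pow_closed[OF x] F_pow_closed[OF P] H_GL by (auto simp: \<phi>_pow)
      have "v x ^ q = twist l u (\<phi> x)" unfolding ku(4) l by (rule twist_Suc_power)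
      also have "\<phi> x = x * ?P (L x)" unfolding \<phi>_def by (rule F_product_telescopes[OF x, symmetric])
      also have "twist l u (x * ?P (L x)) = frobenius_root l (u ((\<phi> ^^ l) x * (\<phi> ^^ l) (?P (L x))))"
        unfolding twist_def \<phi>_pow by (simp only: F_pow_mult[OF x P])
      also have "\<dots> = frobenius_root l (\<Sum>j<K. b j ((\<phi> ^^ l) x) * a j ((\<phi> ^^ l) (?P (L x))))"
        using ba(2) Hl by simp
      also have "\<dots> = (\<Sum>j<K. twist l (a j) (?P (L x)) * twist l (b j) x)"
        by (simp only: frobenius_root_sum frobenius_root_mult twist_def mult.commute)
      finally show ?thesis .
    qed
    have "(\<lambda>x. \<Sum>j<K. twist l (a j) (?P (L x)) * twist l (b j) x) \<in> span_on H ?B V"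
    proof (intro span_on_sum span_on_scale[OF B(1)])
      fix j assume j: "j \<in> {..<K}"
      have "?P ` H \<subseteq> H" using F_product_closed by blast
      then have "regular_on n H (\<lambda>g. twist l (a j) (?P g))"
        using ba(1) j by (intro regular_on_compose[OF F_product_regular _ twist_regular]) auto
      then obtain p where "p \<in> regular_functions n" "\<forall>g\<in>H. twist l (a j) (?P g) = p g"
        unfolding regular_on_def by (rule bexE)
      then show "(\<lambda>x. twist l (a j) (?P (L x))) \<in> ?B"
        unfolding pulled_back_def using L_closed by (intro CollectI bexI[of _ p]) auto
      show "(\<lambda>x. twist l (b j) x) \<in> span_on H ?B V"
        using twist_V[of l "b j"] ba(1) j ku(2) l by simp
    qed
    then show ?thesis by (rule span_on_cong) (simp add: eq)
  qed
  show ?thesis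
  proof (rule integral_on_generated[OF B _ q_ge_2 pow _ _ assms])
    show "finite V" unfolding V_def using finite_coordinates by simp
    show "(\<lambda>x. x $$ (i, j)) \<in> span_on H ?B V" if "i < n" "j < n" for i j
      by (rule U_V) (use that in \<open>auto simp: coordinates_def\<close>)
    show "(\<lambda>x. inverse (det x)) \<in> span_on H ?B V"
      by (rule U_V) (simp add: coordinates_def)
  qed
qed

theorem lang_steinberg:
  assumes "h \<in> H"
  shows "\<exists>x\<in>H. inv\<^bsub>GL n\<^esub> x * F x = h"
proof -
  have "L ` H \<subseteq> H" using L_closed by blast
  from integral_map_surjective[OF closed connected_group_irreducible[OF subgroup closed connected]
      L_regular this integral_over_L assms]
  show ?thesis unfolding L_def .
qed

end

section \<open>Classes of conjugates consisting of fixed points\<close>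

lemma bij_betw_from_equal_fibres:
  assumes "\<And>s t. s \<in> S \<Longrightarrow> t \<in> S \<Longrightarrow> f s = f t \<longleftrightarrow> g s = g t"
  shows "\<exists>\<Phi>. bij_betw \<Phi> (f ` S) (g ` S) \<and> (\<forall>s\<in>S. \<Phi> (f s) = g s)"
proof -
  define \<Phi> where "\<Phi> y = g (SOME s. s \<in> S \<and> f s = y)" for y
  have \<Phi>: "\<Phi> (f s) = g s" if "s \<in> S" for s
  proof -
    have some: "(SOME t. t \<in> S \<and> f t = f s) \<in> S \<and> f (SOME t. t \<in> S \<and> f t = f s) = f s"
      by (rule someI[of _ s]) (simp add: that)
    show ?thesis
      unfolding \<Phi>_def by (rule iffD1[OF assms[OF conjunct1[OF some] that] conjunct2[OF some]])
  qed
  have "inj_on \<Phi> (f ` S)"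
    by (rule inj_onI) (use \<Phi> assms in auto)
  moreover have "\<Phi> ` f ` S = g ` S"
    unfolding image_image using \<Phi> by (intro image_cong) simp_all
  ultimately show ?thesis
    using \<Phi> by (intro exI[of _ \<Phi>]) (simp add: bij_betw_def)
qed

context group
begin

lemma cancel_left [simp]:
  assumes "x \<in> carrier G" "y \<in> carrier G"
  shows "x \<otimes> (inv x \<otimes> y) = y" "inv x \<otimes> (x \<otimes> y) = y"
  using assms by (simp_all flip: m_assoc)

lemma conj_by_image:
  assumes "g \<in> carrier G" "A \<subseteq> carrier G"
  shows "conj_by G g A = (\<lambda>a. g \<otimes> a \<otimes> inv g) ` A"
  unfolding conj_by_def l_coset_def r_coset_def by auto

lemma conj_by_closed: "g \<in> carrier G \<Longrightarrow> A \<subseteq> carrier G \<Longrightarrow> conj_by G g A \<subseteq> carrier G"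
  by (auto simp: conj_by_image)

lemma conj_by_mult:
  assumes "g \<in> carrier G" "h \<in> carrier G" "A \<subseteq> carrier G"
  shows "conj_by G (g \<otimes> h) A = conj_by G g (conj_by G h A)"
proof -
  have "conj_by G (g \<otimes> h) A = (\<lambda>a. g \<otimes> (h \<otimes> a \<otimes> inv h) \<otimes> inv g) ` A"
    using assms by (subst conj_by_image) (auto simp: m_assoc inv_mult_group subset_iff intro!: image_cong)
  then show ?thesis
    using assms conj_by_closed[OF assms(2,3)] by (simp add: conj_by_image image_image)
qed

lemma conj_by_one:
  assumes "A \<subseteq> carrier G"
  shows "conj_by G \<one> A = A"
proof -
  have "(\<lambda>a. \<one> \<otimes> a \<otimes> inv \<one>) ` A = (\<lambda>a. a) ` A"
    using assms by (intro image_cong) auto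
  then show ?thesis using assms by (simp add: conj_by_image)
qed

lemma conj_by_inv_cancel:
  assumes "g \<in> carrier G" "A \<subseteq> carrier G"
  shows "conj_by G (inv g) (conj_by G g A) = A"
  using assms conj_by_mult[of "inv g" g A] conj_by_one by simp

lemma subgroup_conj_by:
  assumes "subgroup H G" "g \<in> carrier G"
  shows "subgroup (conj_by G g H) G"
proof -
  note H = subgroup.subset[OF assms(1)]
  have eq: "conj_by G g H = (\<lambda>x. g \<otimes> x \<otimes> inv g) ` H" by (rule conj_by_image[OF assms(2) H])
  show ?thesis
  proof (rule subgroupI)
    show "conj_by G g H \<subseteq> carrier G" by (rule conj_by_closed[OF assms(2) H])
    show "conj_by G g H \<noteq> {}" unfolding eq using subgroup.one_closed[OF assms(1)] by blast
    fix a assume "a \<in> conj_by G g H"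
    then obtain x where x: "x \<in> H" "a = g \<otimes> x \<otimes> inv g" unfolding eq by (rule imageE)
    have xG: "x \<in> carrier G" using x(1) H by auto
    have "inv a = g \<otimes> inv x \<otimes> inv g" using x(2) xG assms(2) by (simp add: inv_mult_group m_assoc)
    then show "inv a \<in> conj_by G g H"
      unfolding eq by (rule image_eqI) (rule subgroup.m_inv_closed[OF assms(1) x(1)])
    fix b assume "b \<in> conj_by G g H"
    then obtain y where y: "y \<in> H" "b = g \<otimes> y \<otimes> inv g" unfolding eq by (rule imageE)
    have yG: "y \<in> carrier G" using y(1) H by auto
    have "a \<otimes> b = g \<otimes> (x \<otimes> y) \<otimes> inv g" using x(2) y(2) xG yG assms(2) by (simp add: m_assoc)
    then show "a \<otimes> b \<in> conj_by G g H"
      unfolding eq by (rule image_eqI) (rule subgroup.m_closed[OF assms(1) x(1) y(1)])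
  qed
qed

lemma mem_normalizer_iff:
  assumes "B \<subseteq> carrier G"
  shows "g \<in> normalizer G B \<longleftrightarrow> g \<in> carrier G \<and> conj_by G g B = B"
  using assms by (simp add: normalizer_def stabilizer_def conj_by_def)

lemma normalizer_mult_closed:
  assumes "B \<subseteq> carrier G" "g \<in> normalizer G B" "h \<in> normalizer G B"
  shows "g \<otimes> h \<in> normalizer G B"
  using assms conj_by_mult by (simp add: mem_normalizer_iff)

lemma normalizer_inv_closed:
  assumes "B \<subseteq> carrier G" "g \<in> normalizer G B"
  shows "inv g \<in> normalizer G B"
  using assms conj_by_inv_cancel[of g B] by (simp add: mem_normalizer_iff)

lemma normalizer_one_closed: "B \<subseteq> carrier G \<Longrightarrow> \<one> \<in> normalizer G B"
  by (simp add: mem_normalizer_iff conj_by_one)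

lemma centralizerD:
  "g \<in> centralizer G B \<Longrightarrow> g \<in> carrier G"
  "g \<in> centralizer G B \<Longrightarrow> b \<in> B \<Longrightarrow> g \<otimes> b = b \<otimes> g"
  by (auto simp: centralizer_def)

lemma mem_centralizer_iff:
  assumes "B \<subseteq> carrier G"
  shows "g \<in> centralizer G B \<longleftrightarrow> g \<in> carrier G \<and> (\<forall>b\<in>B. g \<otimes> b \<otimes> inv g = b)"
proof -
  have "g \<otimes> b = b \<otimes> g \<longleftrightarrow> g \<otimes> b \<otimes> inv g = b" if "g \<in> carrier G" "b \<in> B" for b
    using that assms inv_solve_right'[of b "g \<otimes> b" g] by (auto simp: subset_iff)
  then show ?thesis unfolding centralizer_def by auto
qed

lemma subgroup_centralizer:
  assumes "B \<subseteq> carrier G"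
  shows "subgroup (centralizer G B) G"
proof (rule subgroupI)
  have B: "b \<in> carrier G" if "b \<in> B" for b using that assms by auto
  show "centralizer G B \<subseteq> carrier G" by (auto simp: centralizer_def)
  have "\<one> \<in> centralizer G B" using B by (simp add: centralizer_def)
  then show "centralizer G B \<noteq> {}" by auto
  fix g assume g: "g \<in> centralizer G B"
  note gG = centralizerD(1)[OF g]
  have "inv g \<otimes> b \<otimes> inv (inv g) = b" if "b \<in> B" for b
  proof -
    have "inv g \<otimes> (b \<otimes> g) = b"
      unfolding centralizerD(2)[OF g that, symmetric] using gG B[OF that] by simp
    then show ?thesis using gG B[OF that] by (simp add: m_assoc)
  qed
  then show "inv g \<in> centralizer G B" using gG by (simp add: mem_centralizer_iff[OF assms])
  fix h assume h: "h \<in> centralizer G B"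
  note hG = centralizerD(1)[OF h]
  have "g \<otimes> h \<otimes> b = b \<otimes> (g \<otimes> h)" if "b \<in> B" for b
  proof -
    have "g \<otimes> h \<otimes> b = g \<otimes> (b \<otimes> h)"
      using centralizerD(2)[OF h that] gG hG B[OF that] by (simp add: m_assoc)
    also have "\<dots> = (b \<otimes> g) \<otimes> h"
      using centralizerD(2)[OF g that] gG hG B[OF that] by (simp flip: m_assoc)
    finally show ?thesis using gG hG B[OF that] by (simp add: m_assoc)
  qed
  then show "g \<otimes> h \<in> centralizer G B" using gG hG by (simp add: centralizer_def)
qed

lemma centralizer_subset_normalizer:
  assumes "B \<subseteq> carrier G"
  shows "centralizer G B \<subseteq> normalizer G B"
proof
  fix g assume "g \<in> centralizer G B"
  then have g: "g \<in> carrier G" "\<forall>b\<in>B. g \<otimes> b \<otimes> inv g = b" by (simp_all add: mem_centralizer_iff[OF assms])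
  then have "(\<lambda>b. g \<otimes> b \<otimes> inv g) ` B = (\<lambda>b. b) ` B" by (intro image_cong) simp_all
  then show "g \<in> normalizer G B"
    using g(1) assms by (simp add: mem_normalizer_iff conj_by_image)
qed

lemma centralizer_conj:
  assumes "B \<subseteq> carrier G" "g \<in> carrier G" "c \<in> centralizer G B"
  shows "g \<otimes> c \<otimes> inv g \<in> centralizer G (conj_by G g B)"
proof -
  note c = centralizerD[OF assms(3)]
  have "(g \<otimes> c \<otimes> inv g) \<otimes> (g \<otimes> b \<otimes> inv g) = (g \<otimes> b \<otimes> inv g) \<otimes> (g \<otimes> c \<otimes> inv g)" if "b \<in> B" for b
  proof -
    have b: "b \<in> carrier G" using that assms(1) by auto
    have "(g \<otimes> c \<otimes> inv g) \<otimes> (g \<otimes> b \<otimes> inv g) = g \<otimes> (c \<otimes> b) \<otimes> inv g"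
      using assms(2) c(1) b by (simp add: m_assoc)
    also have "\<dots> = g \<otimes> (b \<otimes> c) \<otimes> inv g" using c(2)[OF that] by simp
    also have "\<dots> = (g \<otimes> b \<otimes> inv g) \<otimes> (g \<otimes> c \<otimes> inv g)"
      using assms(2) c(1) b by (simp add: m_assoc)
    finally show ?thesis .
  qed
  then show ?thesis
    using assms(1,2) c(1) by (auto simp: centralizer_def conj_by_image)
qed

end

text \<open>The part of the argument that belongs to abstract groups: \<open>Q\<close> plays the role of the identity
component of the centralizer of \<open>B\<close>, and the surjectivity of the Lang map is assumed for the whole
group and for those conjugates of \<open>Q\<close> that centralize a conjugate of \<open>B\<close> consisting of fixed points.\<close>

locale lang_conjugacy = group G for G (structure) +
  fixes F and B Q
  assumes F_hom: "F \<in> hom G G"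
    and B_closed: "B \<subseteq> carrier G"
    and B_fixed: "B \<subseteq> fixed_points G F"
    and Q_subgroup: "subgroup Q G"
    and Q_centralizes: "Q \<subseteq> centralizer G B"
    and Q_normal: "\<And>g x. g \<in> normalizer G B \<Longrightarrow> x \<in> Q \<Longrightarrow> g \<otimes> x \<otimes> inv g \<in> Q"
    and lang: "\<And>h. h \<in> carrier G \<Longrightarrow> \<exists>x\<in>carrier G. inv x \<otimes> F x = h"
    and lang_Q: "\<And>g h. g \<in> carrier G \<Longrightarrow> conj_by G g B \<subseteq> fixed_points G F \<Longrightarrow> h \<in> conj_by G g Q \<Longrightarrow>
      \<exists>x\<in>conj_by G g Q. inv x \<otimes> F x = h"
begin

abbreviation "N \<equiv> normalizer G B"
abbreviation "C \<equiv> centralizer G B"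
abbreviation "GF \<equiv> fixed_points G F"

definition lang_map where "lang_map g = inv g \<otimes> F g"

lemma F_closed [simp]: "x \<in> carrier G \<Longrightarrow> F x \<in> carrier G"
  using F_hom by (auto simp: hom_def)

lemma F_mult [simp]: "x \<in> carrier G \<Longrightarrow> y \<in> carrier G \<Longrightarrow> F (x \<otimes> y) = F x \<otimes> F y"
  using F_hom by (auto simp: hom_def)

lemma F_one [simp]: "F \<one> = \<one>"
  using group_hom.hom_one[of G G F] F_hom is_group by (simp add: group_hom_def group_hom_axioms_def)

lemma F_inv [simp]: "x \<in> carrier G \<Longrightarrow> F (inv x) = inv (F x)"
  using group_hom.hom_inv[of G G F x] F_hom is_group by (simp add: group_hom_def group_hom_axioms_def)

lemma lang_map_closed [simp]: "g \<in> carrier G \<Longrightarrow> lang_map g \<in> carrier G"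
  by (simp add: lang_map_def)

lemma N_closed: "g \<in> N \<Longrightarrow> g \<in> carrier G"
  by (simp add: mem_normalizer_iff[OF B_closed])

lemma C_subgroup: "subgroup C G"
  by (rule subgroup_centralizer[OF B_closed])

lemma C_N: "g \<in> C \<Longrightarrow> g \<in> N"
  using centralizer_subset_normalizer[OF B_closed] by (rule subsetD)

lemma Q_closed: "x \<in> Q \<Longrightarrow> x \<in> carrier G"
  using subgroup.subset[OF Q_subgroup] by (rule subsetD)

lemma l_coset_absorb:
  assumes "a \<in> carrier G" "x \<in> Q"
  shows "(a \<otimes> x) <# Q = a <# Q"
proof -
  have "x <# Q = Q" using coset_join3[OF Q_closed[OF assms(2)] Q_subgroup assms(2)] .
  then show ?thesis
    using lcos_m_assoc[OF subgroup.subset[OF Q_subgroup] assms(1) Q_closed[OF assms(2)]] by simp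
qed

lemma l_coset_eqE:
  assumes "a \<in> carrier G" "b \<in> carrier G" "a <# Q = b <# Q"
  obtains x where "x \<in> Q" "a = b \<otimes> x"
proof -
  have "a \<otimes> \<one> \<in> a <# Q"
    unfolding l_coset_def using subgroup.one_closed[OF Q_subgroup] by auto
  then have "a \<in> b <# Q" using assms by simp
  then show ?thesis using that unfolding l_coset_def by auto
qed

text \<open>Both sides say that \<open>F(g) b F(g)\<^sup>-\<^sup>1 = g b g\<^sup>-\<^sup>1\<close> for all \<open>b \<in> B\<close>.\<close>

lemma conj_in_GF_iff:
  assumes g: "g \<in> carrier G"
  shows "conj_by G g B \<subseteq> GF \<longleftrightarrow> lang_map g \<in> C"
proof -
  have "F (g \<otimes> b \<otimes> inv g) = g \<otimes> b \<otimes> inv g \<longleftrightarrow> lang_map g \<otimes> b = b \<otimes> lang_map g" if "b \<in> B" for b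
  proof -
    have b: "b \<in> carrier G" "F b = b"
      using that B_closed B_fixed by (auto simp: fixed_points_def)
    have 1: "F (g \<otimes> b \<otimes> inv g) = g \<otimes> (lang_map g \<otimes> b) \<otimes> inv (F g)"
      using g b by (simp add: lang_map_def m_assoc)
    have 2: "g \<otimes> b \<otimes> inv g = g \<otimes> (b \<otimes> lang_map g) \<otimes> inv (F g)"
      using g b by (simp add: lang_map_def m_assoc)
    show ?thesis by (subst 1, subst 2) (use g b(1) in simp)
  qed
  then show ?thesis
    using g B_closed unfolding conj_by_image[OF g B_closed]
    by (auto simp: fixed_points_def centralizer_def)
qed

lemma lang_map_mult:
  "g \<in> carrier G \<Longrightarrow> h \<in> carrier G \<Longrightarrow> lang_map (g \<otimes> h) = inv h \<otimes> lang_map g \<otimes> F h"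
  by (simp add: lang_map_def inv_mult_group m_assoc)

lemma lang_map_eq_imp:
  assumes "g \<in> carrier G" "h \<in> carrier G" "lang_map g = lang_map h"
  shows "g \<otimes> inv h \<in> GF"
proof -
  have F: "F y = y \<otimes> lang_map y" if "y \<in> carrier G" for y
    using that by (simp add: lang_map_def)
  have "F (g \<otimes> inv h) = g \<otimes> lang_map h \<otimes> inv (h \<otimes> lang_map h)"
    using assms F[OF assms(1)] F[OF assms(2)] by simp
  also have "\<dots> = g \<otimes> inv h" using assms by (simp add: inv_mult_group m_assoc)
  finally show ?thesis using assms by (simp add: fixed_points_def)
qed

lemma GF_subgroup: "subgroup GF G"
  by (rule subgroupI) (auto simp: fixed_points_def intro: exI[of _ \<one>])

lemma conj_class_eq_iff:
  assumes "A \<subseteq> carrier G" "A' \<subseteq> carrier G"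
  shows "conj_class G GF A = conj_class G GF A' \<longleftrightarrow> (\<exists>x\<in>GF. A = conj_by G x A')"
proof
  assume "conj_class G GF A = conj_class G GF A'"
  moreover have "conj_by G \<one> A \<in> conj_class G GF A"
    unfolding conj_class_def using subgroup.one_closed[OF GF_subgroup] by (rule imageI)
  ultimately show "\<exists>x\<in>GF. A = conj_by G x A'"
    using conj_by_one[OF assms(1)] by (auto simp: conj_class_def)
next
  assume "\<exists>x\<in>GF. A = conj_by G x A'"
  then obtain x where x: "x \<in> GF" "A = conj_by G x A'" by (rule bexE)
  have GFG: "y \<in> carrier G" if "y \<in> GF" for y using that by (simp add: fixed_points_def)
  have 1: "conj_by G y A = conj_by G (y \<otimes> x) A'" if "y \<in> GF" for y
    unfolding x(2) using conj_by_mult[OF GFG[OF that] GFG[OF x(1)] assms(2)] by simp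
  have 2: "conj_by G y A' = conj_by G (y \<otimes> inv x) A" if "y \<in> GF" for y
    using 1[of "y \<otimes> inv x"] that x(1) GFG
      subgroup.m_closed[OF GF_subgroup that subgroup.m_inv_closed[OF GF_subgroup x(1)]]
    by (simp add: m_assoc)
  show "conj_class G GF A = conj_class G GF A'"
    unfolding conj_class_def
  proof (intro equalityI image_subsetI)
    fix y assume y: "y \<in> GF"
    show "conj_by G y A \<in> (\<lambda>h. conj_by G h A') ` GF"
      unfolding 1[OF y] by (intro imageI subgroup.m_closed[OF GF_subgroup] y x)
    show "conj_by G y A' \<in> (\<lambda>h. conj_by G h A) ` GF"
      unfolding 2[OF y] by (intro imageI subgroup.m_closed[OF GF_subgroup]
          subgroup.m_inv_closed[OF GF_subgroup] y x)
  qed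
qed

text \<open>The coset of \<open>F(h) u h\<^sup>-\<^sup>1\<close> is another member of the \<open>F\<close>-class of \<open>u\<close>, and \<open>F\<close>-classes are orbits
under the normalizer.\<close>

lemma F_class_translate:
  assumes "h \<in> N" "u \<in> carrier G"
  shows "F_class G F N Q (F h \<otimes> u \<otimes> inv h) = F_class G F N Q u"
proof -
  note N_cl = normalizer_mult_closed[OF B_closed] normalizer_inv_closed[OF B_closed]
  have eq: "F k \<otimes> (F h \<otimes> u \<otimes> inv h) \<otimes> inv k = F (k \<otimes> h) \<otimes> u \<otimes> inv (k \<otimes> h)" if "k \<in> N" for k
    using N_closed[OF that] N_closed[OF assms(1)] assms(2) by (simp add: m_assoc inv_mult_group)
  have eq': "F k \<otimes> u \<otimes> inv k = F (k \<otimes> inv h) \<otimes> (F h \<otimes> u \<otimes> inv h) \<otimes> inv (k \<otimes> inv h)" if "k \<in> N" for k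
    using N_closed[OF that] N_closed[OF assms(1)] assms(2) by (simp add: m_assoc inv_mult_group)
  show ?thesis
    unfolding F_class_def
  proof (intro equalityI image_subsetI)
    fix k assume k: "k \<in> N"
    show "(F k \<otimes> (F h \<otimes> u \<otimes> inv h) \<otimes> inv k) <# Q \<in> (\<lambda>g. (F g \<otimes> u \<otimes> inv g) <# Q) ` N"
      unfolding eq[OF k] by (rule imageI, rule N_cl(1)[OF k assms(1)])
    show "(F k \<otimes> u \<otimes> inv k) <# Q \<in> (\<lambda>g. (F g \<otimes> (F h \<otimes> u \<otimes> inv h) \<otimes> inv g) <# Q) ` N"
      unfolding eq'[OF k] by (rule imageI, rule N_cl(1)[OF k N_cl(2)[OF assms(1)]])
  qed
qed

text \<open>Since the normalizer normalizes \<open>Q\<close>, the \<open>F\<close>-class depends on the coset of \<open>u\<close> only.\<close>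

lemma F_class_coset:
  assumes "u \<in> carrier G" "x \<in> Q"
  shows "F_class G F N Q (u \<otimes> x) = F_class G F N Q u"
  unfolding F_class_def
proof (rule image_cong[OF refl])
  fix k assume k: "k \<in> N"
  have "F k \<otimes> (u \<otimes> x) \<otimes> inv k = (F k \<otimes> u \<otimes> inv k) \<otimes> (k \<otimes> x \<otimes> inv k)"
    using N_closed[OF k] assms Q_closed by (simp add: m_assoc)
  then show "(F k \<otimes> (u \<otimes> x) \<otimes> inv k) <# Q = (F k \<otimes> u \<otimes> inv k) <# Q"
    using l_coset_absorb[OF _ Q_normal[OF k assms(2)], of "F k \<otimes> u \<otimes> inv k"] N_closed[OF k] assms(1)
    by simp
qed

lemma self_in_F_class: "u \<in> carrier G \<Longrightarrow> u <# Q \<in> F_class G F N Q u"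
  unfolding F_class_def
  by (rule image_eqI[of _ _ \<one>]) (simp_all add: normalizer_one_closed[OF B_closed])

lemma F_class_inv_coset:
  assumes "w \<in> C" "v \<in> carrier G" "v <# Q = w <# Q"
  shows "F_class G F N Q (inv v) = F_class G F N Q (inv w)"
proof -
  have w: "w \<in> carrier G" using centralizerD(1)[OF assms(1)] .
  obtain x where x: "x \<in> Q" "v = w \<otimes> x" by (rule l_coset_eqE[OF assms(2) w assms(3)])
  have "inv v = inv w \<otimes> (w \<otimes> inv x \<otimes> inv w)"
    using w Q_closed[OF x(1)] by (simp add: x(2) inv_mult_group m_assoc)
  moreover have "w \<otimes> inv x \<otimes> inv w \<in> Q"
    by (rule Q_normal[OF C_N[OF assms(1)] subgroup.m_inv_closed[OF Q_subgroup x(1)]])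
  ultimately show ?thesis using F_class_coset[of "inv w"] w by simp
qed

text \<open>Changing \<open>g1\<close> by an element of the normalizer, one may assume that the two inverse Lang elements lie
in the same coset of \<open>Q\<close>. The Lang property of \<open>g2 Q g2\<^sup>-\<^sup>1\<close> then corrects \<open>g2\<close> by an element of
\<open>Q\<close>, which does not change the conjugate of \<open>B\<close>, so that the Lang elements become equal.\<close>

lemma conj_class_eq_of_F_class_eq:
  assumes g: "g1 \<in> carrier G" "g2 \<in> carrier G" "conj_by G g1 B \<subseteq> GF" "conj_by G g2 B \<subseteq> GF"
    and eq: "F_class G F N Q (inv (lang_map g1)) = F_class G F N Q (inv (lang_map g2))"
  shows "conj_class G GF (conj_by G g1 B) = conj_class G GF (conj_by G g2 B)"
proof -
  let ?w = "lang_map g2"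
  have "inv ?w <# Q \<in> F_class G F N Q (inv (lang_map g1))"
    unfolding eq using g(2) by (intro self_in_F_class) simp
  then obtain h where h: "h \<in> N"
    "inv ?w <# Q = (F h \<otimes> inv (lang_map g1) \<otimes> inv h) <# Q"
    unfolding F_class_def by (rule imageE)
  note hG = N_closed[OF h(1)]
  define g where "g = g1 \<otimes> inv h"
  have gG: "g \<in> carrier G" using g(1) hG by (simp add: g_def)
  have gB: "conj_by G g B = conj_by G g1 B"
    unfolding g_def using conj_by_mult[OF g(1) inv_closed[OF hG] B_closed]
      normalizer_inv_closed[OF B_closed h(1)] by (simp add: mem_normalizer_iff[OF B_closed])
  have "inv (lang_map g) = F h \<otimes> inv (lang_map g1) \<otimes> inv h"
    unfolding g_def using g(1) hG by (simp add: lang_map_mult inv_mult_group m_assoc)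
  with h(2) have "inv (lang_map g) <# Q = inv ?w <# Q" by simp
  then obtain x where x: "x \<in> Q" "inv (lang_map g) = inv ?w \<otimes> x"
    using gG g(2) by (elim l_coset_eqE[rotated 2]) simp_all
  note xG = Q_closed[OF x(1)]
  have lg: "lang_map g = inv x \<otimes> ?w"
    using arg_cong[OF x(2), of "\<lambda>y. inv y"] gG g(2) xG by (simp add: inv_mult_group)
  have "g2 \<otimes> inv x \<otimes> inv g2 \<in> conj_by G g2 Q"
    using subgroup.m_inv_closed[OF Q_subgroup x(1)] subgroup.subset[OF Q_subgroup]
    by (simp add: conj_by_image g(2))
  from lang_Q[OF g(2,4) this] obtain k' where k': "k' \<in> conj_by G g2 Q" "inv k' \<otimes> F k' = g2 \<otimes> inv x \<otimes> inv g2"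
    by (rule bexE)
  obtain k where k: "k \<in> Q" "k' = g2 \<otimes> k \<otimes> inv g2"
    using k'(1) subgroup.subset[OF Q_subgroup] by (auto simp: conj_by_image g(2))
  note kG = Q_closed[OF k(1)]
  \<comment> \<open>Lang's theorem on the conjugate of \<open>Q\<close> by \<open>g2\<close> is Lang's theorem on \<open>Q\<close> for the twisted
    endomorphism \<open>y \<mapsto> w F(y) w\<^sup>-\<^sup>1\<close>; it yields \<open>k \<in> Q\<close> such that \<open>g\<close> and \<open>g2 k\<close> have the
    same image under the Lang map, so that they differ by a fixed point.\<close>
  have "g2 \<otimes> (inv k \<otimes> ?w \<otimes> F k \<otimes> inv ?w) \<otimes> inv g2 = inv k' \<otimes> F k'"
    using g(2) kG by (simp add: k(2) lang_map_def inv_mult_group m_assoc)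
  also have "\<dots> = g2 \<otimes> inv x \<otimes> inv g2" by (rule k'(2))
  finally have "inv k \<otimes> ?w \<otimes> F k \<otimes> inv ?w = inv x" using g(2) kG xG by simp
  then have "inv x \<otimes> ?w = (inv k \<otimes> ?w \<otimes> F k \<otimes> inv ?w) \<otimes> ?w" by simp
  also have "\<dots> = lang_map (g2 \<otimes> k)" using g(2) kG by (simp add: lang_map_mult m_assoc)
  finally have "lang_map g = lang_map (g2 \<otimes> k)" using lg by simp
  from lang_map_eq_imp[OF gG _ this] g(2) kG
  have z: "g \<otimes> inv (g2 \<otimes> k) \<in> GF" by simp
  have "conj_by G k B = B"
    using C_N[OF subsetD[OF Q_centralizes k(1)]] by (simp add: mem_normalizer_iff[OF B_closed])
  then have "conj_by G (g2 \<otimes> k) B = conj_by G g2 B" using conj_by_mult[OF g(2) kG B_closed] by simp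
  moreover have "conj_by G g B = conj_by G ((g \<otimes> inv (g2 \<otimes> k)) \<otimes> (g2 \<otimes> k)) B"
    using gG g(2) kG by (simp add: m_assoc)
  ultimately have "conj_by G g1 B = conj_by G (g \<otimes> inv (g2 \<otimes> k)) (conj_by G g2 B)"
    using conj_by_mult[of "g \<otimes> inv (g2 \<otimes> k)" "g2 \<otimes> k" B] gG g(2) kG B_closed gB by simp
  with z show ?thesis
    using conj_class_eq_iff[OF conj_by_closed[OF g(1) B_closed] conj_by_closed[OF g(2) B_closed]]
    by blast
qed

text \<open>If \<open>x\<close> is a fixed point that conjugates one subgroup to the other, then \<open>h = (x g2)\<^sup>-\<^sup>1 g1\<close> normalizes
\<open>B\<close>, and \<open>x g2\<close> has the same Lang element as \<open>g2\<close>.\<close>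

lemma F_class_eq_of_conj_class_eq:
  assumes g: "g1 \<in> carrier G" "g2 \<in> carrier G"
    and eq: "conj_class G GF (conj_by G g1 B) = conj_class G GF (conj_by G g2 B)"
  shows "F_class G F N Q (inv (lang_map g1)) = F_class G F N Q (inv (lang_map g2))"
proof -
  obtain x where x: "x \<in> GF" "conj_by G g1 B = conj_by G x (conj_by G g2 B)"
    using eq conj_class_eq_iff[OF conj_by_closed[OF g(1) B_closed] conj_by_closed[OF g(2) B_closed]]
    by blast
  have xG: "x \<in> carrier G" "F x = x" using x(1) by (simp_all add: fixed_points_def)
  define h where "h = inv g2 \<otimes> inv x \<otimes> g1"
  have hG: "h \<in> carrier G" using g xG(1) by (simp add: h_def)
  have "conj_by G h B = conj_by G (inv (x \<otimes> g2)) (conj_by G g1 B)"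
    unfolding h_def using conj_by_mult[of "inv (x \<otimes> g2)" g1 B] g xG(1) B_closed
    by (simp add: inv_mult_group)
  also have "conj_by G g1 B = conj_by G (x \<otimes> g2) B"
    unfolding x(2) using conj_by_mult[OF xG(1) g(2) B_closed] by simp
  finally have "h \<in> N"
    using conj_by_inv_cancel[of "x \<otimes> g2" B] g xG(1) hG B_closed
    by (simp add: mem_normalizer_iff[OF B_closed])
  moreover have "inv (lang_map g2) = F h \<otimes> inv (lang_map g1) \<otimes> inv h"
    unfolding h_def lang_map_def using g xG by (simp add: inv_mult_group m_assoc)
  ultimately show ?thesis using F_class_translate[of h "inv (lang_map g1)"] g by simp
qed

lemma lang_map_N_in_C:
  assumes "g \<in> N"
  shows "lang_map g \<in> C"
  using assms B_fixed conj_in_GF_iff[OF N_closed[OF assms]]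
  by (simp add: mem_normalizer_iff[OF B_closed])

text \<open>For \<open>h\<close> in the normalizer, \<open>F(h) u h\<^sup>-\<^sup>1 = h (L(h) u) h\<^sup>-\<^sup>1\<close> with \<open>L(h) \<in> C\<close>, because \<open>h B h\<^sup>-\<^sup>1 = B\<close>
consists of fixed points; and \<open>C\<close> is normal in \<open>N\<close>.\<close>

lemma F_class_subset_centralizer_iff:
  assumes u: "u \<in> carrier G"
  shows "F_class G F N Q u \<subseteq> (\<lambda>u. u <# Q) ` C \<longleftrightarrow> u \<in> C"
proof
  assume "F_class G F N Q u \<subseteq> (\<lambda>u. u <# Q) ` C"
  with self_in_F_class[OF u] have "u <# Q \<in> (\<lambda>u. u <# Q) ` C" by (rule subsetD[rotated])
  then obtain c where c: "u <# Q = c <# Q" "c \<in> C" by (rule imageE)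
  obtain x where "x \<in> Q" "u = c \<otimes> x"
    by (rule l_coset_eqE[OF u centralizerD(1)[OF c(2)] c(1)])
  then show "u \<in> C"
    using subgroup.m_closed[OF C_subgroup c(2) subsetD[OF Q_centralizes]] by simp
next
  assume uC: "u \<in> C"
  show "F_class G F N Q u \<subseteq> (\<lambda>u. u <# Q) ` C"
    unfolding F_class_def
  proof (intro image_subsetI imageI)
    fix h assume h: "h \<in> N"
    note hG = N_closed[OF h]
    have conj: "h \<otimes> c \<otimes> inv h \<in> C" if "c \<in> C" for c
      using centralizer_conj[OF B_closed hG that] h by (simp add: mem_normalizer_iff[OF B_closed])
    have "F h \<otimes> u \<otimes> inv h = h \<otimes> (lang_map h \<otimes> u) \<otimes> inv h"
      using hG u by (simp add: lang_map_def m_assoc)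
    also have "\<dots> \<in> C"
      by (intro conj subgroup.m_closed[OF C_subgroup] lang_map_N_in_C h uC)
    finally show "F h \<otimes> u \<otimes> inv h \<in> C" .
  qed
qed

theorem classes_bijection:
  "\<exists>\<Phi>. bij_betw \<Phi>
      {X \<in> F_class G F N Q ` N. X \<subseteq> (\<lambda>u. u <# Q) ` C}
      {conj_class G GF B' | B'. B' \<in> conj_class G (carrier G) B \<and> B' \<subseteq> GF} \<and>
    (\<forall>w\<in>C.
      (\<exists>g\<in>carrier G. (inv g \<otimes> F g) <# Q = w <# Q) \<and>
      (\<forall>g\<in>carrier G. (inv g \<otimes> F g) <# Q = w <# Q \<longrightarrow>
         conj_by G g B \<subseteq> GF \<and>
         \<Phi> (F_class G F N Q (inv w)) = conj_class G GF (conj_by G g B)))"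
proof -
  let ?S = "{g \<in> carrier G. conj_by G g B \<subseteq> GF}"
  let ?f = "\<lambda>g. F_class G F N Q (inv (lang_map g))"
  let ?c = "\<lambda>g. conj_class G GF (conj_by G g B)"
  have "\<exists>\<Phi>. bij_betw \<Phi> (?f ` ?S) (?c ` ?S) \<and> (\<forall>g\<in>?S. \<Phi> (?f g) = ?c g)"
  proof (rule bij_betw_from_equal_fibres)
    fix s t assume "s \<in> ?S" "t \<in> ?S"
    then have st: "s \<in> carrier G" "t \<in> carrier G" "conj_by G s B \<subseteq> GF" "conj_by G t B \<subseteq> GF"
      by simp_all
    show "?f s = ?f t \<longleftrightarrow> ?c s = ?c t"
      by (rule iffI) (erule conj_class_eq_of_F_class_eq[OF st], erule F_class_eq_of_conj_class_eq[OF st(1,2)])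
  qed
  then obtain \<Phi> where \<Phi>: "bij_betw \<Phi> (?f ` ?S) (?c ` ?S)" "\<forall>g\<in>?S. \<Phi> (?f g) = ?c g"
    by (elim exE conjE)
  have dom: "?f ` ?S = {X \<in> F_class G F N Q ` N. X \<subseteq> (\<lambda>u. u <# Q) ` C}"
  proof (intro equalityI subsetI)
    fix X assume "X \<in> ?f ` ?S"
    then obtain g where g: "g \<in> carrier G" "conj_by G g B \<subseteq> GF" "X = ?f g" by auto
    have "inv (lang_map g) \<in> C"
      using g conj_in_GF_iff subgroup.m_inv_closed[OF C_subgroup] by simp
    then show "X \<in> {X \<in> F_class G F N Q ` N. X \<subseteq> (\<lambda>u. u <# Q) ` C}"
      unfolding g(3) using C_N F_class_subset_centralizer_iff[of "inv (lang_map g)"] g(1)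
      by (intro CollectI conjI imageI) simp_all
  next
    fix X assume "X \<in> {X \<in> F_class G F N Q ` N. X \<subseteq> (\<lambda>u. u <# Q) ` C}"
    then obtain u where u: "u \<in> N" "X = F_class G F N Q u" "X \<subseteq> (\<lambda>u. u <# Q) ` C" by auto
    have uC: "u \<in> C" using F_class_subset_centralizer_iff[OF N_closed[OF u(1)]] u(2,3) by simp
    have "inv u \<in> carrier G" using N_closed[OF u(1)] by simp
    from lang[OF this] obtain g where g: "g \<in> carrier G" "inv g \<otimes> F g = inv u" by (rule bexE)
    have "lang_map g \<in> C"
      unfolding lang_map_def g(2) by (rule subgroup.m_inv_closed[OF C_subgroup uC])
    then have "g \<in> ?S" using g(1) conj_in_GF_iff by simp
    moreover have "X = ?f g" using u(2) g(2) N_closed[OF u(1)] by (simp add: lang_map_def)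
    ultimately show "X \<in> ?f ` ?S" by (intro image_eqI)
  qed
  have rng: "?c ` ?S = {conj_class G GF B' | B'. B' \<in> conj_class G (carrier G) B \<and> B' \<subseteq> GF}"
    unfolding conj_class_def[of G "carrier G"] by auto
  have "(\<exists>g\<in>carrier G. (inv g \<otimes> F g) <# Q = w <# Q) \<and>
      (\<forall>g\<in>carrier G. (inv g \<otimes> F g) <# Q = w <# Q \<longrightarrow>
         conj_by G g B \<subseteq> GF \<and>
         \<Phi> (F_class G F N Q (inv w)) = conj_class G GF (conj_by G g B))" if w: "w \<in> C" for w
  proof (intro conjI ballI impI)
    note wG = centralizerD(1)[OF w]
    obtain g where "g \<in> carrier G" "inv g \<otimes> F g = w" using lang[OF wG] by (rule bexE)
    then show "\<exists>g\<in>carrier G. (inv g \<otimes> F g) <# Q = w <# Q" by (intro bexI[of _ g]) simp_all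
    fix g assume g: "g \<in> carrier G" "(inv g \<otimes> F g) <# Q = w <# Q"
    obtain x where x: "x \<in> Q" "lang_map g = w \<otimes> x"
      using l_coset_eqE[OF _ wG g(2)] g(1) unfolding lang_map_def by auto
    have "lang_map g \<in> C"
      unfolding x(2) by (rule subgroup.m_closed[OF C_subgroup w subsetD[OF Q_centralizes x(1)]])
    then show gB: "conj_by G g B \<subseteq> GF" using conj_in_GF_iff[OF g(1)] by simp
    have "F_class G F N Q (inv w) = ?f g"
      using F_class_inv_coset[OF w lang_map_closed[OF g(1)]] g(2) by (simp add: lang_map_def)
    then show "\<Phi> (F_class G F N Q (inv w)) = conj_class G GF (conj_by G g B)"
      using \<Phi>(2) g(1) gB by simp
  qed
  note main = this
  show ?thesis
    by (rule exI[of _ \<Phi>], rule conjI[OF \<Phi>(1)[unfolded dom rng]], rule ballI, rule main)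
qed

end

section \<open>Steinberg endomorphisms and identity components of centralizers\<close>

lemma closedin_zariski_singleton:
  assumes "b \<in> carrier (GL n :: 'a::field mat monoid)"
  shows "closedin (zariski n) {b}"
proof (rule closedin_zariskiI)
  let ?S = "{\<lambda>x. x $$ (i, j) + - (b $$ (i, j)) |i j. i < n \<and> j < n} :: ('a mat \<Rightarrow> 'a) set"
  show "?S \<subseteq> regular_functions n"
    by clarify (rule regular_functions.add[OF regular_functions.entry regular_functions.const])
  show "{b} = {x \<in> carrier (GL n). \<forall>f\<in>?S. f x = 0}"
  proof (intro equalityI subsetI)
    fix x assume x: "x \<in> {x \<in> carrier (GL n). \<forall>f\<in>?S. f x = 0}"
    have "x $$ (i, j) = b $$ (i, j)" if "i < n" "j < n" for i j
    proof -
      have "(\<lambda>x. x $$ (i, j) + - (b $$ (i, j))) \<in> ?S" using that by blast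
      from bspec[OF conjunct2[OF CollectD[OF x]] this] show ?thesis by simp
    qed
    then show "x \<in> {b}" using x assms by (auto simp: GL_iff intro!: eq_matI)
  qed (use assms in auto)
qed

locale steinberg_group =
  fixes n :: nat and G :: "'a::alg_closed_field mat monoid" (structure) and F :: "'a mat \<Rightarrow> 'a mat"
  assumes algebraic_group: "linear_algebraic_group n G"
    and steinberg: "steinberg_endomorphism n G F"
    and positive_characteristic: "CHAR('a) > 0"
begin

lemma G_GL: "G = GL n\<lparr>carrier := carrier G\<rparr>" "subgroup (carrier G) (GL n)"
  "closedin (zariski n) (carrier G)"
proof -
  note conj = algebraic_group[unfolded linear_algebraic_group_def]
  show "G = GL n\<lparr>carrier := carrier G\<rparr>" by (rule conjunct1[OF conj])
  show "subgroup (carrier G) (GL n)" by (rule conjunct1[OF conjunct2[OF conj]])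
  show "closedin (zariski n) (carrier G)" by (rule conjunct2[OF conjunct2[OF conj]])
qed

lemma carrier_subset: "carrier G \<subseteq> carrier (GL n)"
  by (rule subgroup.subset[OF G_GL(2)])

lemma mult_G [simp]: "x \<otimes> y = x * y"
proof -
  have "x \<otimes>\<^bsub>GL n\<lparr>carrier := carrier G\<rparr>\<^esub> y = x * y" by simp
  then show ?thesis unfolding G_GL(1)[symmetric] .
qed

lemma one_G [simp]: "\<one> = 1\<^sub>m n"
proof -
  have "\<one>\<^bsub>GL n\<lparr>carrier := carrier G\<rparr>\<^esub> = (1\<^sub>m n :: 'a mat)" by simp
  then show ?thesis unfolding G_GL(1)[symmetric] .
qed

lemma inv_G: "x \<in> carrier G \<Longrightarrow> inv x = inv\<^bsub>GL n\<^esub> x"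
  using group.m_inv_consistent[OF group_GL G_GL(2), of x] unfolding G_GL(1)[symmetric] .

lemma G_group: "group G"
  using group.subgroup_imp_group[OF group_GL G_GL(2)] unfolding G_GL(1)[symmetric] .

lemma subgroup_GL: "subgroup H G \<Longrightarrow> subgroup H (GL n)"
  using group.incl_subgroup[OF group_GL G_GL(2), of H] unfolding G_GL(1)[symmetric] .

lemma regular_conj:
  assumes "g \<in> carrier G"
  shows "regular_map n (carrier G) (\<lambda>x. g \<otimes> x \<otimes> inv g)"
proof -
  interpret group G by (rule G_group)
  have "g \<in> carrier (GL n)" "inv g \<in> carrier (GL n)" using assms carrier_subset by auto
  then show ?thesis
    unfolding mult_G by (intro regular_map_mult regular_map_const regular_map_id carrier_subset)
qed

lemma F_hom: "F \<in> hom G G"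
  using steinberg by (simp add: steinberg_endomorphism_def algebraic_endomorphism_def)

lemma F_carrier: "x \<in> carrier G \<Longrightarrow> F x \<in> carrier G"
  using F_hom by (auto simp: hom_def)

lemma coordinate_ring_regular:
  assumes "f \<in> coordinate_ring n X"
  shows "regular_on n X f"
  using assms by (auto simp: coordinate_ring_def regular_on_def)

text \<open>The condition on the inverse determinant follows from the one on the entries, because
\<open>1 / det (F x) = det (F (x\<^sup>-\<^sup>1))\<close>.\<close>

lemma F_regular: "regular_map n (carrier G) F"
proof (rule regular_mapI)
  interpret group G by (rule G_group)
  interpret F: group_hom G G F by standard (rule F_hom)
  have FG: "F x \<in> carrier (GL n)" if "x \<in> carrier G" for x
    using F_carrier[OF that] carrier_subset by auto
  then show "F x \<in> carrier (GL n)" if "x \<in> carrier G" for x using that .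
  show entry: "regular_on n (carrier G) (\<lambda>x. F x $$ (i, j))" if "i < n" "j < n" for i j
  proof -
    have "(\<lambda>x\<in>carrier G. F x $$ (i, j)) \<in> coordinate_ring n (carrier G)"
      using steinberg that by (simp add: steinberg_endomorphism_def algebraic_endomorphism_def)
    from coordinate_ring_regular[OF this] show ?thesis
      by (subst regular_on_cong[of _ _ "\<lambda>x\<in>carrier G. F x $$ (i, j)"]) simp_all
  qed
  have det: "regular_on n (carrier G) (\<lambda>x. det (F x))"
    by (rule regular_on_det[OF _ entry]) (use FG in \<open>auto simp: GL_iff\<close>)
  have inv: "regular_map n (carrier G) (\<lambda>x. inv\<^bsub>GL n\<^esub> x)"
    by (rule regular_map_subset[OF regular_map_inv carrier_subset])
  have "(\<lambda>x. inv\<^bsub>GL n\<^esub> x) ` carrier G \<subseteq> carrier G"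
    using inv_closed by (auto simp flip: inv_G)
  from regular_on_compose[OF inv this det]
  have "regular_on n (carrier G) (\<lambda>x. det (F (inv\<^bsub>GL n\<^esub> x)))" .
  moreover have "inverse (det (F x)) = det (F (inv\<^bsub>GL n\<^esub> x))" if x: "x \<in> carrier G" for x
  proof -
    have "F x * F (inv\<^bsub>GL n\<^esub> x) = 1\<^sub>m n"
      using F.hom_mult[OF x inv_closed[OF x]] F.hom_one r_inv[OF x] inv_G[OF x] by simp
    moreover have "F x \<in> carrier_mat n n" "F (inv\<^bsub>GL n\<^esub> x) \<in> carrier_mat n n"
      using FG[OF x] FG[OF inv_closed[OF x]] inv_G[OF x] by (simp_all add: GL_iff)
    ultimately have "det (F x) * det (F (inv\<^bsub>GL n\<^esub> x)) = 1"
      using det_mult[of "F x" n "F (inv\<^bsub>GL n\<^esub> x)"] by simp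
    then show ?thesis by (rule inverse_unique)
  qed
  ultimately show "regular_on n (carrier G) (\<lambda>x. inverse (det (F x)))"
    by (subst regular_on_cong) simp_all
qed

theorem lang_on_subgroup:
  assumes H: "subgroup H G" "closedin (zariski n) H" "connectedin (zariski n) H" "F ` H \<subseteq> H"
    and h: "h \<in> H"
  shows "\<exists>x\<in>H. inv x \<otimes> F x = h"
proof -
  obtain m e R where st: "e \<ge> 1" "Fq_structure (CHAR('a) ^ e) n (carrier G) R"
    "frobenius_morphism (CHAR('a) ^ e) (carrier G) R (F ^^ m)"
    using steinberg unfolding steinberg_endomorphism_def by (elim conjE exE)
  have HG: "H \<subseteq> carrier G" by (rule subgroup.subset[OF H(1)])
  note conj = st(2)[unfolded Fq_structure_def]
  have RG: "R \<subseteq> coordinate_ring n (carrier G)" by (rule conjunct1[OF conj])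
  have spans: "\<forall>f\<in>coordinate_ring n (carrier G).
      \<exists>T c. finite T \<and> T \<subseteq> R \<and> (\<forall>x\<in>carrier G. f x = (\<Sum>t\<in>T. c t * t x))"
    by (rule conjunct1[OF conjunct2[OF conjunct2[OF conjunct2[OF conj]]]])
  have "lang_steinberg_setting n H F m e R"
  proof (rule lang_steinberg_setting.intro)
    show "subgroup H (GL n)" by (rule subgroup_GL[OF H(1)])
    show "closedin (zariski n) H" "connectedin (zariski n) H" by (rule H)+
    show "F x \<in> H" if "x \<in> H" for x using H(4) that by blast
    show "F (x * y) = F x * F y" if "x \<in> H" "y \<in> H" for x y
    proof -
      have "F (x \<otimes> y) = F x \<otimes> F y" using F_hom HG that by (auto simp: hom_def)
      then show ?thesis by simp
    qed
    show "regular_map n H F" by (rule regular_map_subset[OF F_regular HG])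
    show "CHAR('a) > 0" by (rule positive_characteristic)
    show "e \<ge> 1" by (rule st(1))
    show "regular_on n H t" if "t \<in> R" for t
      by (rule regular_on_subset[OF coordinate_ring_regular[OF subsetD[OF RG that]] HG])
    show "\<exists>T c. finite T \<and> T \<subseteq> R \<and> (\<forall>x\<in>H. f x = (\<Sum>t\<in>T. c t * t x))"
      if "f \<in> regular_functions n" for f
    proof -
      have "restrict f (carrier G) \<in> coordinate_ring n (carrier G)"
        unfolding coordinate_ring_def by (rule imageI[OF that])
      from bspec[OF spans this] obtain T c where T: "finite T" "T \<subseteq> R"
        "\<forall>x\<in>carrier G. restrict f (carrier G) x = (\<Sum>t\<in>T. c t * t x)"
        by (elim exE conjE)
      have "f x = (\<Sum>t\<in>T. c t * t x)" if "x \<in> H" for x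
        using bspec[OF T(3) subsetD[OF HG that]] subsetD[OF HG that] by simp
      then show ?thesis using T(1,2) by (intro exI[of _ T] exI[of _ c]) simp
    qed
    show "t ((F ^^ m) x) = t x ^ (CHAR('a) ^ e)" if "t \<in> R" "x \<in> H" for t x
      using st(3) that HG unfolding frobenius_morphism_def by blast
  qed
  from lang_steinberg_setting.lang_steinberg[OF this h]
  show ?thesis using HG by (auto simp: inv_G subset_iff)
qed

context
  fixes B
  assumes B: "B \<subseteq> carrier G"
begin

interpretation group G by (rule G_group)

text \<open>The centralizer is the intersection, over \<open>b \<in> B\<close>, of the fibres over \<open>b\<close> of the regular maps
\<open>x \<mapsto> x\<^sup>-\<^sup>1 b x\<close>.\<close>

lemma closedin_centralizer: "closedin (zariski n) (centralizer G B)"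
proof -
  let ?D = "\<lambda>b. {x \<in> carrier G. inv\<^bsub>GL n\<^esub> x * (b * x) \<in> {b}}"
  have bGL: "b \<in> carrier (GL n)" if "b \<in> B" for b using that B carrier_subset by auto
  have eq: "x \<otimes> b = b \<otimes> x \<longleftrightarrow> inv\<^bsub>GL n\<^esub> x * (b * x) \<in> {b}" if "x \<in> carrier G" "b \<in> B" for x b
  proof -
    have b: "b \<in> carrier G" using that B by auto
    have "x \<otimes> b = b \<otimes> x \<longleftrightarrow> inv x \<otimes> (b \<otimes> x) = b"
      using inv_solve_left[OF b that(1) m_closed[OF b that(1)]] by metis
    then show ?thesis by (simp add: inv_G[OF that(1)])
  qed
  have centralizer_eq: "centralizer G B = \<Inter>(insert (carrier G) (?D ` B))"
    unfolding centralizer_def using eq by auto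
  have closed: "closedin (zariski n) (?D b)" if "b \<in> B" for b
  proof (rule closedin_trans_full[OF closedin_regular_vimage[OF _ carrier_subset
          closedin_zariski_singleton[OF bGL[OF that]]] G_GL(3)])
    show "regular_map n (carrier G) (\<lambda>x. inv\<^bsub>GL n\<^esub> x * (b * x))"
      using bGL[OF that]
      by (intro regular_map_mult regular_map_inv' regular_map_const regular_map_id carrier_subset)
  qed
  show ?thesis
    unfolding centralizer_eq
  proof (rule closedin_Inter)
    fix D assume "D \<in> insert (carrier G) (?D ` B)"
    then show "closedin (zariski n) D"
    proof (rule insertE)
      assume "D \<in> ?D ` B"
      then obtain b where "D = ?D b" "b \<in> B" by (rule imageE)
      then show ?thesis using closed[of b] by simp
    qed (simp add: G_GL(3))
  qed simp
qed

abbreviation (input) "Q \<equiv> identity_component n (centralizer G B)"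

lemma centralizer_GL: "centralizer G B \<subseteq> carrier (GL n)"
  using carrier_subset by (auto simp: centralizer_def)

text \<open>The subgroup property, normality and stability below come from this maximality, applied to images of
\<open>Q\<close> under translations, conjugations and \<open>F\<close>, which are connected because these maps are regular.\<close>

lemma component_maximal:
  assumes "connectedin (zariski n) D" "1\<^sub>m n \<in> D" "D \<subseteq> centralizer G B"
  shows "D \<subseteq> Q"
  unfolding identity_component_def
  by (rule connected_component_of_maximal) (use assms in \<open>auto simp: connectedin_subtopology\<close>)

lemma component_connected: "connectedin (zariski n) Q" "Q \<subseteq> centralizer G B"
proof -
  have "connectedin (subtopology (zariski n) (centralizer G B)) Q"
    unfolding identity_component_def by (rule connectedin_connected_component_of)
  then show "connectedin (zariski n) Q" "Q \<subseteq> centralizer G B"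
    by (simp_all add: connectedin_subtopology)
qed

lemma component_closed: "closedin (zariski n) Q"
  unfolding identity_component_def
  by (rule closedin_trans_full[OF closedin_connected_component_of closedin_centralizer])

lemma component_one: "1\<^sub>m n \<in> Q"
proof -
  have "\<one> \<in> centralizer G B" by (rule subgroup.one_closed[OF subgroup_centralizer[OF B]])
  then show ?thesis
    unfolding identity_component_def
    using centralizer_GL by (auto simp: connected_component_of_refl)
qed

lemma component_carrier: "Q \<subseteq> carrier G"
  using component_connected(2) by (auto simp: centralizer_def)

lemma component_subgroup: "subgroup Q G"
proof -
  note C = subgroup_centralizer[OF B]
  have key: "inv x \<otimes> y \<in> Q" if x: "x \<in> Q" and y: "y \<in> Q" for x y
  proof -
    have xG: "x \<in> carrier G" using component_carrier x by auto
    have "regular_map n (carrier G) (\<lambda>z. inv x \<otimes> z)"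
      using xG carrier_subset inv_closed[OF xG]
      unfolding mult_G by (intro regular_map_mult regular_map_const regular_map_id) auto
    from connectedin_regular_image[OF this carrier_subset component_connected(1) component_carrier]
    have "connectedin (zariski n) ((\<lambda>z. inv x \<otimes> z) ` Q)" .
    moreover have "1\<^sub>m n \<in> (\<lambda>z. inv x \<otimes> z) ` Q"
      using x l_inv[OF xG] by (intro image_eqI[of _ _ x]) simp_all
    moreover have "(\<lambda>z. inv x \<otimes> z) ` Q \<subseteq> centralizer G B"
      using component_connected(2) x subgroup.m_closed[OF C subgroup.m_inv_closed[OF C]] by auto
    ultimately have "(\<lambda>z. inv x \<otimes> z) ` Q \<subseteq> Q" by (rule component_maximal)
    with y show ?thesis by blast
  qed
  have inv: "inv x \<in> Q" if "x \<in> Q" for x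
  proof -
    have "x \<in> carrier G" using component_carrier that by auto
    then have "inv x \<otimes> \<one> = inv x" by (intro r_one inv_closed)
    then show ?thesis using key[OF that component_one] by simp
  qed
  show ?thesis
  proof (rule subgroupI)
    show "Q \<subseteq> carrier G" by (rule component_carrier)
    show "Q \<noteq> {}" using component_one by blast
    show "inv x \<in> Q" if "x \<in> Q" for x by (rule inv[OF that])
    show "x \<otimes> y \<in> Q" if "x \<in> Q" "y \<in> Q" for x y
      using key[OF inv[OF that(1)] that(2)] component_carrier that(1) by auto
  qed
qed

lemma component_normal:
  assumes g: "g \<in> normalizer G B" and x: "x \<in> Q"
  shows "g \<otimes> x \<otimes> inv g \<in> Q"
proof -
  have gG: "g \<in> carrier G" "conj_by G g B = B" using g by (simp_all add: mem_normalizer_iff[OF B])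
  from connectedin_regular_image[OF regular_conj[OF gG(1)] carrier_subset component_connected(1)
      component_carrier]
  have "connectedin (zariski n) ((\<lambda>x. g \<otimes> x \<otimes> inv g) ` Q)" .
  moreover have "1\<^sub>m n \<in> (\<lambda>x. g \<otimes> x \<otimes> inv g) ` Q"
  proof (rule image_eqI[OF _ component_one])
    have "g \<otimes> \<one> \<otimes> inv g = \<one>" using gG(1) by (simp only: r_one r_inv)
    then show "1\<^sub>m n = g \<otimes> 1\<^sub>m n \<otimes> inv g" by simp
  qed
  moreover have "(\<lambda>x. g \<otimes> x \<otimes> inv g) ` Q \<subseteq> centralizer G B"
    using centralizer_conj[OF B gG(1)] component_connected(2) unfolding gG(2) by blast
  ultimately have "(\<lambda>x. g \<otimes> x \<otimes> inv g) ` Q \<subseteq> Q" by (rule component_maximal)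
  with x show ?thesis by blast
qed

text \<open>The conjugate \<open>g Q g\<^sup>-\<^sup>1\<close> is the identity component of the centralizer of \<open>g B g\<^sup>-\<^sup>1\<close>. Since \<open>F\<close>
fixes \<open>g B g\<^sup>-\<^sup>1\<close> pointwise, it maps this centralizer, and hence the identity component, into itself.\<close>

lemma lang_on_component_conjugate:
  assumes g: "g \<in> carrier G" and gB: "conj_by G g B \<subseteq> fixed_points G F"
    and h: "h \<in> conj_by G g Q"
  shows "\<exists>x\<in>conj_by G g Q. inv x \<otimes> F x = h"
proof -
  interpret F: group_hom G G F by standard (rule F_hom)
  let ?Q = "conj_by G g Q"
  have Q_eq: "?Q = (\<lambda>x. g \<otimes> x \<otimes> inv g) ` Q" by (rule conj_by_image[OF g component_carrier])
  have QG: "?Q \<subseteq> carrier G" by (rule conj_by_closed[OF g component_carrier])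
  have con: "connectedin (zariski n) ?Q"
    unfolding Q_eq
    by (rule connectedin_regular_image[OF regular_conj[OF g] carrier_subset component_connected(1)
      component_carrier])
  have mem: "y \<in> ?Q \<longleftrightarrow> inv g \<otimes> y \<otimes> inv (inv g) \<in> Q" if y: "y \<in> carrier G" for y
  proof
    assume "y \<in> ?Q"
    then obtain x where x: "x \<in> Q" "y = g \<otimes> x \<otimes> inv g" unfolding Q_eq by (rule imageE)
    have "x \<in> carrier G" using x(1) component_carrier by auto
    then have "inv g \<otimes> y \<otimes> inv (inv g) = x"
      unfolding x(2) using g by (simp add: m_assoc del: mult_G one_G)
    with x(1) show "inv g \<otimes> y \<otimes> inv (inv g) \<in> Q" by simp
  next
    assume *: "inv g \<otimes> y \<otimes> inv (inv g) \<in> Q"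
    have "y = g \<otimes> (inv g \<otimes> y \<otimes> inv (inv g)) \<otimes> inv g"
      using g y by (simp add: m_assoc del: mult_G one_G)
    then show "y \<in> ?Q" unfolding Q_eq using * by (rule image_eqI)
  qed
  have "?Q = {y \<in> carrier G. inv g \<otimes> y \<otimes> inv (inv g) \<in> Q}"
    using mem QG by blast
  then have closed: "closedin (zariski n) ?Q"
    using closedin_trans_full[OF closedin_regular_vimage[OF regular_conj[OF inv_closed[OF g]]
          carrier_subset component_closed] G_GL(3)] by simp
  have sub: "subgroup ?Q G"
    by (rule subgroup_conj_by[OF component_subgroup g])
  have stable: "F ` ?Q \<subseteq> ?Q"
  proof -
    let ?D = "(\<lambda>y. inv g \<otimes> y \<otimes> inv (inv g)) ` F ` ?Q"
    have FQG: "F ` ?Q \<subseteq> carrier G" using QG F_carrier by auto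
    have "connectedin (zariski n) (F ` ?Q)"
      by (rule connectedin_regular_image[OF F_regular carrier_subset con QG])
    then have "connectedin (zariski n) ?D"
      by (rule connectedin_regular_image[OF regular_conj[OF inv_closed[OF g]] carrier_subset _ FQG])
    moreover have "1\<^sub>m n \<in> ?D"
    proof -
      have "F \<one> \<in> F ` ?Q" by (rule imageI[OF subgroup.one_closed[OF sub]])
      then have "inv g \<otimes> F \<one> \<otimes> inv (inv g) \<in> ?D" by (rule imageI)
      moreover have "inv g \<otimes> F \<one> \<otimes> inv (inv g) = \<one>"
        using g by (simp del: mult_G one_G)
      ultimately show ?thesis by simp
    qed
    moreover have "?D \<subseteq> centralizer G B"
    proof (clarify)
      fix y assume y: "y \<in> ?Q"
      have gBG: "conj_by G g B \<subseteq> carrier G" by (rule conj_by_closed[OF g B])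
      have "y \<in> centralizer G (conj_by G g B)"
        using y component_connected(2) centralizer_conj[OF B g] unfolding Q_eq by blast
      then have "F y \<in> centralizer G (conj_by G g B)"
      proof -
        assume yC: "y \<in> centralizer G (conj_by G g B)"
        note yG = centralizerD(1)[OF yC]
        have "F y \<otimes> b = b \<otimes> F y" if b: "b \<in> conj_by G g B" for b
        proof -
          have bG: "b \<in> carrier G" "F b = b"
            using subsetD[OF gB b] by (simp_all add: fixed_points_def)
          have "F (y \<otimes> b) = F (b \<otimes> y)" using centralizerD(2)[OF yC b] by simp
          then show ?thesis using F.hom_mult[OF yG bG(1)] F.hom_mult[OF bG(1) yG] bG(2) by simp
        qed
        then show ?thesis using F_carrier[OF yG] by (simp add: centralizer_def)
      qed
      from centralizer_conj[OF gBG inv_closed[OF g] this] conj_by_inv_cancel[OF g B]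
      show "inv g \<otimes> F y \<otimes> inv (inv g) \<in> centralizer G B" by simp
    qed
    ultimately have "?D \<subseteq> Q" by (rule component_maximal)
    then show ?thesis using mem FQG by blast
  qed
  show ?thesis by (rule lang_on_subgroup[OF sub closed con stable h])
qed

end

end

section \<open>Stable conjugates and classes of fixed conjugates\<close>

theorem proposition4p1:
  fixes G :: "'a::alg_closed_field mat monoid" (structure)
    and n l :: nat
    and F :: "'a mat \<Rightarrow> 'a mat"
    and A :: "'a mat set"
  assumes "CHAR('a) = l" and "l > 0"
    and "connected_reductive n G"
    and "steinberg_endomorphism n G F"
    and "subgroup A G" and "finite A"
    and "F ` A \<in> conj_class G (carrier G) A"
  shows
    "(\<exists>B \<in> conj_class G (carrier G) A. F ` B = B) \<and>
     (\<forall>B \<in> conj_class G (carrier G) A. B \<subseteq> fixed_points G F \<longrightarrow>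
       (let N = normalizer G B; C = centralizer G B; Q = identity_component n C;
            GF = fixed_points G F
        in \<exists>\<Phi>. bij_betw \<Phi>
              {X \<in> F_class G F N Q ` N. X \<subseteq> (\<lambda>u. u <# Q) ` C}
              {conj_class G GF B' | B'. B' \<in> conj_class G (carrier G) B \<and> B' \<subseteq> GF} \<and>
            (\<forall>w\<in>C.
              (\<exists>g\<in>carrier G. (inv g \<otimes> F g) <# Q = w <# Q) \<and>
              (\<forall>g\<in>carrier G. (inv g \<otimes> F g) <# Q = w <# Q \<longrightarrow>
                 conj_by G g B \<subseteq> GF \<and>
                 \<Phi> (F_class G F N Q (inv w)) = conj_class G GF (conj_by G g B)))))"
proof -
  interpret steinberg_group n G F
    using assms(1-4) by unfold_locales (simp_all add: connected_reductive_def)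
  interpret group G by (rule G_group)
  interpret F: group_hom G G F by standard (rule F_hom)
  have connected: "connectedin (zariski n) (carrier G)"
    using assms(3) by (simp add: connected_reductive_def)
  have lang: "\<exists>x\<in>carrier G. inv x \<otimes> F x = h" if "h \<in> carrier G" for h
    by (rule lang_on_subgroup[OF subgroup_self G_GL(3) connected _ that]) (use F_carrier in blast)
  have AG: "A \<subseteq> carrier G" by (rule subgroup.subset[OF assms(5)])
  show ?thesis
  proof (intro conjI ballI impI)
    obtain g where g: "g \<in> carrier G" "F ` A = conj_by G g A"
      using assms(7) unfolding conj_class_def by auto
    obtain x where x: "x \<in> carrier G" "inv x \<otimes> F x = inv g"
      using lang[OF inv_closed[OF g(1)]] by (rule bexE)
    have Fx: "F x \<otimes> g = x"
    proof -
      have "x \<otimes> (inv x \<otimes> F x) \<otimes> g = x \<otimes> inv g \<otimes> g" by (simp only: x(2))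
      then show ?thesis using x(1) g(1) by (simp add: m_assoc del: mult_G one_G)
    qed
    have "F ` conj_by G x A = (\<lambda>a. F x \<otimes> a \<otimes> inv (F x)) ` F ` A"
      unfolding conj_by_image[OF x(1) AG] image_image
      by (rule image_cong) (use x(1) AG in \<open>auto simp del: mult_G one_G\<close>)
    also have "\<dots> = conj_by G (F x) (conj_by G g A)"
      unfolding g(2) by (rule conj_by_image[symmetric]) (use x g AG F_carrier conj_by_closed in auto)
    also have "\<dots> = conj_by G x A"
      using conj_by_mult[OF F_carrier[OF x(1)] g(1) AG] Fx by simp
    finally have "F ` conj_by G x A = conj_by G x A" .
    moreover have "conj_by G x A \<in> conj_class G (carrier G) A"
      unfolding conj_class_def by (rule imageI[OF x(1)])
    ultimately show "\<exists>B\<in>conj_class G (carrier G) A. F ` B = B" by (rule bexI)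
  next
    fix B assume B: "B \<in> conj_class G (carrier G) A" "B \<subseteq> fixed_points G F"
    have BG: "B \<subseteq> carrier G" using B(2) by (auto simp: fixed_points_def)
    interpret lang_conjugacy G F B "identity_component n (centralizer G B)"
      by (intro lang_conjugacy.intro lang_conjugacy_axioms.intro G_group F_hom BG B(2)
          component_subgroup[OF BG] component_connected(2)[OF BG] component_normal[OF BG] lang
          lang_on_component_conjugate[OF BG])
    show "let N = normalizer G B; C = centralizer G B; Q = identity_component n C;
            GF = fixed_points G F
        in \<exists>\<Phi>. bij_betw \<Phi>
              {X \<in> F_class G F N Q ` N. X \<subseteq> (\<lambda>u. u <# Q) ` C}
              {conj_class G GF B' | B'. B' \<in> conj_class G (carrier G) B \<and> B' \<subseteq> GF} \<and>
            (\<forall>w\<in>C.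
              (\<exists>g\<in>carrier G. (inv g \<otimes> F g) <# Q = w <# Q) \<and>
              (\<forall>g\<in>carrier G. (inv g \<otimes> F g) <# Q = w <# Q \<longrightarrow>
                 conj_by G g B \<subseteq> GF \<and>
                 \<Phi> (F_class G F N Q (inv w)) = conj_class G GF (conj_by G g B)))"
      unfolding Let_def by (rule classes_bijection)
  qed
qed

end
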